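(* Assume: (F) $F_0$ has bounded support $\mathcal{S}_0=[0,M_0]$ and is strictly increasing on $\mathcal{S}_0$ with density $f_0$, strictly staying away from zero on $\mathcal{S}_0$; (G) $G$ has support $[0,\infty)$, is strictly increasing on $\mathcal{S}_0$ with density $g$ staying away from zero on $\mathcal{S}_0$, and $g'$ is bounded on $\mathcal{S}_0$. Fix $t>0$ such that $f_0''$ and $g''$ exist and are continuous at $t$ and $g(t)f_0'(t)+2f_0(t)g'(t)\ne0$. Let $h=cn^{-1/5}$ ($c>0$) be the bandwidth used in the definition of $\hat g_n$ and $\hat g_{n,1}$. Then, as $n\to\infty$, $$n^{2/5}\big(\hat F_n^{\mathrm{MS}}(t)-F_0(t)\big)\rightsquigarrow\mathcal{N}(\mu_{F,\mathrm{MS}},\sigma^2_{F,\mathrm{MS}}),$$ where $$\mu_{F,\mathrm{MS}}=\tfrac12c^2m_2(k)\Big\{f_0'(t)+2\frac{f_0(t)g'(t)}{g(t)}\Big\},\qquad \sigma^2_{F,\mathrm{MS}}=c^{-1}\frac{F_0(t)(1-F_0(t))}{g(t)}\int k(u)^2\,du.$$ This also holds if $\hat F_n^{\mathrm{MS}}$ is replaced by $\hat F_n^{\mathrm{naive}}$. For fixed $t$, the asymptotically MSE-optimal bandwidth for $\hat F_n^{\mathrm{MS}}(t)$ is $h_{n,F,\mathrm{MS}}=c_{F,\mathrm{MS}}n^{-1/5}$, where $$c_{F,\mathrm{MS}}=\Big\{\frac{F_0(t)(1-F_0(t))}{g(t)}\int k(u)^2\,du\Big\}^{1/5}\Big\{m_2^2(k)\Big\{f_0'(t)+2\frac{f_0(t)g'(t)}{g(t)}\Big\}^2\Big\}^{-1/5};$$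 that is, $c_{F,\mathrm{MS}}$ minimizes the asymptotic mean squared error $\mu_{F,\mathrm{MS}}^2+\sigma_{F,\mathrm{MS}}^2$ over $c>0$.
   Context: Current status model: $X_1,X_2,\dots$ are i.i.d. with distribution function $F_0$ on $[0,\infty)$, and, independently, $T_1,T_2,\dots$ are i.i.d. with distribution function $G$ on $[0,\infty)$ having Lebesgue density $g$. One observes $(T_i,\Delta_i)$, $1\le i\le n$, with $\Delta_i=1_{\{X_i\le T_i\}}$. Kernel: $k$ is a probability density with support $[-1,1]$, symmetric and twice continuously differentiable on $\mathbb{R}$; $m_2(k)=\int u^2k(u)\,du$; $k_h(u)=h^{-1}k(u/h)$. Kernel estimators: for $i=0,1$ let $\mathbb{G}_{n,i}(t)=\frac1n\sum_{j=1}^n1_{[0,t]\times\{i\}}(T_j,\Delta_j)$. Put $\hat g_{n,i}(t)=\int k_h(t-u)\,d\mathbb{G}_{n,i}(u)$ for $t>h$, and for $0\le t\le h$, with $\beta=t/h$, use the boundary-corrected estimator $\hat g_{n,i}(t)=\int h^{-1}k^\beta((t-u)/h)\,d\mathbb{G}_{n,i}(u)$, where $$k^\beta(u)=\frac{\nu_{2,\beta}(k)-\nu_{1,\beta}(k)u}{\nu_{0,\beta}(k)\nu_{2,\beta}(k)-\nu_{1,\beta}(k)^2}\,k(u)1_{(-1,\beta)}(u),\qquad \nu_{i,\beta}(k)=\int_{-1}^\beta u^ik(u)\,du.$$ Put $\hat g_n=\hat g_{n,0}+\hat g_{n,1}$, $\hat G_{n,i}(t)=\int_{[0,t]}\hat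 g_{n,i}(u)\,du$, $\hat G_n(t)=\int_{[0,t]}\hat g_n(u)\,du$. The naive estimator is $\hat F_n^{\mathrm{naive}}(t)=\hat g_{n,1}(t)/\hat g_n(t)$. The maximum smoothed likelihood estimator $\hat F_n^{\mathrm{MS}}(t)$ is the right-continuous slope of the lower convex hull of the parameterized curve $t\mapsto(\hat G_n(t),\hat G_{n,1}(t))$, $t\in[0,\tau]$, $\tau=\sup\{t\ge0:\hat g_{n,0}(t)+\hat g_{n,1}(t)>0\}$, evaluated at the point with $x$-coordinate $\hat G_n(t)$. The symbol $\rightsquigarrow$ denotes convergence in distribution. *)

theory Defs
  imports "HOL-Probability.Probability"
begin

definition measure_support :: "real measure \<Rightarrow> real set" where
  "measure_support \<mu> = {x. \<forall>U. open U \<and> x \<in> U \<longrightarrow> 0 < emeasure \<mu> U}"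

text \<open>Continuity of the second derivative at \<open>t\<close> presupposes that it exists in a
  neighbourhood of \<open>t\<close>; \<^const>\<open>deriv\<close> is unspecified where the derivative does not exist.\<close>

definition cont_second_deriv_at :: "(real \<Rightarrow> real) \<Rightarrow> real \<Rightarrow> bool" where
  "cont_second_deriv_at f t \<longleftrightarrow>
     (\<forall>\<^sub>F x in nhds t. f differentiable (at x) \<and> deriv f differentiable (at x)) \<and>
     isCont (deriv (deriv f)) t"

definition smoothing_kernel :: "(real \<Rightarrow> real) \<Rightarrow> bool" where
  "smoothing_kernel k \<longleftrightarrow>
     (\<forall>u. 0 \<le> k u) \<and> integrable lborel k \<and> (LINT u|lborel. k u) = 1 \<and>
     closure {u. k u \<noteq> 0} = {-1..1} \<and>
     (\<forall>u. k (- u) = k u) \<and>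
     (\<forall>u. cont_second_deriv_at k u)"

definition second_moment :: "(real \<Rightarrow> real) \<Rightarrow> real" where
  "second_moment k = (LINT u|lborel. u\<^sup>2 * k u)"

definition scaled_kernel :: "(real \<Rightarrow> real) \<Rightarrow> real \<Rightarrow> real \<Rightarrow> real" where
  "scaled_kernel k h u = k (u / h) / h"

definition partial_moment :: "(real \<Rightarrow> real) \<Rightarrow> nat \<Rightarrow> real \<Rightarrow> real" where
  "partial_moment k i \<beta> = (LINT u:{-1..\<beta>}|lborel. u ^ i * k u)"

definition boundary_kernel :: "(real \<Rightarrow> real) \<Rightarrow> real \<Rightarrow> real \<Rightarrow> real" where
  "boundary_kernel k \<beta> u =
     (partial_moment k 2 \<beta> - partial_moment k 1 \<beta> * u) /
     (partial_moment k 0 \<beta> * partial_moment k 2 \<beta> - (partial_moment k 1 \<beta>)\<^sup>2) *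
     k u * indicator {-1<..<\<beta>} u"

text \<open>In the following, a sample of size \<open>n\<close> is given by \<open>(T j, D j)\<close> for \<open>j < n\<close>.\<close>

definition emp_subdist ::
    "nat \<Rightarrow> (nat \<Rightarrow> real) \<Rightarrow> (nat \<Rightarrow> nat) \<Rightarrow> nat \<Rightarrow> real \<Rightarrow> real" where
  "emp_subdist n T D i t = (\<Sum>j<n. indicator ({0..t} \<times> {i}) (T j, D j)) / real n"

text \<open>\<^const>\<open>interval_measure\<close> is the Lebesgue-Stieltjes measure of a distribution function.
  Only arguments \<open>t \<ge> 0\<close> are relevant.\<close>

definition dens_est ::
    "(real \<Rightarrow> real) \<Rightarrow> real \<Rightarrow> nat \<Rightarrow> (nat \<Rightarrow> real) \<Rightarrow> (nat \<Rightarrow> nat) \<Rightarrow> nat \<Rightarrow> real \<Rightarrow> real" where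
  "dens_est k h n T D i t =
     (if t > h
      then LINT u|interval_measure (emp_subdist n T D i). scaled_kernel k h (t - u)
      else LINT u|interval_measure (emp_subdist n T D i).
             boundary_kernel k (t / h) ((t - u) / h) / h)"

definition dens_est_total ::
    "(real \<Rightarrow> real) \<Rightarrow> real \<Rightarrow> nat \<Rightarrow> (nat \<Rightarrow> real) \<Rightarrow> (nat \<Rightarrow> nat) \<Rightarrow> real \<Rightarrow> real" where
  "dens_est_total k h n T D t = dens_est k h n T D 0 t + dens_est k h n T D 1 t"

definition cum_est ::
    "(real \<Rightarrow> real) \<Rightarrow> real \<Rightarrow> nat \<Rightarrow> (nat \<Rightarrow> real) \<Rightarrow> (nat \<Rightarrow> nat) \<Rightarrow> nat \<Rightarrow> real \<Rightarrow> real" where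
  "cum_est k h n T D i t = (LINT u:{0..t}|lborel. dens_est k h n T D i u)"

definition cum_est_total ::
    "(real \<Rightarrow> real) \<Rightarrow> real \<Rightarrow> nat \<Rightarrow> (nat \<Rightarrow> real) \<Rightarrow> (nat \<Rightarrow> nat) \<Rightarrow> real \<Rightarrow> real" where
  "cum_est_total k h n T D t = (LINT u:{0..t}|lborel. dens_est_total k h n T D u)"

definition F_naive ::
    "(real \<Rightarrow> real) \<Rightarrow> real \<Rightarrow> nat \<Rightarrow> (nat \<Rightarrow> real) \<Rightarrow> (nat \<Rightarrow> nat) \<Rightarrow> real \<Rightarrow> real" where
  "F_naive k h n T D t = dens_est k h n T D 1 t / dens_est_total k h n T D t"

definition lower_hull :: "(real \<times> real) set \<Rightarrow> real \<Rightarrow> real" where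
  "lower_hull C x = Inf {y. (x, y) \<in> convex hull C}"

text \<open>The right derivative, which for a convex function is its right-continuous slope.\<close>

definition right_slope :: "(real \<Rightarrow> real) \<Rightarrow> real \<Rightarrow> real" where
  "right_slope \<phi> x = Lim (at_right x) (\<lambda>y. (\<phi> y - \<phi> x) / (y - x))"

definition right_end ::
    "(real \<Rightarrow> real) \<Rightarrow> real \<Rightarrow> nat \<Rightarrow> (nat \<Rightarrow> real) \<Rightarrow> (nat \<Rightarrow> nat) \<Rightarrow> real" where
  "right_end k h n T D = Sup {t. 0 \<le> t \<and> 0 < dens_est k h n T D 0 t + dens_est k h n T D 1 t}"

text \<open>The value is unspecified where the hull has no point to the right of the evaluation
  point, or no finite right slope there.\<close>

definition F_MS ::
    "(real \<Rightarrow> real) \<Rightarrow> real \<Rightarrow> nat \<Rightarrow> (nat \<Rightarrow> real) \<Rightarrow> (nat \<Rightarrow> nat) \<Rightarrow> real \<Rightarrow> real" where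
  "F_MS k h n T D t =
     right_slope
       (lower_hull ((\<lambda>s. (cum_est_total k h n T D s, cum_est k h n T D 1 s)) `
                    {0..right_end k h n T D}))
       (cum_est_total k h n T D t)"

definition bandwidth :: "real \<Rightarrow> nat \<Rightarrow> real" where
  "bandwidth c n = c * real n powr (- 1 / 5)"

definition asymp_mean ::
    "(real \<Rightarrow> real) \<Rightarrow> (real \<Rightarrow> real) \<Rightarrow> (real \<Rightarrow> real) \<Rightarrow> real \<Rightarrow> real \<Rightarrow> real" where
  "asymp_mean k f\<^sub>0 g t c =
     1 / 2 * c\<^sup>2 * second_moment k * (deriv f\<^sub>0 t + 2 * (f\<^sub>0 t * deriv g t / g t))"

definition asymp_var ::
    "(real \<Rightarrow> real) \<Rightarrow> (real \<Rightarrow> real) \<Rightarrow> (real \<Rightarrow> real) \<Rightarrow> real \<Rightarrow> real \<Rightarrow> real" where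
  "asymp_var k F\<^sub>0 g t c =
     inverse c * (F\<^sub>0 t * (1 - F\<^sub>0 t) / g t) * (LINT u|lborel. (k u)\<^sup>2)"

definition optimal_const ::
    "(real \<Rightarrow> real) \<Rightarrow> (real \<Rightarrow> real) \<Rightarrow> (real \<Rightarrow> real) \<Rightarrow> (real \<Rightarrow> real) \<Rightarrow> real \<Rightarrow> real" where
  "optimal_const k F\<^sub>0 f\<^sub>0 g t =
     (F\<^sub>0 t * (1 - F\<^sub>0 t) / g t * (LINT u|lborel. (k u)\<^sup>2)) powr (1 / 5) *
     ((second_moment k)\<^sup>2 * (deriv f\<^sub>0 t + 2 * (f\<^sub>0 t * deriv g t / g t))\<^sup>2) powr (- 1 / 5)"

text \<open>\<^const>\<open>normal_density\<close> is parameterised by the standard deviation, here by the variance.\<close>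

definition normal_law :: "real \<Rightarrow> real \<Rightarrow> real measure" where
  "normal_law \<mu> v = density lborel (normal_density \<mu> (sqrt v))"

end

theory Submission
  imports Defs
begin

text \<open>The naive estimator at \<open>t\<close> is a ratio of two kernel averages, but its limit law can be
found without treating the ratio. As soon as the denominator is positive, \<open>n powr (2/5) *
(F_naive - F\<^sub>0 t) \<le> x\<close> says that a sum of \<open>n\<close> independent summands
\<open>k\<^sub>h (t - T j) * (\<Delta> j - F\<^sub>0 t - x * n powr (-2/5))\<close> is nonpositive
(\<open>naive_iff_sum\<close>). With a bandwidth of order \<open>n powr (-1/5)\<close> the mean of
the sum, governed by the second order Taylor polynomial of \<open>(F\<^sub>0 - F\<^sub>0 t) *
g\<close>, and its variance both have finite limits (\<open>summand_mean\<close>,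
\<open>summand_variance\<close>), and the central limit theorem for triangular arrays with bounded
entries (\<open>triangular_clt\<close>) gives the normal law.

The maximum smoothed likelihood estimator equals the naive one with probability tending to one
(\<open>F_MS_eq_F_naive_whp\<close>). The right slope of the convex hull at the point with parameter
\<open>t\<close> is the slope \<open>r\<close> of the curve itself once the whole curve lies above
its tangent there (\<open>right_slope_lower_hull_support\<close>). The height of the curve over the
tangent is \<open>\<integral>\<^sub>t\<^sup>s (g\<^sub>1 - r g)\<close>, written with the density
estimators. For \<open>s\<close> away from \<open>t\<close> it converges uniformly to
\<open>\<integral>\<^sub>t\<^sup>s (F\<^sub>0 - F\<^sub>0 t) dG\<close>, which is bounded away from
\<open>0\<close> (\<open>cum_est_uniform\<close>, \<open>drift_away_from_t\<close>). Only integrated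
estimators occur in this step: the density estimators need not converge at the end points of the
support, and the boundary kernel, which may take negative values, enters through a bound. For
\<open>s\<close> near \<open>t\<close> the integrand vanishes at \<open>t\<close> and is increasing,
because its derivative \<open>g\<^sub>1' - r g'\<close> is uniformly close to \<open>f\<^sub>0 t * g
t > 0\<close> (\<open>density_slope_uniform\<close>, \<open>tangent_near_t\<close>).

A coincidence on events of large probability transfers the limit law only between random variables,
so the hull estimator must be shown to be measurable. By duality the hull is a countable supremum of
countable infima of affine functions of the curve (\<open>lower_hull_eq_dual_hull\<close>), and its
right slope, including the unspecified value where there is none, is a limit along a fixed sequence
(\<open>right_slope_lower_hull_eq_lim\<close>).

The nondegeneracy condition places \<open>t\<close> in the interior of the support of the event
times, since their density is smooth at \<open>t\<close>, bounded below on the support and zero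
beyond it. Finally, the asymptotic mean squared error has the form \<open>a * c ^ 4 / 4 + V /
c\<close>; its excess over the value at the optimal constant \<open>c0\<close> contains the factor
\<open>(c - c0)\<^sup>2\<close> (\<open>optimal_bandwidth\<close>).\<close>

section \<open>Lower convex hulls of compact plane sets\<close>

text \<open>The biconjugate of the hull. Slopes range over the rationals so that the supremum is countable; it
is \<open>\<infinity>\<close> exactly outside the projection of the convex hull to the first axis.\<close>

definition dual_hull :: "(real \<times> real) set \<Rightarrow> real \<Rightarrow> ereal" where
  "dual_hull C x = (SUP m\<in>\<rat>. INF c\<in>C. ereal (snd c - m * (fst c - x)))"

text \<open>Every half-plane above an affine minorant of \<open>C\<close> contains the convex hull.\<close>

lemma dual_hull_le:
  assumes "(x, y) \<in> convex hull C"
  shows "dual_hull C x \<le> ereal y"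
  unfolding dual_hull_def
proof (rule SUP_least)
  fix m :: real
  show "(INF c\<in>C. ereal (snd c - m * (fst c - x))) \<le> ereal y"
  proof (rule ccontr)
    assume "\<not> ?thesis"
    then have less: "ereal y < (INF c\<in>C. ereal (snd c - m * (fst c - x)))" by simp
    have "C \<subseteq> {c. inner (- m, 1) c > y - m * x}"
    proof
      fix c assume "c \<in> C"
      from less_le_trans[OF less INF_lower[OF this]]
      show "c \<in> {c. inner (- m, 1) c > y - m * x}"
        by (cases c) (auto simp: algebra_simps)
    qed
    then have "convex hull C \<subseteq> {c. inner (- m, 1) c > y - m * x}"
      by (rule hull_minimal) (rule convex_halfspace_gt)
    with assms show False by (auto simp: algebra_simps)
  qed
qed

text \<open>A vertical ray that misses the convex hull is strictly separated from it. The separating line may be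
vertical; compactness leaves room to tilt it, and then to make its slope rational.\<close>

lemma dual_hull_ge:
  assumes C: "compact C" "C \<noteq> {}" and out: "\<And>y. y \<le> b \<Longrightarrow> (x, y) \<notin> convex hull C"
  shows "ereal b \<le> dual_hull C x"
proof -
  have "bounded C" using C by (simp add: compact_imp_bounded)
  then obtain B where B: "B > 0" "\<And>c. c \<in> C \<Longrightarrow> norm c \<le> B" by (auto simp: bounded_pos)
  have B1: "\<bar>fst c\<bar> \<le> B" "\<bar>snd c\<bar> \<le> B" if "c \<in> C" for c
    using B(2)[OF that] norm_fst_le[of "fst c" "snd c"] norm_snd_le[of "snd c" "fst c"] by auto
  have "convex ({x} \<times> {..b})" "closed ({x} \<times> {..b})" by (intro convex_Times closed_Times; simp)+
  moreover have "convex hull C \<inter> ({x} \<times> {..b}) = {}" using out by auto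
  ultimately obtain a \<beta> where ab: "\<And>c. c \<in> convex hull C \<Longrightarrow> inner a c < \<beta>"
      "\<And>c. c \<in> {x} \<times> {..b} \<Longrightarrow> \<beta> < inner a c"
    using separating_hyperplane_compact_closed[of "convex hull C" "{x} \<times> {..b}"] C
    by (metis compact_convex_hull convex_convex_hull convex_hull_eq_empty)
  obtain a1 a2 where a: "a = (a1, a2)" by (cases a)
  have sep1: "a1 * fst c + a2 * snd c < \<beta>" if "c \<in> C" for c
    using ab(1)[of c] hull_inc[OF that, of convex] a by (cases c) auto
  have sep2: "\<beta> < a1 * x + a2 * y" if "y \<le> b" for y
    using ab(2)[of "(x, y)"] that a by auto
  have a2: "a2 \<le> 0"
  proof (rule ccontr)
    assume "\<not> a2 \<le> 0"
    then have "\<beta> < a1 * x + a2 * min b ((\<beta> - a1 * x) / a2)" and "a2 > 0" using sep2 by auto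
    moreover have "a2 * min b ((\<beta> - a1 * x) / a2) \<le> a2 * ((\<beta> - a1 * x) / a2)"
      using \<open>a2 > 0\<close> by (intro mult_left_mono) auto
    ultimately show False by auto
  qed
  have "\<exists>m. \<forall>c\<in>C. b < snd c - m * (fst c - x)"
  proof (cases "a2 = 0")
    case False
    then have neg: "a2 < 0" using a2 by simp
    have "b < snd c - (- a1 / a2) * (fst c - x)" if "c \<in> C" for c
    proof -
      have "a2 * (snd c - (- a1 / a2) * (fst c - x)) = a2 * snd c + a1 * fst c - a1 * x"
        using neg by (simp add: field_simps)
      also have "\<dots> < a2 * b" using sep1[OF that] sep2[of b] by simp
      finally show ?thesis using neg by (simp add: mult_less_cancel_left)
    qed
    then show ?thesis by blast
  next
    case True
    \<comment> \<open>The separating line is vertical with gap at least \<open>\<gamma>\<close>; a tilt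
        by \<open>e\<close> uses up less than that.\<close>
    define \<gamma> where "\<gamma> = a1 * x - \<beta>"
    have \<gamma>: "\<gamma> > 0" using sep2[of b] True by (simp add: \<gamma>_def)
    define e where "e = \<gamma> / (B + \<bar>b\<bar> + 1)"
    have e: "e > 0" using \<gamma> B by (simp add: e_def)
    have eq: "e * (B + \<bar>b\<bar> + 1) = \<gamma>" using B by (simp add: e_def)
    have "b < snd c - (a1 / e) * (fst c - x)" if "c \<in> C" for c
    proof -
      have "e * (b - snd c) \<le> e * (B + \<bar>b\<bar>)" using e B1[OF that] by (intro mult_left_mono) auto
      also have "\<dots> < \<gamma>" using eq e by (simp add: algebra_simps)
      also have "\<gamma> < a1 * x - a1 * fst c" using sep1[OF that] True by (simp add: \<gamma>_def)
      finally have "e * b < e * (snd c - (a1 / e) * (fst c - x))"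
        using e by (simp add: algebra_simps)
      then show ?thesis using e by simp
    qed
    then show ?thesis by blast
  qed
  then obtain m where m: "\<And>c. c \<in> C \<Longrightarrow> b < snd c - m * (fst c - x)" by blast
  show ?thesis
  proof (rule ereal_le_epsilon2)
    fix e :: real assume e: "0 < e"
    define \<delta> where "\<delta> = e / (B + \<bar>x\<bar> + 1)"
    have \<delta>: "\<delta> > 0" "\<delta> * (B + \<bar>x\<bar> + 1) = e" using e B by (auto simp: \<delta>_def)
    obtain q where q: "q \<in> \<rat>" "m < q" "q < m + \<delta>" using Rats_dense_in_real[of m "m + \<delta>"] \<delta> by auto
    have "ereal (b - e) \<le> (INF c\<in>C. ereal (snd c - q * (fst c - x)))"
    proof (rule INF_greatest)
      fix c assume c: "c \<in> C"
      have "(q - m) * (fst c - x) \<le> \<bar>q - m\<bar> * \<bar>fst c - x\<bar>" by (metis abs_ge_self abs_mult)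
      also have "\<dots> \<le> \<delta> * (B + \<bar>x\<bar> + 1)" using q B1[OF c] \<delta> by (intro mult_mono) auto
      finally have "(q - m) * (fst c - x) \<le> e" using \<delta> by simp
      then show "ereal (b - e) \<le> ereal (snd c - q * (fst c - x))"
        using m[OF c] by (simp add: algebra_simps)
    qed
    also have "\<dots> \<le> dual_hull C x" unfolding dual_hull_def by (rule SUP_upper[OF q(1)])
    finally show "ereal b \<le> dual_hull C x + ereal e"
      by (cases "dual_hull C x") (auto simp: algebra_simps)
  qed
qed

lemma lower_hull_attained:
  assumes C: "compact C" and x: "x \<in> fst ` (convex hull C)"
  shows "(x, lower_hull C x) \<in> convex hull C"
    and "\<And>y. (x, y) \<in> convex hull C \<Longrightarrow> lower_hull C x \<le> y"
proof -
  let ?S = "{y. (x, y) \<in> convex hull C}"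
  have eq: "?S = snd ` (convex hull C \<inter> {x} \<times> UNIV)" by force
  have "compact (convex hull C \<inter> {x} \<times> UNIV)"
    by (intro compact_Int_closed compact_convex_hull C closed_Times) auto
  then have cS: "compact ?S" unfolding eq by (intro compact_continuous_image continuous_intros)
  have ne: "?S \<noteq> {}" using x by force
  have bdd: "bdd_below ?S" using cS by (simp add: bounded_imp_bdd_below compact_imp_bounded)
  have "Inf ?S \<in> ?S" using ne bdd compact_imp_closed[OF cS] by (rule closed_contains_Inf)
  then show "(x, lower_hull C x) \<in> convex hull C" by (simp add: lower_hull_def)
  show "lower_hull C x \<le> y" if "(x, y) \<in> convex hull C" for y
    unfolding lower_hull_def using that bdd by (intro cInf_lower) auto
qed

lemma lower_hull_outside:
  assumes "x \<notin> fst ` (convex hull C)"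
  shows "lower_hull C x = Inf {}"
proof -
  have "{y. (x, y) \<in> convex hull C} = {}" using assms by force
  then show ?thesis by (simp add: lower_hull_def)
qed

text \<open>Outside the projection of the convex hull the infimum defining \<^const>\<open>lower_hull\<close> is
taken over the empty set, and the dual value is infinite.\<close>

lemma lower_hull_eq_dual_hull:
  assumes C: "compact C" "C \<noteq> {}"
  shows "lower_hull C x = (if dual_hull C x = \<infinity> then Inf {} else real_of_ereal (dual_hull C x))"
proof (cases "x \<in> fst ` (convex hull C)")
  case True
  let ?y = "lower_hull C x"
  note y = lower_hull_attained[OF C(1) True]
  have below: "ereal b \<le> dual_hull C x" if "b < ?y" for b
    using y(2) that by (intro dual_hull_ge C) (meson le_less_trans not_less)
  have "ereal ?y \<le> dual_hull C x"
  proof (rule ereal_le_epsilon2)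
    fix e :: real assume "e > 0"
    then have "ereal (?y - e) \<le> dual_hull C x" by (intro below) simp
    then show "ereal ?y \<le> dual_hull C x + ereal e"
      by (cases "dual_hull C x") (auto simp: algebra_simps)
  qed
  with dual_hull_le[OF y(1)] have "dual_hull C x = ereal ?y" by (rule antisym[OF _ ])
  then show ?thesis by simp
next
  case False
  have "ereal b \<le> dual_hull C x" for b
    using False by (intro dual_hull_ge C) force
  then have "dual_hull C x = \<infinity>" by (meson ereal_top)
  with lower_hull_outside[OF False] show ?thesis by simp
qed

lemma convex_on_lower_hull:
  assumes "compact C"
  shows "convex_on (fst ` (convex hull C)) (lower_hull C)"
proof (intro convex_onI)
  fix u x y :: real
  assume u: "0 < u" "u < 1" and x: "x \<in> fst ` (convex hull C)" and y: "y \<in> fst ` (convex hull C)"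
  have "(1 - u) *\<^sub>R (x, lower_hull C x) + u *\<^sub>R (y, lower_hull C y) \<in> convex hull C"
    using u lower_hull_attained(1)[OF assms x] lower_hull_attained(1)[OF assms y]
    by (intro convexD[OF convex_convex_hull]) auto
  then have mem: "((1 - u) *\<^sub>R x + u *\<^sub>R y, (1 - u) * lower_hull C x + u * lower_hull C y) \<in> convex hull C"
    by simp
  then have "(1 - u) *\<^sub>R x + u *\<^sub>R y \<in> fst ` (convex hull C)" by force
  from lower_hull_attained(2)[OF assms this mem]
  show "lower_hull C ((1 - u) *\<^sub>R x + u *\<^sub>R y) \<le> (1 - u) * lower_hull C x + u * lower_hull C y" .
qed (intro convex_linear_image convex_convex_hull linear_fst)

text \<open>For monotone functions a one-sided limit can be read off a single sequence.\<close>

lemma tendsto_at_right_0_iff_sequence: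
  fixes f :: "real \<Rightarrow> real"
  assumes "\<epsilon> > 0" and mono: "mono_on {0<..<\<epsilon>} f \<or> antimono_on {0<..<\<epsilon>} f"
  shows "(f \<longlongrightarrow> l) (at_right 0) \<longleftrightarrow> (\<lambda>m. f (1 / real (Suc m))) \<longlonglongrightarrow> l"
proof
  have lim: "filterlim (\<lambda>m. 1 / real (Suc m)) (at_right 0) sequentially"
    unfolding filterlim_at using LIMSEQ_Suc[OF lim_1_over_n] by auto
  assume "(f \<longlongrightarrow> l) (at_right 0)"
  from filterlim_compose[OF this lim] show "(\<lambda>m. f (1 / real (Suc m))) \<longlonglongrightarrow> l" .
next
  assume seq: "(\<lambda>m. f (1 / real (Suc m))) \<longlonglongrightarrow> l"
  show "(f \<longlongrightarrow> l) (at_right 0)"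
  proof (rule tendstoI)
    fix e :: real assume "e > 0"
    then obtain N where N: "\<And>m. m \<ge> N \<Longrightarrow> dist (f (1 / real (Suc m))) l < e"
      using seq by (auto simp: lim_sequentially)
    obtain K where K: "1 / real (Suc K) < \<epsilon>" using assms(1) nat_approx_posE by blast
    define L where "L = max N K"
    have L: "L \<ge> N" "1 / real (Suc L) < \<epsilon>"
      using K frac_le[of 1 1 "real (Suc K)" "real (Suc L)"] by (auto simp: L_def)
    have "dist (f x) l < e" if x: "0 < x" "x < 1 / real (Suc L)" for x
    proof -
      obtain J where J: "1 / real (Suc J) < x" using x nat_approx_posE by blast
      have "1 / real (Suc J) < 1 / real (Suc L)" using J x by linarith
      then have JL: "J \<ge> N" using L(1) by (simp add: field_simps)
      have "f (1 / real (Suc J)) \<le> f x \<and> f x \<le> f (1 / real (Suc L)) \<or>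
            f (1 / real (Suc L)) \<le> f x \<and> f x \<le> f (1 / real (Suc J))"
        using mono x J L(2) by (auto simp: monotone_on_def)
      then show ?thesis using N[OF JL] N[OF L(1)] by (auto simp: dist_real_def abs_less_iff)
    qed
    then show "\<forall>\<^sub>F x in at_right 0. dist (f x) l < e"
      unfolding eventually_at_right_field by (intro exI[of _ "1 / real (Suc L)"]) auto
  qed
qed

text \<open>To the right of \<open>x\<close> the hull is either convex or, beyond the projection, constant; in
both cases the difference quotients are eventually monotone. Hence both sides are defined by the
same predicate on limits, so that they agree even where no limit exists.\<close>

lemma right_slope_lower_hull_eq_lim:
  assumes C: "compact C"
  shows "right_slope (lower_hull C) x =
    lim (\<lambda>m. (lower_hull C (x + 1 / real (Suc m)) - lower_hull C x) / (1 / real (Suc m)))"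
proof -
  let ?\<phi> = "lower_hull C" and ?D = "fst ` (convex hull C)"
  let ?Q = "\<lambda>\<delta>. (?\<phi> (x + \<delta>) - ?\<phi> x) / \<delta>"
  have "\<exists>\<epsilon>>0. mono_on {0<..<\<epsilon>} ?Q \<or> antimono_on {0<..<\<epsilon>} ?Q"
  proof (cases "\<exists>\<epsilon>>0. ?D \<inter> {x<..<x + \<epsilon>} = {}")
    case True
    then obtain \<epsilon> where \<epsilon>: "\<epsilon> > 0" "?D \<inter> {x<..<x + \<epsilon>} = {}" by blast
    have Q: "?Q \<delta> = (Inf {} - ?\<phi> x) / \<delta>" if "\<delta> \<in> {0<..<\<epsilon>}" for \<delta>
    proof -
      have "x + \<delta> \<notin> ?D" using \<epsilon> that by fastforce
      then show ?thesis using lower_hull_outside by simp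
    qed
    show ?thesis
    proof (cases "Inf {} - ?\<phi> x \<ge> 0")
      case True
      then have "antimono_on {0<..<\<epsilon>} ?Q" by (auto simp: monotone_on_def Q intro!: divide_left_mono)
      with \<epsilon> show ?thesis by blast
    next
      case False
      then have "mono_on {0<..<\<epsilon>} ?Q" by (auto simp: monotone_on_def Q intro!: divide_left_mono_neg)
      with \<epsilon> show ?thesis by blast
    qed
  next
    case False
    have cD: "compact ?D" by (intro compact_continuous_image continuous_intros compact_convex_hull C)
    have intD: "is_interval ?D"
      by (simp add: is_interval_convex_1 convex_linear_image[OF linear_fst] convex_convex_hull)
    have "x \<in> closure ?D"
      unfolding closure_approachable
    proof (intro allI impI)
      fix e :: real assume "e > 0"
      then obtain y where "y \<in> ?D" "x < y" "y < x + e"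
        using False by (metis disjoint_iff greaterThanLessThan_iff)
      then show "\<exists>y\<in>?D. dist y x < e" by (intro bexI[of _ y]) (auto simp: dist_real_def)
    qed
    then have xD: "x \<in> ?D" using cD by (simp add: compact_imp_closed)
    obtain z where z: "z \<in> ?D" "x < z"
      using False zero_less_one by (metis disjoint_iff greaterThanLessThan_iff)
    have sub: "x + \<delta> \<in> ?D" if "\<delta> \<in> {0..<z - x}" for \<delta>
      using that by (intro mem_is_interval_1_I[OF intD xD z(1)]) auto
    have "mono_on {0<..<z - x} ?Q"
    proof (rule mono_onI)
      fix r s assume rs: "r \<in> {0<..<z - x}" "s \<in> {0<..<z - x}" "r \<le> s"
      show "?Q r \<le> ?Q s"
      proof (cases "r = s")
        case False
        then have "(?\<phi> x - ?\<phi> (x + r)) / (x - (x + r)) \<le> (?\<phi> x - ?\<phi> (x + s)) / (x - (x + s))"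
          using rs sub
          by (intro convex_on_slope_le(1)[OF convex_on_lower_hull[OF C] xD]) auto
        then show ?thesis using rs by (simp add: field_simps)
      qed simp
    qed
    with z show ?thesis by (intro exI[of _ "z - x"]) auto
  qed
  then obtain \<epsilon> where \<epsilon>: "\<epsilon> > 0" "mono_on {0<..<\<epsilon>} ?Q \<or> antimono_on {0<..<\<epsilon>} ?Q" by blast
  have "((\<lambda>y. (?\<phi> y - ?\<phi> x) / (y - x)) \<longlongrightarrow> l) (at_right x) \<longleftrightarrow>
     (\<lambda>m. ?Q (1 / real (Suc m))) \<longlonglongrightarrow> l" for l
    using tendsto_at_right_0_iff_sequence[OF \<epsilon>]
    by (subst at_right_to_0) (simp add: filterlim_filtermap add.commute)
  then show ?thesis unfolding right_slope_def t2_space_class.Lim_def by simp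
qed

text \<open>Continuity of the curve reduces the infimum over the curve to rational parameters, which makes the
dual expression of the hull measurable in \<open>\<omega>\<close>.\<close>

lemma measurable_right_slope_lower_hull:
  fixes px py :: "'w \<Rightarrow> real \<Rightarrow> real"
  assumes cont: "\<And>\<omega>. continuous_on {0..} (px \<omega>)" "\<And>\<omega>. continuous_on {0..} (py \<omega>)"
    and comp: "\<And>\<omega>. compact ((\<lambda>s. (px \<omega> s, py \<omega> s)) ` {0..})"
    and [measurable]: "\<And>s. (\<lambda>\<omega>. px \<omega> s) \<in> borel_measurable N" "\<And>s. (\<lambda>\<omega>. py \<omega> s) \<in> borel_measurable N"
      "x \<in> borel_measurable N"
  shows "(\<lambda>\<omega>. right_slope (lower_hull ((\<lambda>s. (px \<omega> s, py \<omega> s)) ` {0..})) (x \<omega>)) \<in> borel_measurable N"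
proof -
  let ?C = "\<lambda>\<omega>. (\<lambda>s. (px \<omega> s, py \<omega> s)) ` {0..}"
  have inf: "(INF c\<in>?C \<omega>. ereal (snd c - m * (fst c - z))) =
      (INF s\<in>\<rat>\<inter>{0..}. ereal (py \<omega> s - m * (px \<omega> s - z)))" for \<omega> m z
  proof (rule antisym)
    show "(INF c\<in>?C \<omega>. ereal (snd c - m * (fst c - z))) \<le> (INF s\<in>\<rat>\<inter>{0..}. ereal (py \<omega> s - m * (px \<omega> s - z)))"
      by (rule INF_mono) force
    show "(INF s\<in>\<rat>\<inter>{0..}. ereal (py \<omega> s - m * (px \<omega> s - z))) \<le> (INF c\<in>?C \<omega>. ereal (snd c - m * (fst c - z)))"
    proof (rule INF_greatest)
      fix c assume "c \<in> ?C \<omega>"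
      then obtain s where s: "s \<ge> 0" "c = (px \<omega> s, py \<omega> s)" by auto
      let ?h = "\<lambda>s. py \<omega> s - m * (px \<omega> s - z)"
      have "continuous_on {0..} ?h" by (intro continuous_intros cont)
      then have h: "(?h \<longlongrightarrow> ?h s) (at s within {0..})" using s by (auto simp: continuous_on_def)
      show "(INF s\<in>\<rat>\<inter>{0..}. ereal (?h s)) \<le> ereal (snd c - m * (fst c - z))"
      proof (rule ereal_le_epsilon2)
        fix e :: real assume "e > 0"
        then obtain d where d: "d > 0" "\<And>y. y \<ge> 0 \<Longrightarrow> y \<noteq> s \<Longrightarrow> dist y s < d \<Longrightarrow> dist (?h y) (?h s) < e"
          using tendstoD[OF h \<open>e > 0\<close>] unfolding eventually_at by auto
        obtain q where q: "q \<in> \<rat>" "s < q" "q < s + d" using Rats_dense_in_real[of s "s + d"] d by auto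
        have "dist (?h q) (?h s) < e" using d(2)[of q] q s by (auto simp: dist_real_def)
        then have "ereal (?h q) \<le> ereal (?h s) + ereal e" by (auto simp: dist_real_def)
        moreover have "(INF s\<in>\<rat>\<inter>{0..}. ereal (?h s)) \<le> ereal (?h q)" using q s by (intro INF_lower) auto
        ultimately have "(INF s\<in>\<rat>\<inter>{0..}. ereal (?h s)) \<le> ereal (?h s) + ereal e"
          by (rule order_trans[rotated])
        then show "(INF s\<in>\<rat>\<inter>{0..}. ereal (?h s)) \<le> ereal (snd c - m * (fst c - z)) + ereal e"
          using s by simp
      qed
    qed
  qed
  have ctble: "countable (\<rat> :: real set)" "countable (\<rat> \<inter> {0::real..})"
    using countable_rat by (auto intro: countable_subset)
  have dual [measurable]: "(\<lambda>\<omega>. dual_hull (?C \<omega>) (z \<omega>)) \<in> borel_measurable N"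
    if [measurable]: "z \<in> borel_measurable N" for z
    unfolding dual_hull_def inf
    by (intro borel_measurable_SUP borel_measurable_INF ctble) measurable
  have [measurable]: "(\<lambda>\<omega>. lower_hull (?C \<omega>) (z \<omega>)) \<in> borel_measurable N"
    if [measurable]: "z \<in> borel_measurable N" for z
  proof -
    have "?C \<omega> \<noteq> {}" for \<omega> by auto
    then show ?thesis by (subst lower_hull_eq_dual_hull[OF comp]) measurable
  qed
  show ?thesis
    by (subst right_slope_lower_hull_eq_lim[OF comp]) measurable
qed

text \<open>Right of \<open>X t\<close> the hull is squeezed between the tangent, which lies below the curve and
hence below the convex hull, and the curve itself, which meets every vertical line close to the
right of \<open>X t\<close>.\<close>

lemma right_slope_lower_hull_support:
  fixes X Y :: "real \<Rightarrow> real"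
  assumes t: "0 \<le> t" "t < \<tau>"
    and contX: "continuous_on {t..\<tau>} X"
    and dX: "(X has_real_derivative d) (at t)" "d > 0"
    and dY: "(Y has_real_derivative r * d) (at t)"
    and line: "\<And>s. s \<in> {0..\<tau>} \<Longrightarrow> Y t + r * (X s - X t) \<le> Y s"
  shows "right_slope (lower_hull ((\<lambda>s. (X s, Y s)) ` {0..\<tau>})) (X t) = r"
proof -
  let ?C = "(\<lambda>s. (X s, Y s)) ` {0..\<tau>}"
  let ?\<phi> = "lower_hull ?C"
  have "?C \<subseteq> {c. inner (- r, 1) c \<ge> Y t - r * X t}" using line by (auto simp: algebra_simps)
  then have "convex hull ?C \<subseteq> {c. inner (- r, 1) c \<ge> Y t - r * X t}"
    by (rule hull_minimal) (rule convex_halfspace_ge)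
  then have below: "Y t + r * (x - X t) \<le> y" if "(x, y) \<in> convex hull ?C" for x y
    using that by (fastforce simp: algebra_simps)
  have on: "(X s, Y s) \<in> convex hull ?C" if "s \<in> {0..\<tau>}" for s
    using that by (intro hull_inc) auto
  have bnd: "bdd_below {y. (x, y) \<in> convex hull ?C}" for x
    using below by (intro bdd_belowI[of _ "Y t + r * (x - X t)"]) auto
  have le: "?\<phi> (X s) \<le> Y s" if "s \<in> {0..\<tau>}" for s
    unfolding lower_hull_def using on[OF that] bnd by (intro cInf_lower) auto
  have ge: "Y t + r * (X s - X t) \<le> ?\<phi> (X s)" if "s \<in> {0..\<tau>}" for s
    unfolding lower_hull_def using on[OF that] below by (intro cInf_greatest) auto
  have at: "?\<phi> (X t) = Y t" using le[of t] ge[of t] t by auto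
  have "((\<lambda>y. (?\<phi> y - ?\<phi> (X t)) / (y - X t)) \<longlongrightarrow> r) (at_right (X t))"
  proof (rule tendstoI)
    fix e :: real assume e: "e > 0"
    have "((\<lambda>s. Y s - (r + e/2) * X s) has_real_derivative r * d - (r + e/2) * d) (at t)"
      using DERIV_diff[OF dY DERIV_cmult[OF dX(1), of "r + e/2"]] by simp
    then obtain e1 where e1: "e1 > 0" "\<And>u. u > 0 \<Longrightarrow> u < e1 \<Longrightarrow> Y t - (r + e/2) * X t > Y (t + u) - (r + e/2) * X (t + u)"
      using DERIV_neg_dec_right[of "\<lambda>s. Y s - (r + e/2) * X s" "r * d - (r + e/2) * d" t] e dX
      by (auto simp: algebra_simps)
    obtain e2 where e2: "e2 > 0" "\<And>u. u > 0 \<Longrightarrow> u < e2 \<Longrightarrow> X t < X (t + u)"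
      using DERIV_pos_inc_right[OF dX] by blast
    define u where "u = min (min e1 e2) (\<tau> - t) / 2"
    have u: "u > 0" "u < e1" "u < e2" "t + u \<le> \<tau>"
      using e1(1) e2(1) t by (auto simp: u_def min_def field_simps)
    have "dist ((?\<phi> y - ?\<phi> (X t)) / (y - X t)) r < e" if y: "X t < y" "y < X (t + u)" for y
    proof -
      have "\<exists>s\<ge>t. s \<le> t + u \<and> X s = y"
        using y u by (intro IVT') (auto intro: continuous_on_subset[OF contX])
      then obtain s where s: "t \<le> s" "s \<le> t + u" "X s = y" by blast
      have "s \<noteq> t" using s y by auto
      then have "Y s - (r + e/2) * X s < Y t - (r + e/2) * X t"
        using e1(2)[of "s - t"] s u by auto
      then have 1: "Y s - Y t < (r + e/2) * (y - X t)" using s by (simp add: field_simps)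
      have "s \<in> {0..\<tau>}" using s u t by auto
      from le[OF this] ge[OF this] have "?\<phi> y \<le> Y s" "Y t + r * (y - X t) \<le> ?\<phi> y" using s by auto
      with 1 have "r * (y - X t) \<le> ?\<phi> y - Y t" "?\<phi> y - Y t < (r + e/2) * (y - X t)" by linarith+
      with y have "r \<le> (?\<phi> y - ?\<phi> (X t)) / (y - X t)" "(?\<phi> y - ?\<phi> (X t)) / (y - X t) < r + e/2"
        by (auto simp: at pos_le_divide_eq pos_divide_less_eq)
      with e show ?thesis by (auto simp: dist_real_def)
    qed
    moreover have "X t < X (t + u)" using e2 u by auto
    ultimately show "\<forall>\<^sub>F y in at_right (X t). dist ((?\<phi> y - ?\<phi> (X t)) / (y - X t)) r < e"
      unfolding eventually_at_right_field by blast
  qed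
  then show ?thesis unfolding right_slope_def by (intro tendsto_Lim) auto
qed

section \<open>Smoothing kernels and the boundary correction\<close>

lemma bounded_of_support:
  fixes f :: "real \<Rightarrow> real"
  assumes "\<And>u. isCont f u" "\<And>u. 1 < \<bar>u\<bar> \<Longrightarrow> f u = 0"
  shows "\<exists>B>0. \<forall>u. \<bar>f u\<bar> \<le> B"
proof -
  have "bounded (f ` {-1..1})"
    by (intro compact_imp_bounded compact_continuous_image continuous_at_imp_continuous_on) (auto simp: assms)
  then obtain B where B: "B > 0" "\<And>u. u \<in> {-1..1} \<Longrightarrow> \<bar>f u\<bar> \<le> B" by (auto simp: bounded_pos)
  have "\<bar>f u\<bar> \<le> B" for u
    using B(1) B(2)[of u] assms(2)[of u] by (cases "1 < \<bar>u\<bar>") (auto simp: abs_le_iff not_less)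
  with B(1) show ?thesis by blast
qed

lemma integrable_bounded_support:
  fixes f :: "real \<Rightarrow> real"
  assumes [measurable]: "f \<in> borel_measurable borel" and "\<And>u. \<bar>f u\<bar> \<le> B" "\<And>u. u \<notin> {a..b} \<Longrightarrow> f u = 0"
  shows "integrable lborel f"
proof (rule Bochner_Integration.integrable_bound)
  show "integrable lborel (\<lambda>u. B * indicator {a..b} u :: real)"
    by (intro integrable_mult_right integrable_real_indicator) (auto simp: emeasure_lborel_Icc_eq)
  show "AE x in lborel. norm (f x) \<le> norm (B * indicator {a..b} x)"
    using assms(2,3) by (intro AE_I2) (auto simp: indicator_def intro: order_trans[OF _ abs_ge_self])
qed simp

lemma integral_pos_continuous:
  fixes f :: "real \<Rightarrow> real"
  assumes cont: "\<And>u. isCont f u" and nn: "\<And>u. 0 \<le> f u" and u0: "a < u0" "u0 < b" "0 < f u0"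
    and int: "integrable lborel (\<lambda>u. indicator {a..b} u * f u)"
  shows "0 < (LINT u|lborel. indicator {a..b} u * f u)"
proof (rule ccontr)
  assume neg: "\<not> ?thesis"
  have "0 \<le> (LINT u|lborel. indicator {a..b} u * f u)" using nn by (intro integral_nonneg_AE) auto
  with neg have "(LINT u|lborel. indicator {a..b} u * f u) = 0" by simp
  then have ae: "AE u in lborel. indicator {a..b} u * f u = 0"
    using integral_nonneg_eq_0_iff_AE[OF int] nn by auto
  have "\<forall>\<^sub>F u in at u0. f u > 0" using cont[of u0] u0(3) by (intro order_tendstoD) (auto simp: isCont_def)
  then obtain d where d: "d > 0" "\<And>u. u \<noteq> u0 \<Longrightarrow> dist u u0 < d \<Longrightarrow> f u > 0"
    unfolding eventually_at by auto
  define e where "e = min d (min (u0 - a) (b - u0))"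
  have e: "e > 0" "e \<le> d" "e \<le> u0 - a" "e \<le> b - u0" using d u0 by (auto simp: e_def)
  have "AE u in lborel. u \<notin> {u0<..<u0 + e}"
    using ae
  proof eventually_elim
    case (elim u)
    show ?case using elim d(2)[of u] e by (auto simp: dist_real_def indicator_def split: if_splits)
  qed
  then have "{u0<..<u0 + e} \<in> null_sets lborel"
    by (subst AE_iff_null_sets) auto
  then show False using e by (simp add: null_sets_def)
qed

text \<open>The weight that an observation at \<open>v\<close> receives in the density estimator at
\<open>s\<close>.\<close>

definition local_weight :: "(real \<Rightarrow> real) \<Rightarrow> real \<Rightarrow> real \<Rightarrow> real \<Rightarrow> real" where
  "local_weight k h s v =
     (if s > h then scaled_kernel k h (s - v) else boundary_kernel k (s / h) ((s - v) / h) / h)"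

definition cum_weight :: "(real \<Rightarrow> real) \<Rightarrow> real \<Rightarrow> real \<Rightarrow> real \<Rightarrow> real" where
  "cum_weight k h s v = (LINT u:{0..s}|lborel. local_weight k h u v)"

locale kernel =
  fixes k :: "real \<Rightarrow> real"
  assumes smoothing: "smoothing_kernel k"
begin

lemma nonneg: "0 \<le> k u" and sym: "k (- u) = k u" and integral_1: "(LINT u|lborel. k u) = 1"
  and closure: "closure {u. k u \<noteq> 0} = {-1..1}"
  using smoothing by (auto simp: smoothing_kernel_def)

lemma smooth: "(k has_real_derivative deriv k u) (at u)"
    "(deriv k has_real_derivative deriv (deriv k) u) (at u)" "isCont (deriv (deriv k)) u"
proof -
  have "cont_second_deriv_at k u" using smoothing by (simp add: smoothing_kernel_def)
  then have "k differentiable (at u) \<and> deriv k differentiable (at u)" "isCont (deriv (deriv k)) u"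
    unfolding cont_second_deriv_at_def by (auto dest: eventually_nhds_x_imp_x)
  then show "(k has_real_derivative deriv k u) (at u)"
    "(deriv k has_real_derivative deriv (deriv k) u) (at u)" "isCont (deriv (deriv k)) u"
    by (auto simp: DERIV_deriv_iff_real_differentiable)
qed

lemma cont: "isCont k u" and deriv_cont: "isCont (deriv k) u"
  using smooth DERIV_isCont by blast+

lemma measurable_k [measurable]: "k \<in> borel_measurable borel" "deriv k \<in> borel_measurable borel"
  using cont deriv_cont by (auto intro!: borel_measurable_continuous_onI continuous_at_imp_continuous_on)

lemma zero_outside: assumes "1 \<le> \<bar>u\<bar>" shows "k u = 0"
proof (rule ccontr)
  assume neq: "k u \<noteq> 0"
  have "\<forall>\<^sub>F x in at u. k x \<noteq> 0" using cont[of u] neq by (intro tendsto_imp_eventually_ne) (auto simp: isCont_def)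
  then obtain d where d: "d > 0" "\<And>x. x \<noteq> u \<Longrightarrow> dist x u < d \<Longrightarrow> k x \<noteq> 0"
    unfolding eventually_at by auto
  define x where "x = (if u > 0 then u + d/2 else u - d/2)"
  have "k x \<noteq> 0" using d by (intro d(2)) (auto simp: x_def dist_real_def)
  then have "x \<in> {-1..1}" using closure closure_subset[of "{u. k u \<noteq> 0}"] by blast
  then show False using assms d by (auto simp: x_def split: if_splits)
qed

lemma deriv_zero_outside: assumes "1 < \<bar>u\<bar>" shows "deriv k u = 0" "deriv (deriv k) u = 0"
proof -
  have z: "deriv k u = 0" if "1 < \<bar>u\<bar>" for u
  proof -
    have "\<forall>\<^sub>F x in nhds u. 1 < \<bar>x\<bar>"
      using that by (intro eventually_nhds_in_open[of "{x. 1 < \<bar>x\<bar>}", simplified])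
        (auto intro!: open_Collect_less continuous_intros)
    then have "\<forall>\<^sub>F x in nhds u. k x = (\<lambda>_. 0) x" by eventually_elim (auto intro: zero_outside)
    from deriv_cong_ev[OF this refl] show ?thesis by simp
  qed
  show "deriv k u = 0" by (rule z[OF assms])
  have "\<forall>\<^sub>F x in nhds u. 1 < \<bar>x\<bar>"
    using assms by (intro eventually_nhds_in_open[of "{x. 1 < \<bar>x\<bar>}", simplified])
      (auto intro!: open_Collect_less continuous_intros)
  then have "\<forall>\<^sub>F x in nhds u. deriv k x = (\<lambda>_. 0) x" by eventually_elim (auto intro: z)
  from deriv_cong_ev[OF this refl] show "deriv (deriv k) u = 0" by simp
qed

lemma bounded: "\<exists>B>0. \<forall>u. \<bar>k u\<bar> \<le> B"
  by (intro bounded_of_support cont zero_outside) auto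

lemma deriv_bounded: "\<exists>B>0. \<forall>u. \<bar>deriv k u\<bar> \<le> B"
  by (intro bounded_of_support deriv_cont deriv_zero_outside)

lemma deriv_lipschitz: "\<exists>L>0. \<forall>x y. \<bar>deriv k x - deriv k y\<bar> \<le> L * \<bar>x - y\<bar>"
proof -
  obtain L where L: "L > 0" "\<And>u. \<bar>deriv (deriv k) u\<bar> \<le> L"
    using bounded_of_support[of "deriv (deriv k)"] smooth(3) deriv_zero_outside(2) by blast
  have "norm (deriv k x - deriv k y) \<le> L * norm (x - y)" for x y
    by (rule field_differentiable_bound[of UNIV "deriv k" "deriv (deriv k)"])
      (use smooth(2) L(2) in auto)
  with L(1) show ?thesis by auto
qed

text \<open>Points of positivity close to \<open>1\<close>, and by symmetry close to \<open>-1\<close>, are what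
the support condition is used for. In between the kernel may have zeros, even at \<open>0\<close>.\<close>

lemma pos_near_1: assumes "a < 1" obtains u where "a < u" "u < 1" "0 < k u"
proof -
  have "1 \<in> closure {u. k u \<noteq> 0}" using closure by simp
  then obtain u where u: "k u \<noteq> 0" "dist u 1 < 1 - a"
    unfolding closure_approachable using assms by (auto dest: spec[of _ "1 - a"])
  have "u < 1" using zero_outside[of u] u by force
  then show thesis using u nonneg[of u] by (intro that[of u]) (auto simp: dist_real_def)
qed

lemma integrable_moment:
  assumes [measurable]: "A \<in> sets borel"
  shows "integrable lborel (\<lambda>u. indicator A u * (u ^ i * k u))"
proof -
  obtain B where B: "B > 0" "\<And>u. \<bar>k u\<bar> \<le> B" using bounded by blast
  show ?thesis
  proof (rule integrable_bounded_support)
    fix u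
    show "\<bar>indicator A u * (u ^ i * k u)\<bar> \<le> B"
    proof (cases "\<bar>u\<bar> \<le> 1")
      case True
      then have "\<bar>u ^ i\<bar> \<le> 1" by (simp add: power_abs power_le_one)
      then have "\<bar>u ^ i\<bar> * \<bar>k u\<bar> \<le> 1 * B" using B by (intro mult_mono) auto
      then show ?thesis using B by (auto simp: indicator_def abs_mult)
    next
      case False
      then show ?thesis using B(1) zero_outside[of u] by auto
    qed
  next
    fix u assume "u \<notin> {- 1..(1::real)}"
    then show "indicator A u * (u ^ i * k u) = 0" using zero_outside[of u] by auto
  qed measurable
qed

lemma partial_moment_eq: "partial_moment k i \<beta> = (LINT u|lborel. indicator {-1..\<beta>} u * (u ^ i * k u))"
  by (simp add: partial_moment_def set_lebesgue_integral_def)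

lemma partial_moment_le_1: "\<bar>partial_moment k i \<beta>\<bar> \<le> 1"
proof -
  have "\<bar>partial_moment k i \<beta>\<bar> \<le> (LINT u|lborel. \<bar>indicator {-1..\<beta>} u * (u ^ i * k u)\<bar>)"
    unfolding partial_moment_eq by (rule integral_abs_bound)
  also have "\<dots> \<le> (LINT u|lborel. k u)"
  proof (rule integral_mono)
    show "integrable lborel k" using smoothing by (simp add: smoothing_kernel_def)
    fix u :: real
    show "\<bar>indicator {- 1..\<beta>} u * (u ^ i * k u)\<bar> \<le> k u"
    proof (cases "\<bar>u\<bar> \<le> 1")
      case True
      then have "\<bar>u ^ i\<bar> \<le> 1" by (simp add: power_abs power_le_one)
      then have "\<bar>u ^ i\<bar> * \<bar>k u\<bar> \<le> 1 * k u" using nonneg[of u] by (intro mult_mono) auto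
      then show ?thesis using nonneg[of u] by (auto simp: indicator_def abs_mult)
    next
      case False
      then show ?thesis using zero_outside[of u] by auto
    qed
  qed (intro integrable_abs integrable_moment, auto)
  finally show ?thesis using integral_1 by simp
qed

lemma square_moment:
  "(LINT u|lborel. indicator {-1..\<beta>} u * ((u - z)\<^sup>2 * k u)) =
     partial_moment k 2 \<beta> - 2 * z * partial_moment k 1 \<beta> + z\<^sup>2 * partial_moment k 0 \<beta>"
  "integrable lborel (\<lambda>u. indicator {-1..\<beta>} u * ((u - z)\<^sup>2 * k u))"
proof -
  let ?m = "\<lambda>i u. indicator {-1..\<beta>} u * (u ^ i * k u)"
  have eq: "indicator {-1..\<beta>} u * ((u - z)\<^sup>2 * k u) = ?m 2 u - 2 * z * ?m 1 u + z\<^sup>2 * ?m 0 u" for u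
    by (simp add: power2_eq_square algebra_simps)
  have i: "integrable lborel (?m i)" for i by (rule integrable_moment) simp
  show "integrable lborel (\<lambda>u. indicator {-1..\<beta>} u * ((u - z)\<^sup>2 * k u))"
    unfolding eq using i
    by (intro Bochner_Integration.integrable_add Bochner_Integration.integrable_diff integrable_mult_right)
  show "(LINT u|lborel. indicator {-1..\<beta>} u * ((u - z)\<^sup>2 * k u)) =
     partial_moment k 2 \<beta> - 2 * z * partial_moment k 1 \<beta> + z\<^sup>2 * partial_moment k 0 \<beta>"
    unfolding eq partial_moment_eq
    by (simp only: i Bochner_Integration.integral_add Bochner_Integration.integral_diff
      Bochner_Integration.integrable_diff integrable_mult_right integral_mult_right_zero)
qed

text \<open>For \<open>z = \<nu>\<^sub>1 / \<nu>\<^sub>0\<close> the determinant is \<open>\<nu>\<^sub>0\<close>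
times \<open>\<integral> (u - z)\<^sup>2 k u du\<close> over \<open>[-1, \<beta>]\<close>. Both
factors decrease when the integrals are restricted to \<open>[-1, 0]\<close>, and there the second
one is at least its minimum over all \<open>z\<close>.\<close>

lemma boundary_det_bound:
  "\<exists>d>0. \<forall>\<beta>\<ge>0. d \<le> partial_moment k 0 \<beta> * partial_moment k 2 \<beta> - (partial_moment k 1 \<beta>)\<^sup>2"
proof -
  define A where "A i = partial_moment k i 0" for i
  have pos: "\<exists>u. -1 < u \<and> u < 0 \<and> u \<noteq> z \<and> 0 < k u" for z
  proof -
    \<comment> \<open>Two points of positivity are needed since one of them may be
        \<open>z\<close>.\<close>
    obtain u1 where u1: "0 < u1" "u1 < 1" "0 < k u1" using pos_near_1[of 0] by auto
    obtain u2 where u2: "u1 < u2" "u2 < 1" "0 < k u2" using pos_near_1[of u1] u1 by auto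
    show ?thesis
    proof (cases "z = - u1")
      case True then show ?thesis using u1 u2 sym by (intro exI[of _ "- u2"]) auto
    next
      case False then show ?thesis using u1 u2 sym by (intro exI[of _ "- u1"]) auto
    qed
  qed
  have A0: "0 < A 0"
  proof -
    obtain u where "-1 < u" "u < 0" "0 < k u" using pos[of 0] by auto
    then show ?thesis unfolding A_def partial_moment_eq
      using integrable_moment[of "{-1..0}" 0] cont nonneg
      by (intro integral_pos_continuous[of _ _ u]) auto
  qed
  \<comment> \<open>The minimiser of \<open>z \<mapsto> \<integral> (u - z)\<^sup>2 k u du\<close>
      over \<open>[-1, 0]\<close>.\<close>
  define z0 where "z0 = A 1 / A 0"
  define D where "D = (LINT u|lborel. indicator {-1..0} u * ((u - z0)\<^sup>2 * k u))"
  have D: "0 < D"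
  proof -
    obtain u where "-1 < u" "u < 0" "u \<noteq> z0" "0 < k u" using pos[of z0] by auto
    then show ?thesis unfolding D_def
      using square_moment(2)[of 0 z0] cont nonneg
      by (intro integral_pos_continuous[of _ _ u]) (auto intro!: continuous_intros)
  qed
  have Deq: "D = A 2 - (A 1)\<^sup>2 / A 0"
    unfolding D_def square_moment(1) using A0 by (simp add: z0_def A_def field_simps power2_eq_square)
  have "A 0 * D \<le> partial_moment k 0 \<beta> * partial_moment k 2 \<beta> - (partial_moment k 1 \<beta>)\<^sup>2" if "\<beta> \<ge> 0" for \<beta>
  proof -
    have mono: "(LINT u|lborel. indicator {-1..0} u * f u) \<le> (LINT u|lborel. indicator {-1..\<beta>} u * f u)"
      if "integrable lborel (\<lambda>u. indicator {-1..0} u * f u)" "integrable lborel (\<lambda>u. indicator {-1..\<beta>} u * f u)"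
         "\<And>u. 0 \<le> f u" for f :: "real \<Rightarrow> real"
      using that \<open>\<beta> \<ge> 0\<close> by (intro integral_mono) (auto simp: indicator_def)
    have p0: "A 0 \<le> partial_moment k 0 \<beta>"
      unfolding A_def partial_moment_eq using integrable_moment[of _ 0] nonneg by (intro mono) auto
    define z where "z = partial_moment k 1 \<beta> / partial_moment k 0 \<beta>"
    have "D \<le> A 2 - 2 * z * A 1 + z\<^sup>2 * A 0"
    proof -
      have "A 2 - 2 * z * A 1 + z\<^sup>2 * A 0 - D = A 0 * (z - A 1 / A 0)\<^sup>2"
        using A0 unfolding Deq by (simp add: field_simps power2_eq_square)
      also have "\<dots> \<ge> 0" using A0 by simp
      finally show ?thesis by simp
    qed
    also have "\<dots> = (LINT u|lborel. indicator {-1..0} u * ((u - z)\<^sup>2 * k u))"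
      by (simp add: square_moment A_def)
    also have "\<dots> \<le> (LINT u|lborel. indicator {-1..\<beta>} u * ((u - z)\<^sup>2 * k u))"
      using nonneg by (intro mono square_moment) auto
    finally have *: "D \<le> (LINT u|lborel. indicator {-1..\<beta>} u * ((u - z)\<^sup>2 * k u))" .
    have "A 0 * D \<le> partial_moment k 0 \<beta> * (LINT u|lborel. indicator {-1..\<beta>} u * ((u - z)\<^sup>2 * k u))"
      using p0 * A0 D by (intro mult_mono) auto
    also have "\<dots> = partial_moment k 0 \<beta> * partial_moment k 2 \<beta> - (partial_moment k 1 \<beta>)\<^sup>2"
      unfolding square_moment(1) using p0 A0 by (simp add: z_def field_simps power2_eq_square)
    finally show ?thesis .
  qed
  with A0 D show ?thesis by (intro exI[of _ "A 0 * D"]) auto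
qed

lemma boundary_kernel_bounded: "\<exists>C>0. \<forall>\<beta>\<ge>0. \<forall>u. \<bar>boundary_kernel k \<beta> u\<bar> \<le> C"
proof -
  obtain d where d: "d > 0" "\<And>\<beta>. \<beta> \<ge> 0 \<Longrightarrow>
     d \<le> partial_moment k 0 \<beta> * partial_moment k 2 \<beta> - (partial_moment k 1 \<beta>)\<^sup>2"
    using boundary_det_bound by blast
  obtain B where B: "B > 0" "\<And>u. \<bar>k u\<bar> \<le> B" using bounded by blast
  have "\<bar>boundary_kernel k \<beta> u\<bar> \<le> 2 / d * B" if \<beta>: "\<beta> \<ge> 0" for \<beta> u
  proof (cases "\<bar>u\<bar> \<le> 1")
    case False
    then show ?thesis using B d zero_outside[of u] by (simp add: boundary_kernel_def)
  next
    case True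
    let ?N = "partial_moment k 2 \<beta> - partial_moment k 1 \<beta> * u"
    let ?D = "partial_moment k 0 \<beta> * partial_moment k 2 \<beta> - (partial_moment k 1 \<beta>)\<^sup>2"
    have "\<bar>partial_moment k 1 \<beta> * u\<bar> \<le> 1 * 1"
      unfolding abs_mult using True partial_moment_le_1 by (intro mult_mono) auto
    then have "\<bar>?N\<bar> \<le> 2" using partial_moment_le_1[of 2 \<beta>] by linarith
    then have "\<bar>?N\<bar> / ?D \<le> 2 / d" using d(1) d(2)[OF \<beta>] by (intro frac_le) auto
    then have "\<bar>?N / ?D\<bar> \<le> 2 / d" using d(1) d(2)[OF \<beta>] by (simp add: abs_divide)
    then have "\<bar>?N / ?D\<bar> * \<bar>k u\<bar> * \<bar>indicator {- 1<..<\<beta>} u\<bar> \<le> 2 / d * B * 1"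
      using B d by (intro mult_mono) (auto simp: indicator_def)
    then show ?thesis by (simp add: boundary_kernel_def abs_mult)
  qed
  then show ?thesis using d B by (intro exI[of _ "2 / d * B"]) auto
qed

lemma measurable_partial_moment [measurable]: "partial_moment k i \<in> borel_measurable borel"
proof -
  have "(\<lambda>\<beta>. LINT u|lborel. indicator {p. -1 \<le> snd p \<and> snd p \<le> fst p} (\<beta>, u) * (u ^ i * k u)) \<in> borel_measurable borel"
    by measurable
  also have "(\<lambda>\<beta>. LINT u|lborel. indicator {p. -1 \<le> snd p \<and> snd p \<le> fst p} (\<beta>, u) * (u ^ i * k u)) = partial_moment k i"
    unfolding partial_moment_eq by (intro ext Bochner_Integration.integral_cong) (auto simp: indicator_def)
  finally show ?thesis .
qed

lemma measurable_boundary_kernel [measurable (raw)]: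
  assumes [measurable]: "a \<in> borel_measurable N" "b \<in> borel_measurable N"
  shows "(\<lambda>w. boundary_kernel k (a w) (b w)) \<in> borel_measurable N"
proof -
  have "(\<lambda>w. (partial_moment k 2 (a w) - partial_moment k 1 (a w) * b w) /
     (partial_moment k 0 (a w) * partial_moment k 2 (a w) - (partial_moment k 1 (a w))\<^sup>2) *
     k (b w) * (if -1 < b w \<and> b w < a w then 1 else 0)) \<in> borel_measurable N"
    by measurable
  then show ?thesis by (simp add: boundary_kernel_def indicator_def)
qed

lemma measurable_local_weight [measurable (raw)]:
  assumes [measurable]: "a \<in> borel_measurable N" "b \<in> borel_measurable N"
  shows "(\<lambda>w. local_weight k h (a w) (b w)) \<in> borel_measurable N"
  unfolding local_weight_def scaled_kernel_def by measurable

lemma local_weight_bounded: "\<exists>C>0. \<forall>h>0. \<forall>s\<ge>0. \<forall>v. \<bar>local_weight k h s v\<bar> \<le> C / h"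
proof -
  obtain B where B: "B > 0" "\<And>u. \<bar>k u\<bar> \<le> B" using bounded by blast
  obtain C where C: "C > 0" "\<And>\<beta> u. \<beta> \<ge> 0 \<Longrightarrow> \<bar>boundary_kernel k \<beta> u\<bar> \<le> C" using boundary_kernel_bounded by blast
  have "\<bar>local_weight k h s v\<bar> \<le> max B C / h" if "h > 0" "s \<ge> 0" for h s v
    using that B(2) C(2)[of "s / h"] unfolding local_weight_def scaled_kernel_def
    by (auto simp: abs_divide le_max_iff_disj intro!: divide_right_mono)
  then show ?thesis using B by (intro exI[of _ "max B C"]) auto
qed

lemma local_weight_zero: assumes "h > 0" "h \<le> \<bar>s - v\<bar>" shows "local_weight k h s v = 0"
proof -
  have "1 \<le> \<bar>(s - v) / h\<bar>" using assms by (simp add: field_simps abs_divide)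
  then show ?thesis using zero_outside by (simp add: local_weight_def scaled_kernel_def boundary_kernel_def)
qed

lemma local_weight_nonneg: assumes "h > 0" "s > h" shows "0 \<le> local_weight k h s v"
  using assms nonneg by (simp add: local_weight_def scaled_kernel_def)

lemma local_weight_nonpos_obs: assumes "h > 0" "0 \<le> s" "v \<le> 0" shows "local_weight k h s v = 0"
proof (cases "s > h")
  case True
  then show ?thesis using assms by (intro local_weight_zero) auto
next
  case False
  have "(s - v) / h \<ge> s / h" using assms by (simp add: field_simps)
  then show ?thesis using False by (simp add: local_weight_def boundary_kernel_def)
qed

lemma set_integrable_local_weight:
  assumes h: "h > 0" and A: "A \<in> sets borel" "A \<subseteq> {0..}"
  shows "set_integrable lborel A (\<lambda>u. local_weight k h u v)"
proof -
  obtain C where C: "C > 0" "\<And>h s v. h > 0 \<Longrightarrow> s \<ge> 0 \<Longrightarrow> \<bar>local_weight k h s v\<bar> \<le> C / h" using local_weight_bounded by blast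
  have [measurable]: "A \<in> sets borel" by fact
  show ?thesis
    unfolding set_integrable_def
  proof (rule integrable_bounded_support)
    show "\<bar>indicator A u *\<^sub>R local_weight k h u v\<bar> \<le> C / h" for u
      using C(2)[OF h, of u v] C(1) h A by (auto simp: indicator_def)
    show "indicator A u *\<^sub>R local_weight k h u v = 0" if "u \<notin> {v - h..v + h}" for u
      using that local_weight_zero[OF h, of u v] by (cases "h \<le> \<bar>u - v\<bar>") auto
  qed measurable
qed

lemma cum_weight_diff:
  assumes h: "h > 0" and "0 \<le> r" "r \<le> s"
  shows "cum_weight k h s v - cum_weight k h r v = (LINT u:{r<..s}|lborel. local_weight k h u v)"
proof -
  have "{0..s} = {0..r} \<union> {r<..s}" using assms by auto
  then have "cum_weight k h s v = (LINT u:{0..r} \<union> {r<..s}|lborel. local_weight k h u v)"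
    by (simp add: cum_weight_def)
  also have "\<dots> = cum_weight k h r v + (LINT u:{r<..s}|lborel. local_weight k h u v)"
    unfolding cum_weight_def using assms
    by (intro set_integral_Un set_integrable_local_weight) auto
  finally show ?thesis by simp
qed

lemma continuous_cum_weight:
  assumes h: "h > 0"
  shows "continuous_on {0..} (\<lambda>s. cum_weight k h s v)"
proof -
  obtain C where C: "C > 0" "\<And>h s v. h > 0 \<Longrightarrow> s \<ge> 0 \<Longrightarrow> \<bar>local_weight k h s v\<bar> \<le> C / h" using local_weight_bounded by blast
  have le: "\<bar>cum_weight k h s v - cum_weight k h r v\<bar> \<le> C / h * (s - r)" if "0 \<le> r" "r \<le> s" for r s
  proof -
    have "norm (LINT u:{r<..s}|lborel. local_weight k h u v) \<le> (LINT u:{r<..s}|lborel. C / h)"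
      unfolding set_lebesgue_integral_def
    proof (rule Bochner_Integration.integral_norm_bound_integral)
      show "integrable lborel (\<lambda>u. indicator {r<..s} u *\<^sub>R local_weight k h u v)"
        using set_integrable_local_weight[OF h, of "{r<..s}" v] that by (auto simp: set_integrable_def subset_eq)
      show "norm (indicator {r<..s} u *\<^sub>R local_weight k h u v) \<le> indicator {r<..s} u *\<^sub>R (C / h)" for u
        using C(2)[OF h, of u] that by (auto simp: indicator_def)
          show "integrable lborel (\<lambda>u. indicator {r<..s} u *\<^sub>R (C / h))"
        using that by (intro integrable_scaleR_left integrable_real_indicator) (auto simp: emeasure_lborel_Ioc)
    qed
    then show ?thesis using that by (simp add: cum_weight_diff[OF h that] set_lebesgue_integral_def mult.commute)
  qed
  have "(C / h)-lipschitz_on {0..} (\<lambda>s. cum_weight k h s v)"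
  proof (rule lipschitz_onI)
    fix x y :: real assume "x \<in> {0..}" "y \<in> {0..}"
    then show "dist (cum_weight k h x v) (cum_weight k h y v) \<le> C / h * dist x y"
      using le[of x y] le[of y x] by (cases "x \<le> y") (auto simp: dist_real_def abs_minus_commute)
  qed (use C h in auto)
  then show ?thesis by (rule lipschitz_on_continuous_on)
qed

lemma isCont_local_weight:
  assumes h: "h > 0" and "s > h"
  shows "isCont (\<lambda>s. local_weight k h s v) s"
proof -
  have "\<forall>\<^sub>F u in nhds s. u > h" using assms by (intro eventually_nhds_in_open[of "{h<..}", simplified]) auto
  then have "\<forall>\<^sub>F u in nhds s. local_weight k h u v = scaled_kernel k h (u - v)"
    by eventually_elim (simp add: local_weight_def)
  moreover have "isCont (\<lambda>u. scaled_kernel k h (u - v)) s"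
    unfolding scaled_kernel_def using h by (intro continuous_intros isCont_o2[OF _ cont]) auto
  ultimately show ?thesis by (subst isCont_cong)
qed

lemma cum_weight_has_derivative:
  assumes h: "h > 0" and s: "s > h"
  shows "((\<lambda>s. cum_weight k h s v) has_real_derivative local_weight k h s v) (at s)"
proof -
  \<comment> \<open>The lower limit is moved beyond \<open>h\<close>, where the weight is continuous
      in \<open>s\<close>.\<close>
  define a where "a = (h + s) / 2"
  have a: "h < a" "a < s" using s by (auto simp: a_def)
  let ?f = "\<lambda>u. local_weight k h u v"
  have cont: "continuous_on {a..s + 1} ?f"
    using a by (intro continuous_at_imp_continuous_on ballI isCont_local_weight h) auto
  have "((\<lambda>u. integral {a..u} ?f) has_real_derivative ?f s) (at s within {a..s + 1})"
    using a by (intro integral_has_real_derivative cont) auto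
  then have der: "((\<lambda>u. cum_weight k h a v + integral {a..u} ?f) has_real_derivative ?f s) (at s within {a..s + 1})"
    by (auto intro!: derivative_eq_intros)
  have eq: "cum_weight k h u v = cum_weight k h a v + integral {a..u} ?f" if "a \<le> u" for u
  proof -
    have si: "set_integrable lborel {a..u} ?f" using a h by (intro set_integrable_local_weight) auto
    have "(LINT x:{a<..u}|lborel. ?f x) = (LINT x:{a..u}|lborel. ?f x)"
      unfolding set_lebesgue_integral_def
    proof (rule integral_cong_AE)
      show "AE x in lborel. indicator {a<..u} x *\<^sub>R ?f x = indicator {a..u} x *\<^sub>R ?f x"
        using AE_lborel_singleton[of a] by eventually_elim (auto simp: indicator_def)
    qed measurable
    then show ?thesis
      using cum_weight_diff[OF h, of a u v] a h that set_borel_integral_eq_integral(2)[OF si] by simp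
  qed
  have "((\<lambda>s. cum_weight k h s v) has_real_derivative ?f s) (at s within {a..s + 1})"
    using a by (intro has_field_derivative_transform_within[OF der zero_less_one] eq[symmetric]) simp_all
  then show ?thesis using a by (subst (asm) at_within_interior) auto
qed

lemma integral_scaled_kernel:
  assumes h: "h > 0"
  shows "integrable lborel (\<lambda>u. scaled_kernel k h (u - v))" "(LINT u|lborel. scaled_kernel k h (u - v)) = 1"
proof -
  have k: "integrable lborel k" using smoothing by (simp add: smoothing_kernel_def)
  have eq: "scaled_kernel k h (u - v) = k (- v / h + (1 / h) * u) / h" for u
    using h by (simp add: scaled_kernel_def field_simps)
  show "integrable lborel (\<lambda>u. scaled_kernel k h (u - v))"
    unfolding eq using h k by (intro integrable_divide lborel_integrable_real_affine) auto
  show "(LINT u|lborel. scaled_kernel k h (u - v)) = 1"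
    unfolding eq using h lborel_integral_real_affine[of "1 / h" k "- v / h"] integral_1
    by simp
qed

text \<open>Integrating the weight gives a smoothed indicator of \<open>v \<le> s\<close>, which is exact unless
\<open>s\<close> and \<open>v\<close> are within \<open>h\<close>. Observations below \<open>2 *
h\<close> may feel the boundary kernel, and for them only boundedness is used.\<close>

lemma cum_weight_approx:
  "\<exists>C>0. \<forall>h>0. \<forall>s\<ge>0. \<forall>v\<ge>0.
     \<bar>cum_weight k h s v - (if v \<le> s then 1 else 0)\<bar> \<le>
       (if \<bar>s - v\<bar> \<le> h then 1 else 0) + C * (if v \<le> 2 * h then 1 else 0)"
proof -
  obtain C where C: "C > 0" "\<And>h s v. h > 0 \<Longrightarrow> s \<ge> 0 \<Longrightarrow> \<bar>local_weight k h s v\<bar> \<le> C / h" using local_weight_bounded by blast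
  have "\<bar>cum_weight k h s v - (if v \<le> s then 1 else 0)\<bar> \<le>
       (if \<bar>s - v\<bar> \<le> h then 1 else 0) + (2 * C + 1) * (if v \<le> 2 * h then 1 else 0)"
    if h: "h > 0" and s: "s \<ge> 0" and v: "v \<ge> 0" for h s v
  proof (cases "v \<le> 2 * h")
    case True
    have "norm (cum_weight k h s v) \<le> (LINT u|lborel. indicator {v - h..v + h} u * (C / h))"
      unfolding cum_weight_def set_lebesgue_integral_def
    proof (rule Bochner_Integration.integral_norm_bound_integral)
      show "integrable lborel (\<lambda>u. indicator {0..s} u *\<^sub>R local_weight k h u v)"
        using set_integrable_local_weight[OF h, of "{0..s}"] by (auto simp: set_integrable_def)
      show "norm (indicator {0..s} u *\<^sub>R local_weight k h u v) \<le> indicator {v - h..v + h} u * (C / h)" for u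
        using C(1) C(2)[OF h, of u v] h local_weight_zero[OF h, of u v] by (auto simp: indicator_def)
          show "integrable lborel (\<lambda>u. indicator {v - h..v + h} u * (C / h))"
        using h by (intro integrable_mult_left integrable_real_indicator) (auto simp: emeasure_lborel_Icc_eq)
    qed
    also have "\<dots> = 2 * C" using h by simp
    finally show ?thesis using True by auto
  next
    case False
    have lw: "indicator {0..s} u *\<^sub>R local_weight k h u v = indicator {0..s} u * scaled_kernel k h (u - v)" for u
    proof (cases "u > h")
      case True then show ?thesis by (simp add: local_weight_def)
    next
      case u: False
      then have "local_weight k h u v = 0" using False h by (intro local_weight_zero) auto
      moreover have "scaled_kernel k h (u - v) = 0" unfolding scaled_kernel_def
        using u False h zero_outside[of "(u - v) / h"] by (simp add: abs_divide field_simps)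
      ultimately show ?thesis by simp
    qed
    have zero: "scaled_kernel k h (u - v) = 0" if "u \<notin> {v - h..v + h}" for u
      unfolding scaled_kernel_def using that h zero_outside[of "(u - v) / h"] by (auto simp: abs_divide field_simps)
    have nn: "0 \<le> scaled_kernel k h (u - v)" for u unfolding scaled_kernel_def using h nonneg by auto
    have eq: "cum_weight k h s v = (LINT u|lborel. indicator {0..s} u * scaled_kernel k h (u - v))"
      unfolding cum_weight_def set_lebesgue_integral_def lw ..
    have int: "integrable lborel (\<lambda>u. indicator {0..s} u * scaled_kernel k h (u - v))"
      using integrable_mult_indicator[OF _ integral_scaled_kernel(1)[OF h], of "{0..s}"] by simp
    have ge0: "0 \<le> cum_weight k h s v" unfolding eq using nn by (intro integral_nonneg_AE) auto
    have "cum_weight k h s v \<le> (LINT u|lborel. scaled_kernel k h (u - v))"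
      unfolding eq using nn by (intro integral_mono int integral_scaled_kernel h) (auto simp: indicator_def)
    then have le1: "cum_weight k h s v \<le> 1" using integral_scaled_kernel[OF h] by simp
    show ?thesis
    proof (cases "\<bar>s - v\<bar> \<le> h")
      case True then show ?thesis using ge0 le1 False by auto
    next
      case sv: False
      show ?thesis
      proof (cases "v \<le> s")
        case True
        have "cum_weight k h s v = (LINT u|lborel. scaled_kernel k h (u - v))"
        proof -
          have "indicator {0..s} u * scaled_kernel k h (u - v) = scaled_kernel k h (u - v)" for u
            using True sv False zero[of u] by (cases "u \<in> {v - h..v + h}") (auto simp: indicator_def)
          then show ?thesis unfolding eq by (simp only:)
        qed
        then show ?thesis using integral_scaled_kernel[OF h] True False by auto
      next
        case vs: False
        have "cum_weight k h s v = 0"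
        proof -
          have "indicator {0..s} u * scaled_kernel k h (u - v) = 0" for u
            using vs sv False zero[of u] by (cases "u \<in> {v - h..v + h}") (auto simp: indicator_def)
          then show ?thesis unfolding eq by (simp only: integral_zero)
        qed
        then show ?thesis using vs False by auto
      qed
    qed
  qed
  then show ?thesis using C by (intro exI[of _ "2 * C + 1"]) auto
qed

lemma measurable_cum_weight [measurable]: "cum_weight k h s \<in> borel_measurable borel"
  unfolding cum_weight_def set_lebesgue_integral_def by measurable

end

section \<open>The estimators as averages over the sample\<close>

text \<open>The Lebesgue-Stieltjes measure of the empirical subdistribution function is the sum of its point
masses: both measures have the same distribution function.\<close>

lemma integral_interval_measure_emp_subdist:
  assumes [measurable]: "f \<in> borel_measurable borel"
  shows "(LINT u|interval_measure (emp_subdist n T D i). f u) =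
    (\<Sum>j<n. (if 0 \<le> T j \<and> D j = i then f (T j) else 0)) / real n"
proof -
  define J where "J = {j\<in>{..<n}. 0 \<le> T j \<and> D j = i}"
  define P where "P = point_measure J (\<lambda>_. ennreal (1 / real n))"
  define N where "N = distr P borel T"
  have J: "finite J" by (simp add: J_def)
  have TP: "T \<in> measurable P borel" unfolding P_def by simp
  have "finite_measure P"
    by (rule finite_measureI) (simp add: P_def space_point_measure emeasure_point_measure_finite J ennreal_mult_eq_top_iff)
  then have "finite_measure N" unfolding N_def using TP by (rule finite_measure.finite_measure_distr)
  then have N: "finite_borel_measure N"
    by (intro finite_borel_measure.intro finite_borel_measure_axioms.intro) (simp_all add: N_def)
  have cdf: "cdf N = emp_subdist n T D i"
  proof
    fix t
    have "cdf N t = measure P (T -` {..t} \<inter> space P)"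
      unfolding cdf_def N_def using TP by (intro measure_distr) auto
    also have "T -` {..t} \<inter> space P = {j\<in>J. T j \<le> t}" by (auto simp: P_def space_point_measure)
    also have "measure P {j\<in>J. T j \<le> t} = (\<Sum>j\<in>{j\<in>J. T j \<le> t}. 1 / real n)"
      unfolding P_def measure_def using J
      by (subst emeasure_point_measure_finite) (auto simp: ennreal_of_nat_eq_real_of_nat ennreal_mult[symmetric] simp del: ennreal_1)
    also have "\<dots> = emp_subdist n T D i t"
      unfolding emp_subdist_def sum_divide_distrib
      by (intro sum.mono_neutral_cong_left) (auto simp: J_def indicator_def)
    finally show "cdf N t = emp_subdist n T D i t" .
  qed
  interpret N: finite_borel_measure N by (rule N)
  \<comment> \<open>Any finite Borel measure on the line is the Lebesgue-Stieltjes measure of its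
      distribution function.\<close>
  have "interval_measure (cdf N) = N"
  proof (rule cdf_unique')
    show "finite_borel_measure (interval_measure (cdf N))"
      by (rule finite_borel_measure_interval_measure[OF N.cdf_nondecreasing N.cdf_is_right_cont
            N.cdf_lim_at_bot N.cdf_lim_at_top]) auto
    show "cdf (interval_measure (cdf N)) = cdf N"
      by (rule cdf_interval_measure[OF N.cdf_nondecreasing N.cdf_is_right_cont N.cdf_lim_at_bot])
  qed (rule N)
  then have "(LINT u|interval_measure (emp_subdist n T D i). f u) = (LINT u|N. f u)" by (simp add: cdf)
  also have "\<dots> = (LINT j|P. f (T j))" unfolding N_def using TP by (intro integral_distr) auto
  also have "\<dots> = (\<Sum>j\<in>J. 1 / real n * f (T j))"
    unfolding P_def using J by (subst lebesgue_integral_point_measure_finite) auto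
  also have "\<dots> = (\<Sum>j<n. (if 0 \<le> T j \<and> D j = i then f (T j) else 0)) / real n"
    unfolding sum_divide_distrib
    by (intro sum.mono_neutral_cong_left) (auto simp: J_def)
  finally show ?thesis .
qed

context kernel
begin

lemma dens_est_eq:
  "dens_est k h n T D i s = (\<Sum>j<n. (if 0 \<le> T j \<and> D j = i then local_weight k h s (T j) else 0)) / real n"
proof (cases "s > h")
  case True
  have [measurable]: "(\<lambda>u. scaled_kernel k h (s - u)) \<in> borel_measurable borel"
    unfolding scaled_kernel_def by measurable
  show ?thesis using True
    by (simp add: dens_est_def integral_interval_measure_emp_subdist local_weight_def cong: if_cong)
next
  case False
  have [measurable]: "(\<lambda>u. boundary_kernel k (s / h) ((s - u) / h) / h) \<in> borel_measurable borel"
    by measurable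
  show ?thesis using False
    by (simp add: dens_est_def integral_interval_measure_emp_subdist[where f = "\<lambda>u. boundary_kernel k (s / h) ((s - u) / h) / h"]
        local_weight_def del: integral_divide_zero cong: if_cong)
qed

lemma set_integrable_dens_est:
  assumes h: "h > 0" and A: "A \<in> sets borel" "A \<subseteq> {0..}"
  shows "set_integrable lborel A (dens_est k h n T D i)"
  unfolding dens_est_eq[abs_def] set_integrable_def
proof -
  have "integrable lborel (\<lambda>s. (\<Sum>j<n. (if 0 \<le> T j \<and> D j = i then indicator A s *\<^sub>R local_weight k h s (T j) else 0)) / real n)"
  proof (intro integrable_divide Bochner_Integration.integrable_sum)
    show "integrable lborel (\<lambda>s. if 0 \<le> T j \<and> D j = i then indicator A s *\<^sub>R local_weight k h s (T j) else 0)" for j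
      using set_integrable_local_weight[OF h A, of "T j"]
      by (cases "0 \<le> T j \<and> D j = i") (auto simp: set_integrable_def)
  qed
  also have "(\<lambda>s. (\<Sum>j<n. (if 0 \<le> T j \<and> D j = i then indicator A s *\<^sub>R local_weight k h s (T j) else 0)) / real n) =
     (\<lambda>s. indicator A s *\<^sub>R ((\<Sum>j<n. if 0 \<le> T j \<and> D j = i then local_weight k h s (T j) else 0) / real n))"
    by (auto simp: sum_distrib_left if_distrib cong: if_cong intro!: ext)
  finally show "integrable lborel (\<lambda>s. indicator A s *\<^sub>R ((\<Sum>j<n. if 0 \<le> T j \<and> D j = i then local_weight k h s (T j) else 0) / real n))" .
qed

lemma cum_est_eq:
  assumes h: "h > 0"
  shows "cum_est k h n T D i s = (\<Sum>j<n. (if 0 \<le> T j \<and> D j = i then cum_weight k h s (T j) else 0)) / real n"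
proof -
  have int: "integrable lborel (\<lambda>u. if 0 \<le> T j \<and> D j = i then indicator {0..s} u *\<^sub>R local_weight k h u (T j) else 0)" for j
    using set_integrable_local_weight[OF h, of "{0..s}" "T j"]
    by (cases "0 \<le> T j \<and> D j = i") (auto simp: set_integrable_def)
  have "cum_est k h n T D i s =
    (LINT u|lborel. (\<Sum>j<n. (if 0 \<le> T j \<and> D j = i then indicator {0..s} u *\<^sub>R local_weight k h u (T j) else 0)) / real n)"
    unfolding cum_est_def set_lebesgue_integral_def dens_est_eq
    by (intro Bochner_Integration.integral_cong refl) (auto simp: sum_distrib_left if_distrib cong: if_cong)
  also have "\<dots> = (\<Sum>j<n. (LINT u|lborel. (if 0 \<le> T j \<and> D j = i then indicator {0..s} u *\<^sub>R local_weight k h u (T j) else 0))) / real n"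
    using int by simp
  also have "\<dots> = (\<Sum>j<n. (if 0 \<le> T j \<and> D j = i then cum_weight k h s (T j) else 0)) / real n"
    by (intro arg_cong[where f = "\<lambda>x. x / real n"] sum.cong refl) (auto simp: cum_weight_def set_lebesgue_integral_def)
  finally show ?thesis .
qed

lemma cum_est_total_eq:
  assumes h: "h > 0"
  shows "cum_est_total k h n T D s = cum_est k h n T D 0 s + cum_est k h n T D 1 s"
  unfolding cum_est_total_def dens_est_total_def cum_est_def
  by (intro set_integral_add set_integrable_dens_est h) auto

lemma continuous_cum_est:
  assumes h: "h > 0"
  shows "continuous_on {0..} (cum_est k h n T D i)" "continuous_on {0..} (cum_est_total k h n T D)"
proof -
  show 1: "continuous_on {0..} (cum_est k h n T D i)" for i
  proof -
    have "continuous_on {0..} (\<lambda>s. if 0 \<le> T j \<and> D j = i then cum_weight k h s (T j) else 0)" for j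
      using continuous_cum_weight[OF h, of "T j"] by (cases "0 \<le> T j \<and> D j = i") auto
    then show ?thesis unfolding cum_est_eq[OF h, abs_def] divide_inverse by (intro continuous_intros)
  qed
  show "continuous_on {0..} (cum_est_total k h n T D)"
    unfolding cum_est_total_eq[OF h, abs_def] by (intro continuous_intros 1)
qed

lemma cum_est_has_derivative:
  assumes h: "h > 0" and s: "s > h"
  shows "(cum_est k h n T D i has_real_derivative dens_est k h n T D i s) (at s)"
    and "(cum_est_total k h n T D has_real_derivative dens_est_total k h n T D s) (at s)"
proof -
  show 1: "(cum_est k h n T D i has_real_derivative dens_est k h n T D i s) (at s)" for i
  proof -
    have "((\<lambda>s. if 0 \<le> T j \<and> D j = i then cum_weight k h s (T j) else 0) has_real_derivative
      (if 0 \<le> T j \<and> D j = i then local_weight k h s (T j) else 0)) (at s)" for j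
      using cum_weight_has_derivative[OF h s, of "T j"] by (cases "0 \<le> T j \<and> D j = i") auto
    then show ?thesis unfolding cum_est_eq[OF h, abs_def] dens_est_eq by (intro DERIV_cdivide DERIV_sum)
  qed
  show "(cum_est_total k h n T D has_real_derivative dens_est_total k h n T D s) (at s)"
    unfolding cum_est_total_eq[OF h, abs_def] dens_est_total_def by (intro DERIV_add 1)
qed

lemma cum_est_const:
  assumes h: "h > 0" and a: "0 \<le> a" "a \<le> s" and zero: "\<And>u. a < u \<Longrightarrow> u \<le> s \<Longrightarrow> dens_est k h n T D i u = 0"
  shows "cum_est k h n T D i s = cum_est k h n T D i a"
proof -
  have "{0..s} = {0..a} \<union> {a<..s}" using a by auto
  then have "cum_est k h n T D i s = (LINT u:{0..a} \<union> {a<..s}|lborel. dens_est k h n T D i u)"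
    by (simp add: cum_est_def)
  also have "\<dots> = cum_est k h n T D i a + (LINT u:{a<..s}|lborel. dens_est k h n T D i u)"
    unfolding cum_est_def using a by (intro set_integral_Un set_integrable_dens_est h) auto
  also have "(LINT u:{a<..s}|lborel. dens_est k h n T D i u) = (LINT u:{a<..s}|lborel. 0)"
    using zero by (intro set_lebesgue_integral_cong) auto
  finally show ?thesis by simp
qed

lemma dens_est_nonneg: "h > 0 \<Longrightarrow> s > h \<Longrightarrow> 0 \<le> dens_est k h n T D i s"
  unfolding dens_est_eq using local_weight_nonneg by (auto intro!: divide_nonneg_nonneg sum_nonneg)

lemma dens_est_vanishes:
  assumes h: "h > 0"
  obtains B where "0 \<le> B" "\<And>i s. B < s \<Longrightarrow> dens_est k h n T D i s = 0"
proof
  define B where "B = (\<Sum>j<n. \<bar>T j\<bar>) + h"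
  show "0 \<le> B" using h by (auto simp: B_def intro!: add_nonneg_nonneg sum_nonneg)
  show "dens_est k h n T D i s = 0" if "B < s" for i s
  proof -
    have "local_weight k h s (T j) = 0" if "j < n" for j
    proof -
      have "\<bar>T j\<bar> \<le> (\<Sum>j<n. \<bar>T j\<bar>)" using that by (intro member_le_sum) auto
      then show ?thesis using \<open>B < s\<close> h by (intro local_weight_zero) (auto simp: B_def)
    qed
    then show ?thesis by (auto simp: dens_est_eq intro!: sum.neutral)
  qed
qed

text \<open>An observation \<open>T j > 0\<close> makes the density estimator positive at some point beyond
\<open>h\<close>. Therefore the right end exceeds \<open>h\<close>, beyond it both density
estimators are nonnegative with a sum that is not positive, so the remaining part of the curve is a
single point. This removes the random right end from the description of the curve.\<close>

lemma curve_up_to_right_end: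
  assumes h: "h > 0" and ex: "\<exists>j<n. 0 < T j" and D: "\<And>j. D j \<in> {0, 1}"
  defines "p \<equiv> \<lambda>s. (cum_est_total k h n T D s, cum_est k h n T D 1 s)"
  shows "p ` {0..right_end k h n T D} = p ` {0..}" and "h < right_end k h n T D"
    and "\<And>s. h < s \<Longrightarrow> 0 < dens_est_total k h n T D s \<Longrightarrow> s < right_end k h n T D"
proof -
  let ?S = "{s. 0 \<le> s \<and> 0 < dens_est k h n T D 0 s + dens_est k h n T D 1 s}"
  define \<tau> where "\<tau> = right_end k h n T D"
  have \<tau>: "\<tau> = Sup ?S" by (simp add: \<tau>_def right_end_def)
  obtain B where zero: "\<And>i s. B < s \<Longrightarrow> dens_est k h n T D i s = 0"
    using dens_est_vanishes[OF h] by metis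
  have bdd: "bdd_above ?S"
  proof (rule bdd_aboveI)
    fix s assume "s \<in> ?S" then show "s \<le> B" using zero[of s 0] zero[of s 1] by (cases "s \<le> B") auto
  qed
  obtain j where j: "j < n" "0 < T j" using ex by blast
  obtain u where u: "1 - T j / h < u" "u < 1" "0 < k u" using pos_near_1[of "1 - T j / h"] j h by auto
  \<comment> \<open>The kernel is positive at \<open>u\<close>, and \<open>s0 > h\<close> since
      \<open>u\<close> is close enough to \<open>1\<close>.\<close>
  define s0 where "s0 = T j + h * u"
  have s0: "s0 > h" using u(1) h by (simp add: s0_def field_simps)
  have pos: "0 < dens_est k h n T D 0 s0 + dens_est k h n T D 1 s0"
  proof -
    have "0 < dens_est k h n T D (D j) s0"
      unfolding dens_est_eq
    proof (intro divide_pos_pos sum_pos2[of _ j])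
      have "local_weight k h s0 (T j) = k u / h" using s0 h by (simp add: local_weight_def scaled_kernel_def s0_def)
      then show "0 < (if 0 \<le> T j \<and> D j = D j then local_weight k h s0 (T j) else 0)" using u(3) h j by simp
    qed (use j local_weight_nonneg[OF h s0] in auto)
    then show ?thesis using D[of j] dens_est_nonneg[OF h s0, of n T D 0] dens_est_nonneg[OF h s0, of n T D 1] by auto
  qed
  have "s0 \<in> ?S" using s0 h pos by auto
  then have "s0 \<le> \<tau>" unfolding \<tau> using bdd by (rule cSup_upper)
  with s0 show \<tau>h: "h < right_end k h n T D" by (simp add: \<tau>_def)
  show "s < right_end k h n T D" if s: "h < s" "0 < dens_est_total k h n T D s" for s
  proof -
    have "isCont (dens_est k h n T D i) s" for i
    proof -
      have "isCont (\<lambda>s. if 0 \<le> T j \<and> D j = i then local_weight k h s (T j) else 0) s" for j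
        using isCont_local_weight[OF h s(1), of "T j"] by (cases "0 \<le> T j \<and> D j = i") auto
      then show ?thesis unfolding dens_est_eq[abs_def] divide_inverse by (intro continuous_intros)
    qed
    then have "isCont (dens_est_total k h n T D) s" unfolding dens_est_total_def[abs_def] by (intro continuous_intros)
    then have "\<forall>\<^sub>F u in at s. 0 < dens_est_total k h n T D u"
      using s(2) by (intro order_tendstoD) (auto simp: isCont_def)
    then obtain d where d: "d > 0" "\<And>u. u \<noteq> s \<Longrightarrow> dist u s < d \<Longrightarrow> 0 < dens_est_total k h n T D u"
      unfolding eventually_at by auto
    have "s + d/2 \<in> ?S" using d(1) d(2)[of "s + d/2"] s h by (auto simp: dist_real_def dens_est_total_def)
    then have "s + d/2 \<le> \<tau>" unfolding \<tau> using bdd by (rule cSup_upper)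
    then show ?thesis using d by (simp add: \<tau>_def)
  qed
  have z: "dens_est k h n T D i s = 0" if "i \<in> {0, 1}" "s > \<tau>" for i s
  proof -
    have sh: "s > h" using that \<tau>h by (simp add: \<tau>_def)
    have "s \<notin> ?S" using cSup_upper[OF _ bdd, of s] that by (auto simp: \<tau>)
    then show ?thesis using dens_est_nonneg[OF h sh, of n T D 0] dens_est_nonneg[OF h sh, of n T D 1] that(1) sh h
      by auto
  qed
  have \<tau>0: "0 \<le> \<tau>" using \<tau>h h by (simp add: \<tau>_def)
  have "p s = p \<tau>" if "s > \<tau>" for s
    using that \<tau>0 cum_est_const[OF h \<tau>0, of s n T D 0] cum_est_const[OF h \<tau>0, of s n T D 1] z
    by (auto simp: p_def cum_est_total_eq[OF h])
  moreover have "{0..} = {0..\<tau>} \<union> {\<tau><..}" using \<tau>0 by auto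
  ultimately show "p ` {0..right_end k h n T D} = p ` {0..}"
    unfolding \<tau>_def[symmetric] using \<tau>0 by (fastforce simp: image_iff not_le)
qed

lemma compact_curve:
  assumes h: "h > 0"
  shows "compact ((\<lambda>s. (cum_est_total k h n T D s, cum_est k h n T D 1 s)) ` {0..})"
proof -
  let ?p = "\<lambda>s. (cum_est_total k h n T D s, cum_est k h n T D 1 s)"
  obtain B where B0: "0 \<le> B" and zero: "\<And>i s. B < s \<Longrightarrow> dens_est k h n T D i s = 0"
    using dens_est_vanishes[OF h] by metis
  have "?p s = ?p B" if "s > B" for s
    using that cum_est_const[OF h B0, of s n T D] zero by (auto simp: cum_est_total_eq[OF h])
  moreover have "{0..} = {0..B} \<union> {B<..}" using B0 by auto
  ultimately have "?p ` {0..} = ?p ` {0..B}" using B0 by (fastforce simp: image_iff)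
  moreover have "compact (?p ` {0..B})"
    by (intro compact_continuous_image continuous_on_Pair continuous_on_subset[OF continuous_cum_est(1)[OF h]]
        continuous_on_subset[OF continuous_cum_est(2)[OF h]]) auto
  ultimately show ?thesis by simp
qed

text \<open>Without a positive observation the density estimators vanish on \<open>[0, \<infinity>)\<close>. The
right end is then the unspecified number \<^term>\<open>Sup {} :: real\<close>, and the estimator
takes one fixed value on this event.\<close>

lemma measurable_F_MS:
  fixes T :: "nat \<Rightarrow> 'w \<Rightarrow> real" and D :: "nat \<Rightarrow> 'w \<Rightarrow> nat"
  assumes h: "h > 0" and t: "0 \<le> t" and [measurable]: "\<And>j. T j \<in> borel_measurable N" "\<And>j. D j \<in> measurable N (count_space UNIV)"
    and D: "\<And>j \<omega>. D j \<omega> \<in> {0, 1}"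
  shows "(\<lambda>\<omega>. F_MS k h n (\<lambda>j. T j \<omega>) (\<lambda>j. D j \<omega>) t) \<in> borel_measurable N"
proof -
  let ?T = "\<lambda>\<omega> j. T j \<omega>" and ?D = "\<lambda>\<omega> j. D j \<omega>"
  let ?px = "\<lambda>\<omega>. cum_est_total k h n (?T \<omega>) (?D \<omega>)" and ?py = "\<lambda>\<omega>. cum_est k h n (?T \<omega>) (?D \<omega>) 1"
  have [measurable]: "(\<lambda>\<omega>. cum_est k h n (?T \<omega>) (?D \<omega>) i s) \<in> borel_measurable N" for i s
    unfolding cum_est_eq[OF h] by measurable
  have [measurable]: "(\<lambda>\<omega>. ?px \<omega> s) \<in> borel_measurable N" for s
    unfolding cum_est_total_eq[OF h] by measurable
  define R where "R \<omega> = right_slope (lower_hull ((\<lambda>s. (?px \<omega> s, ?py \<omega> s)) ` {0..})) (?px \<omega> t)" for \<omega>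
  have [measurable]: "R \<in> borel_measurable N"
    unfolding R_def by (intro measurable_right_slope_lower_hull continuous_cum_est compact_curve h) measurable
  define c where "c = right_slope (lower_hull ((\<lambda>s. (0, 0)) ` {0..Sup {} :: real})) 0"
  have "F_MS k h n (?T \<omega>) (?D \<omega>) t = (if \<exists>j<n. 0 < T j \<omega> then R \<omega> else c)" for \<omega>
  proof (cases "\<exists>j<n. 0 < T j \<omega>")
    case True
    then show ?thesis using curve_up_to_right_end(1)[of h n "?T \<omega>" "?D \<omega>"] D h by (simp add: F_MS_def R_def)
  next
    case False
    have zero: "dens_est k h n (?T \<omega>) (?D \<omega>) i s = 0" if "s \<ge> 0" for i s
    proof -
      have "local_weight k h s (T j \<omega>) = 0" if "j < n" for j
        using False that \<open>s \<ge> 0\<close> h by (intro local_weight_nonpos_obs) auto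
      then show ?thesis by (auto simp: dens_est_eq intro!: sum.neutral)
    qed
    have cz: "cum_est k h n (?T \<omega>) (?D \<omega>) i s = 0" for i s
    proof -
      have "cum_est k h n (?T \<omega>) (?D \<omega>) i s = (LINT u:{0..s}|lborel. 0)"
        unfolding cum_est_def using zero by (intro set_lebesgue_integral_cong) auto
      then show ?thesis by simp
    qed
    have "right_end k h n (?T \<omega>) (?D \<omega>) = Sup {}"
      unfolding right_end_def using zero by (intro arg_cong[where f = Sup]) auto
    then show ?thesis unfolding if_not_P[OF False] by (simp add: F_MS_def c_def cz cum_est_total_eq[OF h])
  qed
  then show ?thesis by (simp cong: measurable_cong)
qed

lemma F_MS_eq_F_naive:
  assumes h: "h > 0" "h < t" and D: "\<And>j. D j \<in> {0, 1}" and pos: "0 < dens_est_total k h n T D t"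
    and line: "\<And>s. 0 \<le> s \<Longrightarrow> F_naive k h n T D t * (cum_est_total k h n T D s - cum_est_total k h n T D t)
        \<le> cum_est k h n T D 1 s - cum_est k h n T D 1 t"
  shows "F_MS k h n T D t = F_naive k h n T D t"
proof -
  have ex: "\<exists>j<n. 0 < T j"
  proof (rule ccontr)
    assume "\<not> ?thesis"
    then have "dens_est k h n T D i t = 0" for i
      using h local_weight_nonpos_obs[OF h(1), of t] by (auto simp: dens_est_eq intro!: sum.neutral)
    then show False using pos by (simp add: dens_est_total_def)
  qed
  have \<tau>: "t < right_end k h n T D" using curve_up_to_right_end(3)[OF h(1) ex D h(2) pos] .
  have d1: "dens_est k h n T D 1 t = F_naive k h n T D t * dens_est_total k h n T D t"
    using pos by (simp add: F_naive_def)
  show ?thesis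
    unfolding F_MS_def
  proof (rule right_slope_lower_hull_support)
    show "0 \<le> t" "t < right_end k h n T D" using h \<tau> by auto
    show "continuous_on {t..right_end k h n T D} (cum_est_total k h n T D)"
      using h by (intro continuous_on_subset[OF continuous_cum_est(2)]) auto
    show "(cum_est_total k h n T D has_real_derivative dens_est_total k h n T D t) (at t)"
      by (rule cum_est_has_derivative[OF h])
    show "(cum_est k h n T D 1 has_real_derivative F_naive k h n T D t * dens_est_total k h n T D t) (at t)"
      unfolding d1[symmetric] by (rule cum_est_has_derivative[OF h])
    show "cum_est k h n T D 1 t + F_naive k h n T D t * (cum_est_total k h n T D s - cum_est_total k h n T D t)
       \<le> cum_est k h n T D 1 s" if "s \<in> {0..right_end k h n T D}" for s
      using line[of s] that by simp
  qed (rule pos)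
qed

end

section \<open>Kernel averages of smooth functions\<close>

text \<open>After the substitution \<open>v = u - h * w\<close> a local expansion of \<open>p\<close> at
\<open>u\<close> turns into one in powers of \<open>h\<close> whose coefficients are moments of
\<open>\<kappa>\<close>. It serves for \<open>\<kappa> = k\<close> and \<open>k\<^sup>2\<close> at
\<open>t\<close>, and for \<open>\<kappa> = k'\<close> uniformly in \<open>u\<close>.\<close>

lemma kernel_average_expansion:
  fixes \<kappa> p :: "real \<Rightarrow> real"
  assumes \<kappa> [measurable]: "\<kappa> \<in> borel_measurable borel" and bound: "\<And>w. \<bar>\<kappa> w\<bar> \<le> B" and supp: "\<And>w. 1 < \<bar>w\<bar> \<Longrightarrow> \<kappa> w = 0"
    and p [measurable]: "p \<in> borel_measurable borel" and h: "0 < h"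
    and exp: "\<And>v. \<bar>v - u\<bar> \<le> h \<Longrightarrow> \<bar>p v - (q0 + q1 * (v - u) + q2 * (v - u)\<^sup>2)\<bar> \<le> \<eta> * \<bar>v - u\<bar> ^ m"
  shows "\<bar>(LINT v|lborel. \<kappa> ((u - v) / h) * p v) / h
     - (q0 * (LINT w|lborel. \<kappa> w) - q1 * h * (LINT w|lborel. w * \<kappa> w) + q2 * h\<^sup>2 * (LINT w|lborel. w\<^sup>2 * \<kappa> w))\<bar>
     \<le> \<eta> * h ^ m * (LINT w|lborel. \<bar>\<kappa> w\<bar>)"
proof -
  have \<eta>: "0 \<le> \<eta> * \<bar>v - u\<bar> ^ m" if "\<bar>v - u\<bar> \<le> h" for v using exp[OF that] by linarith
  have "0 \<le> \<eta> * h ^ m" using \<eta>[of "u + h"] h by simp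
  then have \<eta>0: "0 \<le> \<eta>" using h by (metis zero_le_mult_iff zero_less_power not_le)
  have int: "integrable lborel (\<lambda>w. w ^ i * \<kappa> w)" for i
  proof (rule integrable_bounded_support)
    show "\<bar>w ^ i * \<kappa> w\<bar> \<le> B" for w
    proof (cases "\<bar>w\<bar> \<le> 1")
      case True
      then have "\<bar>w ^ i\<bar> * \<bar>\<kappa> w\<bar> \<le> 1 * B" using bound[of w]
        by (intro mult_mono) (auto simp: power_abs power_le_one)
      then show ?thesis by (simp add: abs_mult)
    next
      case False
      then show ?thesis using supp[of w] bound[of w] by simp
    qed
    show "w ^ i * \<kappa> w = 0" if "w \<notin> {-1..1}" for w using supp[of w] that by auto
  qed measurable
  let ?P = "\<lambda>w. q0 * (w ^ 0 * \<kappa> w) - q1 * h * (w ^ 1 * \<kappa> w) + q2 * h\<^sup>2 * (w ^ 2 * \<kappa> w)"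
  have intP: "integrable lborel ?P"
    by (intro Bochner_Integration.integrable_add Bochner_Integration.integrable_diff integrable_mult_right int)
  have intabs: "integrable lborel (\<lambda>w. \<bar>\<kappa> w\<bar>)" using int[of 0] by auto
  have close: "\<bar>\<kappa> w * p (u - h * w) - ?P w\<bar> \<le> \<eta> * h ^ m * \<bar>\<kappa> w\<bar>" for w
  proof (cases "\<bar>w\<bar> \<le> 1")
    case True
    then have hw: "\<bar>h * w\<bar> \<le> h" using h by (simp add: abs_mult mult_left_le)
    have "\<kappa> w * p (u - h * w) - ?P w = \<kappa> w * (p (u - h * w) - (q0 + q1 * ((u - h * w) - u) + q2 * ((u - h * w) - u)\<^sup>2))"
      by (simp add: algebra_simps power2_eq_square)
    then have "\<bar>\<kappa> w * p (u - h * w) - ?P w\<bar> = \<bar>\<kappa> w\<bar> * \<bar>p (u - h * w) - (q0 + q1 * ((u - h * w) - u) + q2 * ((u - h * w) - u)\<^sup>2)\<bar>"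
      by (simp add: abs_mult)
    also have "\<dots> \<le> \<bar>\<kappa> w\<bar> * (\<eta> * \<bar>(u - h * w) - u\<bar> ^ m)"
      using hw by (intro mult_left_mono exp) auto
    also have "\<dots> \<le> \<bar>\<kappa> w\<bar> * (\<eta> * h ^ m)"
      using hw \<eta>0 by (intro mult_left_mono power_mono) auto
    finally show ?thesis by (simp add: mult_ac)
  next
    case False
    then show ?thesis using supp[of w] by simp
  qed
  have intD: "integrable lborel (\<lambda>w. \<kappa> w * p (u - h * w) - ?P w)"
  proof (rule Bochner_Integration.integrable_bound)
    show "integrable lborel (\<lambda>w. \<eta> * h ^ m * \<bar>\<kappa> w\<bar>)" using intabs by simp
    show "AE w in lborel. norm (\<kappa> w * p (u - h * w) - ?P w) \<le> norm (\<eta> * h ^ m * \<bar>\<kappa> w\<bar>)"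
      using close \<eta>0 h by (auto simp: abs_mult)
  qed measurable
  have "integrable lborel (\<lambda>w. (\<kappa> w * p (u - h * w) - ?P w) + ?P w)"
    using intD intP by (rule Bochner_Integration.integrable_add)
  then have intK: "integrable lborel (\<lambda>w. \<kappa> w * p (u - h * w))" by simp
  have "(LINT v|lborel. \<kappa> ((u - v) / h) * p v) = \<bar>- h\<bar> *\<^sub>R (LINT w|lborel. \<kappa> ((u - (u + - h * w)) / h) * p (u + - h * w))"
    using h by (intro lborel_integral_real_affine) auto
  also have "\<dots> = h * (LINT w|lborel. \<kappa> w * p (u - h * w))" using h by simp
  finally have "(LINT v|lborel. \<kappa> ((u - v) / h) * p v) / h = (LINT w|lborel. \<kappa> w * p (u - h * w))" using h by simp
  moreover have "(LINT w|lborel. ?P w) = q0 * (LINT w|lborel. \<kappa> w) - q1 * h * (LINT w|lborel. w * \<kappa> w) + q2 * h\<^sup>2 * (LINT w|lborel. w\<^sup>2 * \<kappa> w)"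
    using int[of 0] int[of 1] int[of 2] by simp
  ultimately have "\<bar>(LINT v|lborel. \<kappa> ((u - v) / h) * p v) / h
     - (q0 * (LINT w|lborel. \<kappa> w) - q1 * h * (LINT w|lborel. w * \<kappa> w) + q2 * h\<^sup>2 * (LINT w|lborel. w\<^sup>2 * \<kappa> w))\<bar>
     = \<bar>LINT w|lborel. \<kappa> w * p (u - h * w) - ?P w\<bar>"
    using Bochner_Integration.integral_diff[OF intK intP] by simp
  also have "\<dots> \<le> (LINT w|lborel. \<eta> * h ^ m * \<bar>\<kappa> w\<bar>)"
    using intD intabs close
    by (intro integral_abs_bound_integral) auto
  also have "\<dots> = \<eta> * h ^ m * (LINT w|lborel. \<bar>\<kappa> w\<bar>)" by simp
  finally show ?thesis .
qed

context kernel
begin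

lemma integrable_power_mult: "integrable lborel (\<lambda>u. u ^ i * k u)"
  using integrable_moment[of UNIV i] by simp

lemma first_moment: "(LINT u|lborel. u * k u) = 0"
proof -
  have "(LINT u|lborel. u * k u) = \<bar>-1\<bar> *\<^sub>R (LINT u|lborel. (0 + (-1) * u) * k (0 + (-1) * u))"
    by (rule lborel_integral_real_affine) simp
  also have "\<dots> = - (LINT u|lborel. u * k u)" by (simp add: sym)
  finally show ?thesis by simp
qed

lemma integral_deriv: "(LINT u|lborel. deriv k u) = 0"
  and integral_id_deriv: "(LINT u|lborel. u * deriv k u) = -1"
proof -
  have z: "deriv k u = 0" if "u \<notin> {-1..1}" for u using that deriv_zero_outside(1)[of u] by auto
  have "(\<integral>u. deriv k u * indicator {-1..1} u \<partial>lborel) = k 1 - k (-1)"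
    by (rule integral_FTC_Icc_real) (auto intro: smooth deriv_cont)
  moreover have "deriv k u * indicator {-1..1} u = deriv k u" for u
    using z[of u] by (auto simp: indicator_def)
  ultimately show "(LINT u|lborel. deriv k u) = 0" by (simp add: zero_outside)
  have "(\<integral>u. (k u + u * deriv k u) * indicator {-1..1} u \<partial>lborel) = 1 * k 1 - (-1) * k (-1)"
    by (rule integral_FTC_Icc_real[where F = "\<lambda>u. u * k u"])
      (auto intro!: derivative_eq_intros smooth continuous_intros cont deriv_cont)
  moreover have "(k u + u * deriv k u) * indicator {-1..1} u = k u + u * deriv k u" for u
    using z[of u] zero_outside[of u] by (cases "u \<in> {-1..1}") auto
  ultimately have *: "(\<integral>u. k u + u * deriv k u \<partial>lborel) = 0" by (simp add: zero_outside)
  obtain B where B: "\<And>u. \<bar>deriv k u\<bar> \<le> B" "B > 0" using deriv_bounded by blast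
  have "integrable lborel (\<lambda>u. u * deriv k u)"
  proof (rule integrable_bounded_support)
    show "\<bar>u * deriv k u\<bar> \<le> B" for u
    proof (cases "\<bar>u\<bar> \<le> 1")
      case True
      then have "\<bar>u\<bar> * \<bar>deriv k u\<bar> \<le> 1 * B" using B by (intro mult_mono) auto
      then show ?thesis by (simp add: abs_mult)
    next
      case False
      then have "deriv k u = 0" by (intro z) auto
      then show ?thesis using B by simp
    qed
    show "u * deriv k u = 0" if "u \<notin> {-1..1}" for u using z that by simp
  qed measurable
  moreover have "integrable lborel k" using integrable_power_mult[of 0] by simp
  ultimately have "(\<integral>u. k u + u * deriv k u \<partial>lborel) = (LINT u|lborel. k u) + (LINT u|lborel. u * deriv k u)"
    by simp
  then show "(LINT u|lborel. u * deriv k u) = -1" using * integral_1 by simp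
qed

lemma integrable_square: "integrable lborel (\<lambda>u. (k u)\<^sup>2)"
proof -
  obtain B where B: "\<And>u. \<bar>k u\<bar> \<le> B" "B > 0" using bounded by blast
  show ?thesis
  proof (rule integrable_bounded_support)
    show "\<bar>(k u)\<^sup>2\<bar> \<le> B\<^sup>2" for u using B(1)[of u] B(2) by (simp add: abs_le_square_iff[symmetric])
    show "(k u)\<^sup>2 = 0" if "u \<notin> {-1..1}" for u using zero_outside[of u] that by auto
  qed measurable
qed

lemma square_integral_pos: "0 < (LINT u|lborel. (k u)\<^sup>2)"
  and second_moment_pos: "0 < second_moment k"
proof -
  obtain u where u: "0 < u" "u < 1" "0 < k u" using pos_near_1[of 0] by auto
  have eq: "(\<lambda>u. indicator {-1..1} u * (k u)\<^sup>2) = (\<lambda>u. (k u)\<^sup>2)"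
    "(\<lambda>u. indicator {-1..1} u * (u\<^sup>2 * k u)) = (\<lambda>u. u\<^sup>2 * k u)"
  proof -
    have "k u = 0" if "u \<notin> {-1..1}" for u using zero_outside[of u] that by auto
    then show "(\<lambda>u. indicator {-1..1} u * (k u)\<^sup>2) = (\<lambda>u. (k u)\<^sup>2)"
      "(\<lambda>u. indicator {-1..1} u * (u\<^sup>2 * k u)) = (\<lambda>u. u\<^sup>2 * k u)"
      by (auto simp: indicator_def fun_eq_iff)
  qed
  have "0 < (LINT u|lborel. indicator {-1..1} u * (k u)\<^sup>2)"
    using u integrable_square by (intro integral_pos_continuous[of _ _ u]) (auto intro!: continuous_intros cont simp: eq)
  then show "0 < (LINT u|lborel. (k u)\<^sup>2)" by (simp add: eq)
  have "0 < (LINT u|lborel. indicator {-1..1} u * (u\<^sup>2 * k u))"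
    using u integrable_power_mult[of 2] nonneg
    by (intro integral_pos_continuous[of _ _ u]) (auto intro!: continuous_intros cont simp: eq)
  then show "0 < second_moment k" by (simp add: eq second_moment_def)
qed

end

text \<open>With \<open>V = a * c0 ^ 5\<close> the excess of the objective over its value at \<open>c0\<close>
is \<open>a * (c - c0)\<^sup>2 / (4 * c)\<close> times a polynomial with positive coefficients.\<close>

lemma optimal_bandwidth:
  fixes a V :: real
  assumes a: "0 < a" and V: "0 < V"
  shows "is_arg_min (\<lambda>c. c ^ 4 * a / 4 + V / c) (\<lambda>c. 0 < c) c \<longleftrightarrow> c = V powr (1 / 5) * a powr (- 1 / 5)"
proof -
  define c0 where "c0 = V powr (1 / 5) * a powr (- 1 / 5)"
  have c0: "c0 > 0" using a V by (simp add: c0_def)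
  have fifth: "(x powr (1 / 5)) ^ 5 = x" if "0 < x" for x :: real
    using that by (subst powr_realpow[symmetric]) (simp_all add: powr_powr)
  have "c0 = V powr (1 / 5) / a powr (1 / 5)" using powr_minus_divide[of a "1 / 5"] by (simp add: c0_def)
  then have "c0 ^ 5 = V / a" using fifth[OF V] fifth[OF a] by (simp add: power_divide)
  then have V5: "V = a * c0 ^ 5" using a by simp
  let ?f = "\<lambda>c. c ^ 4 * a / 4 + V / c"
  have diff: "?f c - ?f c0 = a * (c - c0)\<^sup>2 * (c ^ 3 + 2 * c0 * c\<^sup>2 + 3 * c0\<^sup>2 * c + 4 * c0 ^ 3) / (4 * c)" if "c > 0" for c
  proof -
    have 1: "4 * c * ?f c = a * c ^ 5 + 4 * a * c0 ^ 5"
      unfolding V5 using that by (simp add: distrib_left power_Suc[symmetric] numeral_eq_Suc)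
    have "?f c0 = 5 / 4 * a * c0 ^ 4"
      unfolding V5 using c0 by (simp add: eval_nat_numeral)
    then have "4 * c * (?f c - ?f c0) = a * c ^ 5 + 4 * a * c0 ^ 5 - 5 * c * a * c0 ^ 4"
      by (simp only: right_diff_distrib 1)
    also have "\<dots> = a * (c - c0)\<^sup>2 * (c ^ 3 + 2 * c0 * c\<^sup>2 + 3 * c0\<^sup>2 * c + 4 * c0 ^ 3)"
      by algebra
    finally show ?thesis using that by (simp add: eq_divide_eq mult.commute)
  qed
  have pos: "0 < c ^ 3 + 2 * c0 * c\<^sup>2 + 3 * c0\<^sup>2 * c + 4 * c0 ^ 3" if "c > 0" for c
    using that c0 by (intro add_pos_pos) auto
  have less: "?f c0 < ?f c" if "c > 0" "c \<noteq> c0" for c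
  proof -
    have "0 < a * (c - c0)\<^sup>2 * (c ^ 3 + 2 * c0 * c\<^sup>2 + 3 * c0\<^sup>2 * c + 4 * c0 ^ 3) / (4 * c)"
      using that a pos[of c] by (intro divide_pos_pos mult_pos_pos) auto
    then show ?thesis using diff[OF that(1)] by simp
  qed
  show ?thesis
    unfolding c0_def[symmetric] is_arg_min_def using c0 less by (metis less_asym not_less_iff_gr_or_eq)
qed

section \<open>Limit theorems for rows of independent variables\<close>

lemma isCont_cdf_density:
  assumes "finite_borel_measure (density lborel f)" and [measurable]: "f \<in> borel_measurable borel"
  shows "isCont (cdf (density lborel f)) x"
proof -
  interpret finite_borel_measure "density lborel f" by fact
  have "emeasure (density lborel f) {x} = 0"
    by (subst emeasure_density) (auto intro!: nn_integral_null_delta simp: nn_integral_0_iff_AE indicator_def AE_lborel_singleton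
      eventually_mono[OF AE_lborel_singleton[of x]])
  then show ?thesis by (simp add: isCont_cdf measure_def)
qed

text \<open>Standardisation, so that all limits can be stated with the standard normal law.\<close>

lemma cdf_normal_law:
  assumes v: "0 < v"
  shows "cdf (normal_law \<mu> v) x = cdf std_normal_distribution ((x - \<mu>) / sqrt v)"
proof -
  let ?N = "normal_law \<mu> v" and ?\<sigma> = "sqrt v"
  have \<sigma>: "?\<sigma> > 0" using v by simp
  interpret N: prob_space ?N unfolding normal_law_def using \<sigma> by (rule prob_space_normal_density)
  have "distributed ?N lborel (\<lambda>x. x) (normal_density \<mu> ?\<sigma>)"
    unfolding distributed_def normal_law_def
    by (auto simp: distr_id2 sets_density intro!: distr_cong[THEN trans, OF refl _ refl])
  then have "distributed ?N lborel (\<lambda>x. (x - \<mu>) / ?\<sigma>) std_normal_density"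
    using N.normal_standard_normal_convert[OF \<sigma>, of "\<lambda>x. x" \<mu>] by simp
  then have d: "distr ?N lborel (\<lambda>x. (x - \<mu>) / ?\<sigma>) = std_normal_distribution"
    by (simp add: distributed_def)
  have sN: "sets ?N = sets borel" by (simp add: normal_law_def)
  have meas: "(\<lambda>x. (x - \<mu>) / ?\<sigma>) \<in> measurable ?N lborel"
    by (rule measurable_cong_sets[OF sN refl, THEN equalityD2, THEN subsetD]) simp
  have "cdf std_normal_distribution ((x - \<mu>) / ?\<sigma>) = measure ?N ((\<lambda>x. (x - \<mu>) / ?\<sigma>) -` {..(x - \<mu>) / ?\<sigma>} \<inter> space ?N)"
    unfolding cdf_def d[symmetric] by (subst measure_distr[OF meas]) auto
  also have "(\<lambda>x. (x - \<mu>) / ?\<sigma>) -` {..(x - \<mu>) / ?\<sigma>} \<inter> space ?N = {..x}"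
    using \<sigma> by (auto simp: normal_law_def divide_le_cancel)
  finally show ?thesis by (simp add: cdf_def)
qed

context prob_space
begin

text \<open>Some of the statements below hold for uncountably many parameters at once and their validity need
not define an event; hence only an event on which they hold is asked for.\<close>

definition whp :: "(nat \<Rightarrow> 'a \<Rightarrow> bool) \<Rightarrow> bool" where
  "whp P \<longleftrightarrow> (\<exists>A. (\<forall>n. A n \<in> events) \<and> (\<lambda>n. prob (A n)) \<longlonglongrightarrow> 1 \<and> (\<forall>n. \<forall>\<omega>\<in>A n. P n \<omega>))"

lemma whp_mono:
  assumes "whp P" and ev: "\<forall>\<^sub>F n in sequentially. \<forall>\<omega>\<in>space M. P n \<omega> \<longrightarrow> Q n \<omega>"
  shows "whp Q"
proof -
  obtain A where A: "\<And>n. A n \<in> events" "(\<lambda>n. prob (A n)) \<longlonglongrightarrow> 1" "\<And>n \<omega>. \<omega> \<in> A n \<Longrightarrow> P n \<omega>"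
    using assms(1) by (auto simp: whp_def)
  define B where "B n = (if \<forall>\<omega>\<in>space M. P n \<omega> \<longrightarrow> Q n \<omega> then A n else {})" for n
  have "(\<lambda>n. prob (B n)) \<longlonglongrightarrow> 1"
    by (rule Lim_transform_eventually[OF A(2)]) (use ev in \<open>auto elim!: eventually_mono simp: B_def\<close>)
  moreover have "B n \<in> events" "\<omega> \<in> B n \<Longrightarrow> Q n \<omega>" for n \<omega>
    using A(1)[of n] A(3)[of \<omega> n] sets.sets_into_space[OF A(1)[of n]] by (auto simp: B_def split: if_splits)
  ultimately show ?thesis unfolding whp_def by blast
qed

lemma whp_conj:
  assumes "whp P" "whp Q"
  shows "whp (\<lambda>n \<omega>. P n \<omega> \<and> Q n \<omega>)"
proof -
  obtain A where A: "\<And>n. A n \<in> events" "(\<lambda>n. prob (A n)) \<longlonglongrightarrow> 1" "\<And>n \<omega>. \<omega> \<in> A n \<Longrightarrow> P n \<omega>"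
    using assms(1) by (auto simp: whp_def)
  obtain B where B: "\<And>n. B n \<in> events" "(\<lambda>n. prob (B n)) \<longlonglongrightarrow> 1" "\<And>n \<omega>. \<omega> \<in> B n \<Longrightarrow> Q n \<omega>"
    using assms(2) by (auto simp: whp_def)
  have lower: "prob (A n) + prob (B n) - 1 \<le> prob (A n \<inter> B n)" for n
  proof -
    have "prob (A n \<union> B n) = prob (A n) + prob (B n) - prob (A n \<inter> B n)"
      using A(1)[of n] B(1)[of n] by (simp add: measure_Un3 fmeasurable_eq_sets)
    then show ?thesis using prob_le_1[of "A n \<union> B n"] by simp
  qed
  have "(\<lambda>n. prob (A n \<inter> B n)) \<longlonglongrightarrow> 1"
  proof (rule tendsto_sandwich)
    show "(\<lambda>n. prob (A n) + prob (B n) - 1) \<longlonglongrightarrow> 1"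
      using tendsto_diff[OF tendsto_add[OF A(2) B(2)] tendsto_const[of 1]] by simp
    show "(\<lambda>n. 1) \<longlonglongrightarrow> (1::real)" by simp
  qed (use lower in auto)
  then show ?thesis unfolding whp_def using A B by (intro exI[of _ "\<lambda>n. A n \<inter> B n"]) auto
qed

lemma whp_ball_finite:
  assumes "finite I" "\<And>i. i \<in> I \<Longrightarrow> whp (P i)"
  shows "whp (\<lambda>n \<omega>. \<forall>i\<in>I. P i n \<omega>)"
  using assms
proof (induction I rule: finite_induct)
  case empty
  show ?case unfolding whp_def by (intro exI[of _ "\<lambda>_. space M"]) (auto simp: prob_space)
next
  case (insert i I)
  then have "whp (\<lambda>n \<omega>. P i n \<omega> \<and> (\<forall>i\<in>I. P i n \<omega>))" by (intro whp_conj) auto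
  then show ?case by (rule whp_mono) auto
qed

lemma whp_if_complement_null:
  assumes "\<And>n. E n \<in> events" "(\<lambda>n. prob (E n)) \<longlonglongrightarrow> 0"
    "\<forall>\<^sub>F n in sequentially. \<forall>\<omega>\<in>space M. \<omega> \<notin> E n \<longrightarrow> P n \<omega>"
  shows "whp P"
proof (rule whp_mono[OF _ assms(3)])
  have "(\<lambda>n. 1 - prob (E n)) \<longlonglongrightarrow> 1" using tendsto_diff[OF tendsto_const[of 1] assms(2)] by simp
  then show "whp (\<lambda>n \<omega>. \<omega> \<notin> E n)"
    unfolding whp_def using assms(1)
    by (intro exI[of _ "\<lambda>n. space M - E n"]) (auto simp: prob_compl)
qed

text \<open>The probabilities of two events that agree on \<open>A n\<close> differ by at most \<open>1 - prob
(A n)\<close>.\<close>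

lemma prob_tendsto_transfer:
  assumes lim: "(\<lambda>n. prob {\<omega>\<in>space M. P n \<omega>}) \<longlonglongrightarrow> l"
    and meas: "\<forall>\<^sub>F n in sequentially. {\<omega>\<in>space M. P n \<omega>} \<in> events \<and> {\<omega>\<in>space M. Q n \<omega>} \<in> events"
    and whp: "whp (\<lambda>n \<omega>. P n \<omega> \<longleftrightarrow> Q n \<omega>)"
  shows "(\<lambda>n. prob {\<omega>\<in>space M. Q n \<omega>}) \<longlonglongrightarrow> l"
proof -
  obtain A where A: "\<And>n. A n \<in> events" "(\<lambda>n. prob (A n)) \<longlonglongrightarrow> 1" "\<And>n \<omega>. \<omega> \<in> A n \<Longrightarrow> P n \<omega> \<longleftrightarrow> Q n \<omega>"
    using whp by (auto simp: whp_def)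
  let ?P = "\<lambda>n. {\<omega>\<in>space M. P n \<omega>}" and ?Q = "\<lambda>n. {\<omega>\<in>space M. Q n \<omega>}"
  have le: "prob U \<le> prob V + (1 - prob (A n))"
    if "U \<in> events" "V \<in> events" "U \<inter> A n \<subseteq> V" for U V n
  proof -
    have "prob U \<le> prob (V \<union> (space M - A n))"
      using that A(1)[of n] sets.sets_into_space[OF that(1)] by (intro finite_measure_mono) auto
    also have "\<dots> \<le> prob V + prob (space M - A n)"
      using that A(1)[of n] by (intro measure_Un_le) auto
    finally show ?thesis using A(1)[of n] by (simp add: prob_compl)
  qed
  have "\<forall>\<^sub>F n in sequentially. norm (prob (?Q n) - prob (?P n)) \<le> 1 - prob (A n)"
    using meas
  proof eventually_elim
    case (elim n)
    have "?P n \<inter> A n \<subseteq> ?Q n" "?Q n \<inter> A n \<subseteq> ?P n" using A(3) by auto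
    then show ?case using le[of "?P n" "?Q n" n] le[of "?Q n" "?P n" n] elim by auto
  qed
  moreover have "(\<lambda>n. 1 - prob (A n)) \<longlonglongrightarrow> 0" using tendsto_diff[OF tendsto_const[of 1] A(2)] by simp
  ultimately have "(\<lambda>n. prob (?Q n) - prob (?P n)) \<longlonglongrightarrow> 0" by (rule Lim_null_comparison)
  from tendsto_add[OF this lim] show ?thesis by simp
qed

lemma hoeffding_mean:
  fixes Y :: "nat \<Rightarrow> 'a \<Rightarrow> real"
  assumes indep: "indep_vars (\<lambda>_. borel) Y UNIV"
    and distr: "\<And>j. distr M borel (Y j) = distr M borel (Y 0)"
    and bound: "\<And>\<omega>. \<bar>Y 0 \<omega>\<bar> \<le> B" and B: "0 < B" and n: "0 < n" and \<epsilon>: "0 \<le> \<epsilon>"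
  shows "prob {\<omega>\<in>space M. \<epsilon> \<le> \<bar>(\<Sum>j<n. Y j \<omega>) / real n - expectation (Y 0)\<bar>} \<le> 2 * exp (- real n * \<epsilon>\<^sup>2 / (2 * B\<^sup>2))"
proof -
  have rv: "random_variable borel (Y j)" for j using indep by (auto simp: indep_vars_def)
  interpret H: Hoeffding_ineq_iid M "{..<n}" Y "Y 0" "- B" B "expectation (Y 0)"
  proof unfold_locales
    show "indep_vars (\<lambda>_. borel) Y {..<n}" by (rule indep_vars_subset[OF indep]) auto
    show "AE x in M. Y 0 x \<in> {- B..B}" using bound by (auto simp: abs_le_iff minus_le_iff)
  qed (use rv distr in auto)
  have eq: "- 2 * real (card {..<n}) * \<epsilon>\<^sup>2 / (B - - B)\<^sup>2 = - real n * \<epsilon>\<^sup>2 / (2 * B\<^sup>2)"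
    using B by (simp add: power2_eq_square)
  have "{..<n} \<noteq> {}" using n by auto
  from H.Hoeffding_ineq_abs_ge'[OF \<epsilon> _ this] B show ?thesis
    unfolding eq by simp
qed

text \<open>Row by row the characteristic function of the sum is \<open>\<phi> n ^ n\<close>. It is compared
with \<open>\<psi> n ^ n\<close>, where \<open>\<psi> n = exp (- \<theta>\<^sup>2 / (2 *
n))\<close>: both bases lie in the unit disc, so the powers differ by at most \<open>n\<close> times
the difference of the bases. For that difference the Taylor polynomial of order two suffices, as the
uniform bound \<open>b n\<close> controls the third absolute moment by the second moment.\<close>

theorem triangular_clt:
  fixes Y :: "nat \<Rightarrow> nat \<Rightarrow> 'a \<Rightarrow> real"
  assumes indep: "\<And>n. indep_vars (\<lambda>_. borel) (Y n) UNIV"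
    and distr: "\<And>n j. distr M borel (Y n j) = distr M borel (Y n 0)"
    and bound: "\<And>n \<omega>. \<bar>Y n 0 \<omega>\<bar> \<le> b n" and b: "b \<longlonglongrightarrow> 0"
    and mean: "(\<lambda>n. real n * expectation (Y n 0)) \<longlonglongrightarrow> 0"
    and var: "(\<lambda>n. real n * expectation (\<lambda>\<omega>. (Y n 0 \<omega>)\<^sup>2)) \<longlonglongrightarrow> 1"
  shows "weak_conv_m (\<lambda>n. distr M borel (\<lambda>\<omega>. \<Sum>j<n. Y n j \<omega>)) std_normal_distribution"
proof (rule levy_continuity)
  have rv [measurable]: "random_variable borel (Y n j)" for n j using indep by (auto simp: indep_vars_def)
  show "real_distribution (distr M borel (\<lambda>\<omega>. \<Sum>j<n. Y n j \<omega>))" for n by simp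
  show "real_distribution std_normal_distribution" by (rule real_dist_normal_dist)
  fix \<theta> :: real
  define \<phi> where "\<phi> n = char (distr M borel (Y n 0)) \<theta>" for n
  define \<psi> where "\<psi> n = complex_of_real (exp (- (\<theta>\<^sup>2 / 2) / real n))" for n
  define m where "m n = expectation (Y n 0)" for n
  define s where "s n = expectation (\<lambda>\<omega>. (Y n 0 \<omega>)\<^sup>2)" for n
  have int: "integrable M (\<lambda>\<omega>. (Y n 0 \<omega>) ^ i)" for n i
  proof (rule integrable_const_bound[of _ "b n ^ i"])
    have "\<bar>Y n 0 \<omega>\<bar> ^ i \<le> b n ^ i" for \<omega> using bound by (intro power_mono) auto
    then show "AE \<omega> in M. norm (Y n 0 \<omega> ^ i) \<le> b n ^ i" by (simp add: power_abs)
  qed measurable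
  have char_n: "char (distr M borel (\<lambda>\<omega>. \<Sum>j<n. Y n j \<omega>)) \<theta> = \<phi> n ^ n" for n
  proof -
    have "char (distr M borel (\<lambda>\<omega>. \<Sum>j<n. Y n j \<omega>)) \<theta> = (\<Prod>j<n. char (distr M borel (Y n j)) \<theta>)"
      by (rule char_distr_sum) (rule indep_vars_subset[OF indep], simp)
    also have "\<dots> = (\<Prod>j<n. \<phi> n)" unfolding \<phi>_def by (intro prod.cong refl) (metis distr)
    finally show ?thesis by simp
  qed
  have approx: "cmod (\<phi> n - (1 + \<i> * \<theta> * m n - \<theta>\<^sup>2 / 2 * s n)) \<le> \<bar>\<theta>\<bar> ^ 3 / 6 * b n * s n" for n
  proof -
    interpret D: real_distribution "distr M borel (Y n 0)" by simp
    have ex: "D.expectation (\<lambda>x. x ^ i) = expectation (\<lambda>\<omega>. Y n 0 \<omega> ^ i)" for i by (intro integral_distr) auto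
    have int': "integrable (distr M borel (Y n 0)) (\<lambda>x. x ^ i)" for i
      using int[of n i] by (simp add: integrable_distr_eq)
    have E: "expectation (\<lambda>\<omega>. min (2 * \<bar>Y n 0 \<omega>\<bar>\<^sup>2 * Suc 2) (\<bar>\<theta>\<bar> * \<bar>Y n 0 \<omega>\<bar> ^ Suc 2)) \<le> expectation (\<lambda>\<omega>. \<bar>\<theta>\<bar> * b n * (Y n 0 \<omega>)\<^sup>2)"
    proof (rule integral_mono)
      show "integrable M (\<lambda>\<omega>. \<bar>\<theta>\<bar> * b n * (Y n 0 \<omega>)\<^sup>2)" using int[of n 2] by simp
      show le: "min (2 * \<bar>Y n 0 \<omega>\<bar>\<^sup>2 * Suc 2) (\<bar>\<theta>\<bar> * \<bar>Y n 0 \<omega>\<bar> ^ Suc 2) \<le> \<bar>\<theta>\<bar> * b n * (Y n 0 \<omega>)\<^sup>2" for \<omega>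
      proof -
        have "\<bar>\<theta>\<bar> * (\<bar>Y n 0 \<omega>\<bar> * \<bar>Y n 0 \<omega>\<bar>\<^sup>2) \<le> \<bar>\<theta>\<bar> * (b n * \<bar>Y n 0 \<omega>\<bar>\<^sup>2)"
          using bound by (intro mult_left_mono mult_right_mono) auto
        moreover have "min (2 * \<bar>Y n 0 \<omega>\<bar>\<^sup>2 * Suc 2) (\<bar>\<theta>\<bar> * \<bar>Y n 0 \<omega>\<bar> ^ Suc 2) \<le> \<bar>\<theta>\<bar> * \<bar>Y n 0 \<omega>\<bar> ^ Suc 2"
          by (rule min.cobounded2)
        moreover have "\<bar>\<theta>\<bar> * \<bar>Y n 0 \<omega>\<bar> ^ Suc 2 = \<bar>\<theta>\<bar> * (\<bar>Y n 0 \<omega>\<bar> * \<bar>Y n 0 \<omega>\<bar>\<^sup>2)"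
          by (simp only: power_Suc)
        moreover have "\<bar>\<theta>\<bar> * (b n * \<bar>Y n 0 \<omega>\<bar>\<^sup>2) = \<bar>\<theta>\<bar> * b n * (Y n 0 \<omega>)\<^sup>2" by simp
        ultimately show ?thesis by linarith
      qed
      show "integrable M (\<lambda>\<omega>. min (2 * \<bar>Y n 0 \<omega>\<bar>\<^sup>2 * Suc 2) (\<bar>\<theta>\<bar> * \<bar>Y n 0 \<omega>\<bar> ^ Suc 2))"
      proof (rule Bochner_Integration.integrable_bound)
        show "integrable M (\<lambda>\<omega>. \<bar>\<theta>\<bar> * b n * (Y n 0 \<omega>)\<^sup>2)" using int[of n 2] by simp
        show "AE \<omega> in M. norm (min (2 * \<bar>Y n 0 \<omega>\<bar>\<^sup>2 * Suc 2) (\<bar>\<theta>\<bar> * \<bar>Y n 0 \<omega>\<bar> ^ Suc 2)) \<le> norm (\<bar>\<theta>\<bar> * b n * (Y n 0 \<omega>)\<^sup>2)"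
        proof (rule AE_I2)
          fix \<omega>
          have "0 \<le> min (2 * \<bar>Y n 0 \<omega>\<bar>\<^sup>2 * Suc 2) (\<bar>\<theta>\<bar> * \<bar>Y n 0 \<omega>\<bar> ^ Suc 2)" by (intro min.boundedI) auto
          then show "norm (min (2 * \<bar>Y n 0 \<omega>\<bar>\<^sup>2 * Suc 2) (\<bar>\<theta>\<bar> * \<bar>Y n 0 \<omega>\<bar> ^ Suc 2)) \<le> norm (\<bar>\<theta>\<bar> * b n * (Y n 0 \<omega>)\<^sup>2)"
            using le[of \<omega>] by (metis abs_ge_self abs_of_nonneg order_trans real_norm_def)
        qed
      qed measurable
    qed
    have "cmod (\<phi> n - (\<Sum>i\<le>2. ((\<i> * \<theta>) ^ i / fact i) * D.expectation (\<lambda>x. x ^ i))) \<le>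
      (\<bar>\<theta>\<bar>\<^sup>2 / fact (Suc 2)) * D.expectation (\<lambda>x. min (2 * \<bar>x\<bar>\<^sup>2 * Suc 2) (\<bar>\<theta>\<bar> * \<bar>x\<bar> ^ Suc 2))"
      unfolding \<phi>_def by (rule D.char_approx2) (rule int')
    also have "(\<Sum>i\<le>2. ((\<i> * \<theta>) ^ i / fact i) * D.expectation (\<lambda>x. x ^ i)) = 1 + \<i> * \<theta> * m n - \<theta>\<^sup>2 / 2 * s n"
      unfolding ex m_def s_def
      by (simp add: eval_nat_numeral prob_space algebra_simps)
    also have "D.expectation (\<lambda>x. min (2 * \<bar>x\<bar>\<^sup>2 * Suc 2) (\<bar>\<theta>\<bar> * \<bar>x\<bar> ^ Suc 2)) =
        expectation (\<lambda>\<omega>. min (2 * \<bar>Y n 0 \<omega>\<bar>\<^sup>2 * Suc 2) (\<bar>\<theta>\<bar> * \<bar>Y n 0 \<omega>\<bar> ^ Suc 2))"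
      by (intro integral_distr) auto
    also have "(\<bar>\<theta>\<bar>\<^sup>2 / fact (Suc 2)) * expectation (\<lambda>\<omega>. min (2 * \<bar>Y n 0 \<omega>\<bar>\<^sup>2 * Suc 2) (\<bar>\<theta>\<bar> * \<bar>Y n 0 \<omega>\<bar> ^ Suc 2)) \<le>
        (\<bar>\<theta>\<bar>\<^sup>2 / fact (Suc 2)) * expectation (\<lambda>\<omega>. \<bar>\<theta>\<bar> * b n * (Y n 0 \<omega>)\<^sup>2)"
      by (intro mult_left_mono E) simp
    also have "(\<bar>\<theta>\<bar>\<^sup>2 / fact (Suc 2)) * expectation (\<lambda>\<omega>. \<bar>\<theta>\<bar> * b n * (Y n 0 \<omega>)\<^sup>2) = \<bar>\<theta>\<bar> ^ 3 / 6 * b n * s n"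
      using int[of n 2] by (simp add: s_def eval_nat_numeral)
    finally show ?thesis .
  qed
  have exp_err: "real n * \<bar>exp (- a / real n) - 1 + a / real n\<bar> \<le> a\<^sup>2 / real n" if a: "0 \<le> a" and n: "0 < n" for a n
  proof -
    define x where "x = a / real n"
    have x: "0 \<le> x" using a n by (simp add: x_def)
    have "1 + - x \<le> exp (- x)" by (rule exp_ge_add_one_self)
    moreover have "exp (- x) \<le> 1 / (1 + x)"
      using exp_ge_add_one_self[of x] x by (simp add: exp_minus inverse_eq_divide frac_le)
    moreover have "1 / (1 + x) \<le> 1 - x + x\<^sup>2"
    proof -
      have "1 \<le> (1 - x + x\<^sup>2) * (1 + x)" using x by (simp add: algebra_simps power2_eq_square)
      then show ?thesis using x by (simp add: pos_divide_le_eq)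
    qed
    ultimately have "\<bar>exp (- x) - 1 + x\<bar> \<le> x\<^sup>2" by (simp add: abs_le_iff)
    then have "real n * \<bar>exp (- x) - 1 + x\<bar> \<le> real n * x\<^sup>2" by (intro mult_left_mono) auto
    then show ?thesis using n by (simp add: x_def power2_eq_square)
  qed
  have bound_n: "cmod (\<phi> n ^ n - \<psi> n ^ n) \<le> \<bar>\<theta>\<bar> ^ 3 / 6 * b n * (real n * s n) + \<bar>\<theta>\<bar> * \<bar>real n * m n\<bar>
      + \<theta>\<^sup>2 / 2 * \<bar>real n * s n - 1\<bar> + (\<theta>\<^sup>2 / 2)\<^sup>2 / real n" if n: "0 < n" for n
  proof -
    interpret D: real_distribution "distr M borel (Y n 0)" by simp
    have "\<phi> n - \<psi> n = (\<phi> n - (1 + \<i> * \<theta> * m n - \<theta>\<^sup>2 / 2 * s n)) + \<i> * of_real (\<theta> * m n)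
        - of_real (\<theta>\<^sup>2 / 2 * (s n - 1 / real n)) - of_real (exp (- (\<theta>\<^sup>2 / 2) / real n) - 1 + (\<theta>\<^sup>2 / 2) / real n)"
      by (simp add: \<psi>_def algebra_simps add_divide_distrib diff_divide_distrib)
    also have "cmod \<dots> \<le> cmod (\<phi> n - (1 + \<i> * \<theta> * m n - \<theta>\<^sup>2 / 2 * s n)) + cmod (\<i> * of_real (\<theta> * m n))
        + cmod (of_real (\<theta>\<^sup>2 / 2 * (s n - 1 / real n))) + cmod (of_real (exp (- (\<theta>\<^sup>2 / 2) / real n) - 1 + (\<theta>\<^sup>2 / 2) / real n))"
      by (intro order_trans[OF norm_triangle_ineq4] add_mono order_trans[OF norm_triangle_ineq] order_refl)
    finally have tri: "cmod (\<phi> n - \<psi> n) \<le> cmod (\<phi> n - (1 + \<i> * \<theta> * m n - \<theta>\<^sup>2 / 2 * s n)) + cmod (\<i> * of_real (\<theta> * m n))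
        + cmod (of_real (\<theta>\<^sup>2 / 2 * (s n - 1 / real n))) + cmod (of_real (exp (- (\<theta>\<^sup>2 / 2) / real n) - 1 + (\<theta>\<^sup>2 / 2) / real n))" .
    have "cmod (\<phi> n ^ n - \<psi> n ^ n) \<le> real n * cmod (\<phi> n - \<psi> n)"
      using D.cmod_char_le_1 by (intro norm_power_diff) (auto simp: \<phi>_def \<psi>_def)
    also have "real n * cmod (\<phi> n - \<psi> n) \<le> real n * (cmod (\<phi> n - (1 + \<i> * \<theta> * m n - \<theta>\<^sup>2 / 2 * s n)) + cmod (\<i> * of_real (\<theta> * m n))
        + cmod (of_real (\<theta>\<^sup>2 / 2 * (s n - 1 / real n))) + cmod (of_real (exp (- (\<theta>\<^sup>2 / 2) / real n) - 1 + (\<theta>\<^sup>2 / 2) / real n)))"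
      by (intro mult_left_mono tri) simp
    also have "\<dots> = real n * cmod (\<phi> n - (1 + \<i> * \<theta> * m n - \<theta>\<^sup>2 / 2 * s n)) + real n * (\<bar>\<theta>\<bar> * \<bar>m n\<bar>)
       + real n * (\<theta>\<^sup>2 / 2 * \<bar>s n - 1 / real n\<bar>) + real n * \<bar>exp (- (\<theta>\<^sup>2 / 2) / real n) - 1 + (\<theta>\<^sup>2 / 2) / real n\<bar>"
      unfolding norm_of_real norm_mult norm_ii by (simp add: abs_mult distrib_left)
    also have "\<dots> \<le> real n * (\<bar>\<theta>\<bar> ^ 3 / 6 * b n * s n) + real n * (\<bar>\<theta>\<bar> * \<bar>m n\<bar>)
       + real n * (\<theta>\<^sup>2 / 2 * \<bar>s n - 1 / real n\<bar>) + (\<theta>\<^sup>2 / 2)\<^sup>2 / real n"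
      using approx[of n] exp_err[OF _ n, of "\<theta>\<^sup>2 / 2"] by (intro add_mono mult_left_mono) auto
    also have "real n * (\<bar>\<theta>\<bar> * \<bar>m n\<bar>) = \<bar>\<theta>\<bar> * \<bar>real n * m n\<bar>" by (simp add: abs_mult)
    also have "real n * (\<theta>\<^sup>2 / 2 * \<bar>s n - 1 / real n\<bar>) = \<theta>\<^sup>2 / 2 * \<bar>real n * s n - 1\<bar>"
    proof -
      have "real n * s n - 1 = real n * (s n - 1 / real n)" using n by (simp add: right_diff_distrib)
      then show ?thesis by (simp add: abs_mult)
    qed
    finally show ?thesis by (simp add: mult_ac)
  qed
  have lim0: "(\<lambda>n. \<bar>\<theta>\<bar> ^ 3 / 6 * b n * (real n * s n) + \<bar>\<theta>\<bar> * \<bar>real n * m n\<bar>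
      + \<theta>\<^sup>2 / 2 * \<bar>real n * s n - 1\<bar> + (\<theta>\<^sup>2 / 2)\<^sup>2 / real n) \<longlonglongrightarrow>
      \<bar>\<theta>\<bar> ^ 3 / 6 * 0 * 1 + \<bar>\<theta>\<bar> * \<bar>0\<bar> + \<theta>\<^sup>2 / 2 * \<bar>1 - 1\<bar> + 0"
    using mean var b unfolding m_def[symmetric] s_def[symmetric]
    by (intro tendsto_intros tendsto_divide_0[OF tendsto_const] filterlim_at_top_imp_at_infinity filterlim_real_sequentially)
  have "(\<lambda>n. \<phi> n ^ n - \<psi> n ^ n) \<longlonglongrightarrow> 0"
    by (rule Lim_null_comparison[OF eventually_mono[OF eventually_gt_at_top[of 0] bound_n]]) (use lim0 in auto)
  moreover have "\<forall>\<^sub>F n in sequentially. \<psi> n ^ n = complex_of_real (exp (- (\<theta>\<^sup>2) / 2))"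
    using eventually_gt_at_top[of 0]
  proof eventually_elim
    case (elim n)
    then show ?case by (simp add: \<psi>_def flip: of_real_power exp_of_nat_mult)
  qed
  then have "(\<lambda>n. \<psi> n ^ n) \<longlonglongrightarrow> complex_of_real (exp (- (\<theta>\<^sup>2) / 2))" by (rule tendsto_eventually)
  ultimately have "(\<lambda>n. \<phi> n ^ n) \<longlonglongrightarrow> complex_of_real (exp (- (\<theta>\<^sup>2) / 2))"
    using tendsto_add by fastforce
  then show "(\<lambda>n. char (distr M borel (\<lambda>\<omega>. \<Sum>j<n. Y n j \<omega>)) \<theta>) \<longlonglongrightarrow> char std_normal_distribution \<theta>"
    by (simp add: char_n char_std_normal_distribution)
qed

text \<open>The rows are centred with the limit \<open>m\<close> of the means, not with the means themselves;
the event that the sum is nonpositive then becomes an event with a fixed threshold for the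
standardised sum.\<close>

corollary triangular_clt_prob:
  fixes Y :: "nat \<Rightarrow> nat \<Rightarrow> 'a \<Rightarrow> real"
  assumes indep: "\<And>n. indep_vars (\<lambda>_. borel) (Y n) UNIV"
    and distr: "\<And>n j. distr M borel (Y n j) = distr M borel (Y n 0)"
    and bound: "\<And>n \<omega>. \<bar>Y n 0 \<omega>\<bar> \<le> b n" and b: "b \<longlonglongrightarrow> 0"
    and mean: "(\<lambda>n. real n * expectation (Y n 0)) \<longlonglongrightarrow> m"
    and var: "(\<lambda>n. real n * expectation (\<lambda>\<omega>. (Y n 0 \<omega>)\<^sup>2)) \<longlonglongrightarrow> v" and v: "0 < v"
  shows "(\<lambda>n. prob {\<omega>\<in>space M. (\<Sum>j<n. Y n j \<omega>) \<le> 0}) \<longlonglongrightarrow> cdf std_normal_distribution (- m / sqrt v)"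
proof -
  have rv [measurable]: "random_variable borel (Y n j)" for n j using indep by (auto simp: indep_vars_def)
  define Z where "Z n j \<omega> = (Y n j \<omega> - m / real n) / sqrt v" for n j \<omega>
  have int: "integrable M (Y n 0)" "integrable M (\<lambda>\<omega>. (Y n 0 \<omega>)\<^sup>2)" for n
  proof -
    show "integrable M (Y n 0)" using bound by (intro integrable_const_bound[of _ "b n"]) auto
    have "\<bar>Y n 0 \<omega>\<bar>\<^sup>2 \<le> (b n)\<^sup>2" for \<omega> using bound by (intro power_mono) auto
    then show "integrable M (\<lambda>\<omega>. (Y n 0 \<omega>)\<^sup>2)" by (intro integrable_const_bound[of _ "(b n)\<^sup>2"]) auto
  qed
  have m0: "(\<lambda>n. m / real n) \<longlonglongrightarrow> 0"
    by (intro tendsto_divide_0[OF tendsto_const] filterlim_at_top_imp_at_infinity filterlim_real_sequentially)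
  have m20: "(\<lambda>n. m\<^sup>2 / real n) \<longlonglongrightarrow> 0"
    by (intro tendsto_divide_0[OF tendsto_const] filterlim_at_top_imp_at_infinity filterlim_real_sequentially)
  have "weak_conv_m (\<lambda>n. distr M borel (\<lambda>\<omega>. \<Sum>j<n. Z n j \<omega>)) std_normal_distribution"
  proof (rule triangular_clt)
    show "indep_vars (\<lambda>_. borel) (Z n) UNIV" for n
      unfolding Z_def[abs_def] by (rule indep_vars_compose2[OF indep]) auto
    show "distr M borel (Z n j) = distr M borel (Z n 0)" for n j
    proof -
      let ?f = "\<lambda>y. (y - m / real n) / sqrt v"
      have "distr M borel (Z n j) = distr (distr M borel (Y n j)) borel ?f" for j
        by (subst distr_distr) (auto simp: Z_def[abs_def] comp_def)
      then show ?thesis using distr[of n j] by simp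
    qed
    show "\<bar>Z n 0 \<omega>\<bar> \<le> (b n + \<bar>m / real n\<bar>) / sqrt v" for n \<omega>
    proof -
      have "\<bar>Y n 0 \<omega> - m / real n\<bar> \<le> b n + \<bar>m / real n\<bar>" using bound[of n \<omega>] by linarith
      then show ?thesis using v by (simp add: Z_def abs_divide divide_right_mono)
    qed
    have "(\<lambda>n. (b n + \<bar>m / real n\<bar>) / sqrt v) \<longlonglongrightarrow> (0 + \<bar>0\<bar>) / sqrt v"
      using v by (intro tendsto_intros b m0) auto
    then show "(\<lambda>n. (b n + \<bar>m / real n\<bar>) / sqrt v) \<longlonglongrightarrow> 0" by simp
    have "(\<lambda>n. (real n * expectation (Y n 0) - m) / sqrt v) \<longlonglongrightarrow> (m - m) / sqrt v"
      using v by (intro tendsto_intros mean) auto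
    moreover have "\<forall>\<^sub>F n in sequentially. (real n * expectation (Y n 0) - m) / sqrt v = real n * expectation (Z n 0)"
      using eventually_gt_at_top[of 0]
    proof eventually_elim
      case (elim n)
      have "expectation (Z n 0) = (expectation (Y n 0) - m / real n) / sqrt v"
        unfolding Z_def[abs_def] using int(1)[of n] by (simp add: prob_space)
      then show ?case using elim v by (simp add: field_simps)
    qed
    ultimately show "(\<lambda>n. real n * expectation (Z n 0)) \<longlonglongrightarrow> 0" by (auto intro: Lim_transform_eventually)
    have "(\<lambda>n. (real n * expectation (\<lambda>\<omega>. (Y n 0 \<omega>)\<^sup>2) - 2 * (m / real n) * (real n * expectation (Y n 0)) + m\<^sup>2 / real n) / v)
       \<longlonglongrightarrow> (v - 2 * 0 * m + 0) / v"
      using v by (intro tendsto_intros mean var m0 m20) auto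
    moreover have "\<forall>\<^sub>F n in sequentially. (real n * expectation (\<lambda>\<omega>. (Y n 0 \<omega>)\<^sup>2) - 2 * (m / real n) * (real n * expectation (Y n 0)) + m\<^sup>2 / real n) / v
        = real n * expectation (\<lambda>\<omega>. (Z n 0 \<omega>)\<^sup>2)"
      using eventually_gt_at_top[of 0]
    proof eventually_elim
      case (elim n)
      have eq: "(Z n 0 \<omega>)\<^sup>2 = ((Y n 0 \<omega>)\<^sup>2 - 2 * (m / real n) * Y n 0 \<omega> + (m / real n)\<^sup>2) / v" for \<omega>
        using v by (simp add: Z_def power_divide power2_diff)
      have "expectation (\<lambda>\<omega>. (Z n 0 \<omega>)\<^sup>2) = (expectation (\<lambda>\<omega>. (Y n 0 \<omega>)\<^sup>2) - 2 * (m / real n) * expectation (Y n 0) + (m / real n)\<^sup>2) / v"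
        unfolding eq using int[of n] by (simp add: prob_space)
      then show ?case using elim v by (simp add: field_simps power2_eq_square)
    qed
    ultimately show "(\<lambda>n. real n * expectation (\<lambda>\<omega>. (Z n 0 \<omega>)\<^sup>2)) \<longlonglongrightarrow> 1"
      using v by (auto intro: Lim_transform_eventually)
  qed
  moreover have "isCont (cdf std_normal_distribution) (- m / sqrt v)"
    using real_distribution.finite_borel_measure_M[OF real_dist_normal_dist] by (intro isCont_cdf_density) auto
  ultimately have "(\<lambda>n. cdf (distr M borel (\<lambda>\<omega>. \<Sum>j<n. Z n j \<omega>)) (- m / sqrt v)) \<longlonglongrightarrow> cdf std_normal_distribution (- m / sqrt v)"
    by (auto simp: weak_conv_m_def weak_conv_def)
  moreover have "\<forall>\<^sub>F n in sequentially. cdf (distr M borel (\<lambda>\<omega>. \<Sum>j<n. Z n j \<omega>)) (- m / sqrt v) = prob {\<omega>\<in>space M. (\<Sum>j<n. Y n j \<omega>) \<le> 0}"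
    using eventually_gt_at_top[of 0]
  proof eventually_elim
    case (elim n)
    have [measurable]: "random_variable borel (Z n j)" for j unfolding Z_def[abs_def] by measurable
    have "(\<Sum>j<n. Z n j \<omega>) = ((\<Sum>j<n. Y n j \<omega>) - m) / sqrt v" for \<omega>
      using elim by (simp add: Z_def sum_subtractf flip: sum_divide_distrib)
    then have "(\<Sum>j<n. Z n j \<omega>) \<le> - m / sqrt v \<longleftrightarrow> (\<Sum>j<n. Y n j \<omega>) \<le> 0" for \<omega>
    proof -
      have "((\<Sum>j<n. Y n j \<omega>) - m) / sqrt v \<le> - m / sqrt v \<longleftrightarrow> (\<Sum>j<n. Y n j \<omega>) - m \<le> - m"
        using v by (intro divide_le_cancel[THEN trans]) auto
      then show ?thesis using \<open>(\<Sum>j<n. Z n j \<omega>) = ((\<Sum>j<n. Y n j \<omega>) - m) / sqrt v\<close> by simp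
    qed
    then show ?case by (simp add: cdf_def measure_distr vimage_def Int_def conj_commute)
  qed
  ultimately show ?thesis by (rule Lim_transform_eventually)
qed

end

section \<open>The current status model\<close>

lemma distributed_density_measurable:
  assumes "distributed M lborel Y (\<lambda>x. ennreal (f x))" and "\<And>x. 0 \<le> f x"
  shows "f \<in> borel_measurable borel"
proof -
  have "(\<lambda>x. ennreal (f x)) \<in> borel_measurable lborel" using assms(1) by (rule distributed_borel_measurable)
  then have "(\<lambda>x. enn2real (ennreal (f x))) \<in> borel_measurable lborel" by measurable
  then show ?thesis using assms(2) by simp
qed

lemma distributed_distr_borel:
  assumes "distributed M lborel Y f"
  shows "distr M borel Y = density lborel f"
proof -
  have "distr M borel Y = distr M lborel Y" by (rule distr_cong) auto
  then show ?thesis using assms by (simp add: distributed_def)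
qed

text \<open>\<open>F\<^sub>0\<close> is the distribution function of the event times \<open>X i\<close>, and
\<open>g\<close> the density of the inspection times \<open>T i\<close>.\<close>

locale current_status = prob_space M for M :: "'a measure" +
  fixes X T :: "nat \<Rightarrow> 'a \<Rightarrow> real" and F\<^sub>0 g :: "real \<Rightarrow> real"
  assumes indep: "indep_vars (\<lambda>_. borel) (case_sum X T) UNIV"
    and X_cdf: "\<And>i. cdf (distr M borel (X i)) = F\<^sub>0"
    and T_dens: "\<And>i. distributed M lborel (T i) (\<lambda>x. ennreal (g x))"
    and g_nonneg: "\<And>x. 0 \<le> g x"
    and T_nonneg: "\<And>i. AE \<omega> in M. 0 \<le> T i \<omega>"
begin

definition status :: "nat \<Rightarrow> 'a \<Rightarrow> real" where
  "status j \<omega> = (if X j \<omega> \<le> T j \<omega> then 1 else 0)"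

text \<open>Weights that are affine in the status cover both estimators and their linear combinations:
\<open>\<gamma> = 0\<close> ignores the status, \<open>(\<alpha>, \<gamma>) = (0, 1)\<close> and
\<open>(1, -1)\<close> select the observations with status \<open>1\<close> and \<open>0\<close>. As
the status is \<open>0\<close> or \<open>1\<close>, squares of such weights are again of this form.\<close>

definition weighted_mean :: "(real \<Rightarrow> real) \<Rightarrow> real \<Rightarrow> real \<Rightarrow> nat \<Rightarrow> 'a \<Rightarrow> real" where
  "weighted_mean \<kappa> \<alpha> \<gamma> n \<omega> = (\<Sum>j<n. \<kappa> (T j \<omega>) * (\<alpha> + \<gamma> * status j \<omega>)) / real n"

text \<open>The expectation of \<^const>\<open>weighted_mean\<close>, see \<open>expectation_weighted\<close>.\<close>

definition weighted_integral :: "(real \<Rightarrow> real) \<Rightarrow> real \<Rightarrow> real \<Rightarrow> real" where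
  "weighted_integral \<kappa> \<alpha> \<gamma> = (LINT v|lborel. \<kappa> v * ((\<alpha> + \<gamma> * F\<^sub>0 v) * g v))"

lemma measurable_X [measurable]: "random_variable borel (X i)"
  and measurable_T [measurable]: "random_variable borel (T i)"
proof -
  have *: "random_variable borel (case_sum X T s)" for s using indep by (auto simp: indep_vars_def)
  show "random_variable borel (X i)" "random_variable borel (T i)" using *[of "Inl i"] *[of "Inr i"] by simp_all
qed

lemma measurable_status [measurable]: "random_variable borel (status j)"
  unfolding status_def[abs_def] by measurable

lemma F0_mono: "x \<le> y \<Longrightarrow> F\<^sub>0 x \<le> F\<^sub>0 y"
  and F0_nonneg: "0 \<le> F\<^sub>0 x" and F0_le_1: "F\<^sub>0 x \<le> 1"
proof -
  interpret D: real_distribution "distr M borel (X 0)" by simp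
  show "x \<le> y \<Longrightarrow> F\<^sub>0 x \<le> F\<^sub>0 y" "0 \<le> F\<^sub>0 x" "F\<^sub>0 x \<le> 1"
    using D.cdf_nondecreasing[of x y] D.cdf_nonneg[of x] D.cdf_bounded_prob[of x] by (simp_all add: X_cdf)
qed

lemma measurable_F0 [measurable]: "F\<^sub>0 \<in> borel_measurable borel"
  by (rule borel_measurable_mono) (auto simp: mono_def F0_mono)

lemma measurable_g [measurable]: "g \<in> borel_measurable borel"
  by (rule distributed_density_measurable[OF T_dens g_nonneg])

lemma distr_T: "distr M borel (T i) = density lborel (\<lambda>x. ennreal (g x))"
  by (rule distributed_distr_borel[OF T_dens])

lemma distr_X: "distr M borel (X i) = distr M borel (X j)"
  by (rule cdf_unique) (simp_all add: X_cdf)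

text \<open>Independence of \<open>T i\<close> and \<open>X i\<close>.\<close>

lemma distr_T_X: "distr M (borel \<Otimes>\<^sub>M borel) (\<lambda>\<omega>. (T i \<omega>, X i \<omega>)) = distr M borel (T i) \<Otimes>\<^sub>M distr M borel (X i)"
proof -
  have "indep_vars (\<lambda>_. borel) (case_sum X T) {Inr i, Inl i}" by (rule indep_vars_subset[OF indep]) auto
  then have "indep_var (PiM {Inr i} (\<lambda>_. borel)) (\<lambda>\<omega>. restrict (\<lambda>s. case_sum X T s \<omega>) {Inr i})
     (PiM {Inl i} (\<lambda>_. borel)) (\<lambda>\<omega>. restrict (\<lambda>s. case_sum X T s \<omega>) {Inl i})"
    by (rule indep_var_restrict) auto
  then have "indep_var borel ((\<lambda>f. f (Inr i)) \<circ> (\<lambda>\<omega>. restrict (\<lambda>s. case_sum X T s \<omega>) {Inr i}))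
     borel ((\<lambda>f. f (Inl i)) \<circ> (\<lambda>\<omega>. restrict (\<lambda>s. case_sum X T s \<omega>) {Inl i}))"
    by (rule indep_var_compose) (auto intro!: measurable_component_singleton)
  then have "indep_var borel (T i) borel (X i)" by (simp add: comp_def)
  then show ?thesis using indep_var_distribution_eq by metis
qed

lemma sample_indep:
  assumes [measurable]: "\<phi> \<in> borel_measurable (borel \<Otimes>\<^sub>M borel)"
  shows "indep_vars (\<lambda>_. borel) (\<lambda>j \<omega>. \<phi> (T j \<omega>, X j \<omega>)) (UNIV :: nat set)"
proof -
  have "indep_vars (\<lambda>j. PiM {Inr j, Inl j} (\<lambda>_. borel)) (\<lambda>j \<omega>. restrict (\<lambda>s. case_sum X T s \<omega>) {Inr j, Inl j}) (UNIV :: nat set)"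
    by (rule indep_vars_restrict[OF indep]) (auto simp: disjoint_family_on_def)
  then have "indep_vars (\<lambda>_. borel) (\<lambda>j \<omega>. (\<lambda>f. \<phi> (f (Inr j), f (Inl j))) (restrict (\<lambda>s. case_sum X T s \<omega>) {Inr j, Inl j})) (UNIV :: nat set)"
    by (rule indep_vars_compose2) (intro measurable_compose[OF _ assms] measurable_Pair measurable_component_singleton; simp)
  then show ?thesis by simp
qed

lemma sample_distr:
  assumes [measurable]: "\<phi> \<in> borel_measurable (borel \<Otimes>\<^sub>M borel)"
  shows "distr M borel (\<lambda>\<omega>. \<phi> (T j \<omega>, X j \<omega>)) = distr M borel (\<lambda>\<omega>. \<phi> (T 0 \<omega>, X 0 \<omega>))"
proof -
  have "distr M borel (\<lambda>\<omega>. \<phi> (T j \<omega>, X j \<omega>)) = distr (distr M (borel \<Otimes>\<^sub>M borel) (\<lambda>\<omega>. (T j \<omega>, X j \<omega>))) borel \<phi>" for j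
    by (subst distr_distr) (auto simp: comp_def)
  then show ?thesis unfolding distr_T_X using distr_X[of j 0] by (simp add: distr_T)
qed

text \<open>Given \<open>T j = v\<close>, the status has expectation \<open>F\<^sub>0 v\<close> by independence
of \<open>X j\<close> and \<open>T j\<close>.\<close>

lemma expectation_weighted:
  assumes [measurable]: "\<kappa> \<in> borel_measurable borel" and bound: "\<And>v. \<bar>\<kappa> v\<bar> \<le> B"
  shows "expectation (\<lambda>\<omega>. \<kappa> (T j \<omega>) * (\<alpha> + \<gamma> * status j \<omega>)) = weighted_integral \<kappa> \<alpha> \<gamma>"
    and "integrable lborel (\<lambda>v. \<kappa> v * ((\<alpha> + \<gamma> * F\<^sub>0 v) * g v))"
proof -
  let ?\<phi> = "\<lambda>(v, x). \<kappa> v * (\<alpha> + \<gamma> * indicator {..v} (x::real)) :: real"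
  let ?DT = "distr M borel (T j)" and ?DX = "distr M borel (X j)"
  interpret DT: real_distribution ?DT by simp
  interpret DX: real_distribution ?DX by simp
  interpret P: pair_prob_space ?DT ?DX ..
  have [measurable]: "(\<lambda>(v, x). indicator {..v} (x::real) :: real) \<in> borel_measurable (borel \<Otimes>\<^sub>M borel)"
  proof -
    have "(\<lambda>p::real\<times>real. if snd p \<le> fst p then 1 else 0 :: real) \<in> borel_measurable (borel \<Otimes>\<^sub>M borel)" by measurable
    also have "(\<lambda>p::real\<times>real. if snd p \<le> fst p then 1 else 0 :: real) = (\<lambda>(v, x). indicator {..v} x)"
      by (auto simp: fun_eq_iff indicator_def)
    finally show ?thesis .
  qed
  have m: "?\<phi> \<in> borel_measurable (borel \<Otimes>\<^sub>M borel)" by measurable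
  have sets_eq: "sets (?DT \<Otimes>\<^sub>M ?DX) = sets (borel \<Otimes>\<^sub>M borel)" by (intro sets_pair_measure_cong) simp_all
  have m': "?\<phi> \<in> borel_measurable (?DT \<Otimes>\<^sub>M ?DX)" using m by (simp cong: measurable_cong_sets add: sets_eq)
  have int: "integrable (?DT \<Otimes>\<^sub>M ?DX) ?\<phi>"
  proof (rule P.P.integrable_const_bound[of _ "B * (\<bar>\<alpha>\<bar> + \<bar>\<gamma>\<bar>)"])
    have "\<bar>\<kappa> v\<bar> * \<bar>\<alpha> + \<gamma> * indicator {..v} x\<bar> \<le> B * (\<bar>\<alpha>\<bar> + \<bar>\<gamma>\<bar>)" for v x :: real
      using bound[of v] by (intro mult_mono) (auto simp: indicator_def)
    then show "AE p in ?DT \<Otimes>\<^sub>M ?DX. norm (?\<phi> p) \<le> B * (\<bar>\<alpha>\<bar> + \<bar>\<gamma>\<bar>)" by (auto simp: abs_mult)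
  qed (rule m')
  have inner: "(LINT x|?DX. ?\<phi> (v, x)) = \<kappa> v * (\<alpha> + \<gamma> * F\<^sub>0 v)" for v
  proof -
    have "integrable ?DX (\<lambda>x. indicator {..v} x :: real)" by (rule DX.integrable_const_bound[of _ 1]) auto
    then have "(LINT x|?DX. \<kappa> v * (\<alpha> + \<gamma> * indicator {..v} x)) = \<kappa> v * (\<alpha> + \<gamma> * (LINT x|?DX. indicator {..v} x))"
      using DX.prob_space by simp
    also have "(LINT x|?DX. indicator {..v} x) = F\<^sub>0 v" using X_cdf[of j] by (auto simp: cdf_def)
    finally show ?thesis by simp
  qed
  have "expectation (\<lambda>\<omega>. \<kappa> (T j \<omega>) * (\<alpha> + \<gamma> * status j \<omega>)) = expectation (\<lambda>\<omega>. ?\<phi> (T j \<omega>, X j \<omega>))"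
    by (intro Bochner_Integration.integral_cong refl) (auto simp: status_def indicator_def)
  also have "\<dots> = integral\<^sup>L (distr M (borel \<Otimes>\<^sub>M borel) (\<lambda>\<omega>. (T j \<omega>, X j \<omega>))) ?\<phi>"
    by (rule integral_distr[symmetric]) (use m in simp_all)
  also have "\<dots> = integral\<^sup>L (?DT \<Otimes>\<^sub>M ?DX) ?\<phi>" by (simp only: distr_T_X)
  also have "\<dots> = (LINT v|?DT. (LINT x|?DX. ?\<phi> (v, x)))" using P.integral_fst'[OF int] by simp
  also have "\<dots> = (LINT v|?DT. \<kappa> v * (\<alpha> + \<gamma> * F\<^sub>0 v))" by (simp only: inner)
  also have "\<dots> = (LINT v|lborel. g v *\<^sub>R (\<kappa> v * (\<alpha> + \<gamma> * F\<^sub>0 v)))"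
    unfolding distr_T using g_nonneg by (intro integral_density) auto
  finally show "expectation (\<lambda>\<omega>. \<kappa> (T j \<omega>) * (\<alpha> + \<gamma> * status j \<omega>)) = weighted_integral \<kappa> \<alpha> \<gamma>"
    by (simp add: weighted_integral_def mult_ac)
  have "integrable ?DT (\<lambda>v. \<kappa> v * (\<alpha> + \<gamma> * F\<^sub>0 v))"
    using P.integrable_fst'[OF int] unfolding inner .
  then have "integrable lborel (\<lambda>v. g v *\<^sub>R (\<kappa> v * (\<alpha> + \<gamma> * F\<^sub>0 v)))"
    unfolding distr_T using g_nonneg by (subst (asm) integrable_density) auto
  then show "integrable lborel (\<lambda>v. \<kappa> v * ((\<alpha> + \<gamma> * F\<^sub>0 v) * g v))" by (simp add: mult_ac)
qed

lemma weighted_indep: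
  assumes [measurable]: "\<kappa> \<in> borel_measurable borel"
  shows "indep_vars (\<lambda>_. borel) (\<lambda>j \<omega>. \<kappa> (T j \<omega>) * (\<alpha> + \<gamma> * status j \<omega>)) (UNIV :: nat set)"
    and "distr M borel (\<lambda>\<omega>. \<kappa> (T j \<omega>) * (\<alpha> + \<gamma> * status j \<omega>)) = distr M borel (\<lambda>\<omega>. \<kappa> (T 0 \<omega>) * (\<alpha> + \<gamma> * status 0 \<omega>))"
proof -
  let ?\<phi> = "\<lambda>p. \<kappa> (fst p) * (\<alpha> + \<gamma> * (if snd p \<le> fst p then 1 else 0)) :: real"
  have m: "?\<phi> \<in> borel_measurable (borel \<Otimes>\<^sub>M borel)" by measurable
  show "indep_vars (\<lambda>_. borel) (\<lambda>j \<omega>. \<kappa> (T j \<omega>) * (\<alpha> + \<gamma> * status j \<omega>)) (UNIV :: nat set)"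
    using sample_indep[OF m] by (simp add: status_def)
  show "distr M borel (\<lambda>\<omega>. \<kappa> (T j \<omega>) * (\<alpha> + \<gamma> * status j \<omega>)) = distr M borel (\<lambda>\<omega>. \<kappa> (T 0 \<omega>) * (\<alpha> + \<gamma> * status 0 \<omega>))"
    using sample_distr[OF m] by (simp add: status_def)
qed

lemma measurable_weighted_mean [measurable (raw)]:
  assumes [measurable]: "\<kappa> \<in> borel_measurable borel"
  shows "random_variable borel (weighted_mean \<kappa> \<alpha> \<gamma> n)"
  unfolding weighted_mean_def[abs_def] by measurable

text \<open>Hoeffding's inequality. One bound serves for laws of large numbers and, because it is exponential,
for maxima over grids that grow with \<open>n\<close>.\<close>

lemma weighted_mean_concentration:
  assumes [measurable]: "\<kappa> \<in> borel_measurable borel" and bound: "\<And>v. \<bar>\<kappa> v\<bar> \<le> B" and B: "0 < B"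
    and A: "\<bar>\<alpha>\<bar> + \<bar>\<gamma>\<bar> \<le> A" "0 < A" and n: "0 < n" and \<epsilon>: "0 \<le> \<epsilon>"
  shows "prob {\<omega>\<in>space M. \<epsilon> \<le> \<bar>weighted_mean \<kappa> \<alpha> \<gamma> n \<omega> - weighted_integral \<kappa> \<alpha> \<gamma>\<bar>}
    \<le> 2 * exp (- real n * \<epsilon>\<^sup>2 / (2 * (B * A)\<^sup>2))"
proof -
  have "\<bar>\<kappa> (T 0 \<omega>) * (\<alpha> + \<gamma> * status 0 \<omega>)\<bar> \<le> B * A" for \<omega>
    unfolding abs_mult using bound A B
    by (intro mult_mono) (auto simp: status_def intro: order_trans[OF abs_triangle_ineq])
  then have "prob {\<omega>\<in>space M. \<epsilon> \<le> \<bar>(\<Sum>j<n. \<kappa> (T j \<omega>) * (\<alpha> + \<gamma> * status j \<omega>)) / real n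
      - expectation (\<lambda>\<omega>. \<kappa> (T 0 \<omega>) * (\<alpha> + \<gamma> * status 0 \<omega>))\<bar>} \<le> 2 * exp (- real n * \<epsilon>\<^sup>2 / (2 * (B * A)\<^sup>2))"
    using A B n \<epsilon> by (intro hoeffding_mean weighted_indep) auto
  then show ?thesis
    by (simp add: expectation_weighted(1)[OF assms(1) bound] weighted_mean_def)
qed

lemma weighted_mean_converges:
  fixes \<kappa> :: "nat \<Rightarrow> real \<Rightarrow> real"
  assumes [measurable]: "\<And>n. \<kappa> n \<in> borel_measurable borel"
    and bound: "\<And>n v. \<bar>\<kappa> n v\<bar> \<le> B n" and B: "\<forall>\<^sub>F n in sequentially. 0 < B n"
    and growth: "filterlim (\<lambda>n. real n / (B n)\<^sup>2) at_top sequentially" and \<epsilon>: "0 < \<epsilon>"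
  shows "whp (\<lambda>n \<omega>. \<bar>weighted_mean (\<kappa> n) \<alpha> \<gamma> n \<omega> - weighted_integral (\<kappa> n) \<alpha> \<gamma>\<bar> < \<epsilon>)"
proof (rule whp_if_complement_null)
  define A where "A = \<bar>\<alpha>\<bar> + \<bar>\<gamma>\<bar> + 1"
  let ?E = "\<lambda>n. {\<omega>\<in>space M. \<epsilon> \<le> \<bar>weighted_mean (\<kappa> n) \<alpha> \<gamma> n \<omega> - weighted_integral (\<kappa> n) \<alpha> \<gamma>\<bar>}"
  have A: "0 < A" by (simp add: A_def add_nonneg_pos)
  show "?E n \<in> events" for n by measurable
  show "\<forall>\<^sub>F n in sequentially. \<forall>\<omega>\<in>space M. \<omega> \<notin> ?E n \<longrightarrow> \<bar>weighted_mean (\<kappa> n) \<alpha> \<gamma> n \<omega> - weighted_integral (\<kappa> n) \<alpha> \<gamma>\<bar> < \<epsilon>"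
    by auto
  define a where "a = \<epsilon>\<^sup>2 / (2 * A\<^sup>2)"
  have a: "a > 0" using \<epsilon> A by (simp add: a_def)
  have "\<forall>\<^sub>F n in sequentially. prob (?E n) \<le> 2 * exp (- (a * (real n / (B n)\<^sup>2)))"
    using B eventually_gt_at_top[of 0]
  proof eventually_elim
    case (elim n)
    have "prob (?E n) \<le> 2 * exp (- real n * \<epsilon>\<^sup>2 / (2 * (B n * A)\<^sup>2))"
      using elim bound A \<epsilon> by (intro weighted_mean_concentration) (auto simp: A_def)
    then show ?case by (simp add: a_def power_mult_distrib mult_ac)
  qed
  moreover have "(\<lambda>n. 2 * exp (- (a * (real n / (B n)\<^sup>2)))) \<longlonglongrightarrow> 0"
  proof -
    have "(\<lambda>n. 2 * exp (- (a * (real n / (B n)\<^sup>2)))) \<longlonglongrightarrow> 2 * 0"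
    by (intro tendsto_mult tendsto_const filterlim_compose[OF exp_at_bot] filterlim_compose[OF filterlim_uminus_at_bot_at_top]
        filterlim_tendsto_pos_mult_at_top[OF tendsto_const a growth])
    then show ?thesis by simp
  qed
  ultimately show "(\<lambda>n. prob (?E n)) \<longlonglongrightarrow> 0"
    by (rule tendsto_sandwich[OF always_eventually _ tendsto_const, rotated]) simp
qed

lemma weighted_integral_indicator_diff:
  assumes [measurable]: "A \<in> sets borel" "B \<in> sets borel" and "A \<subseteq> B" and w: "0 \<le> \<alpha>" "0 \<le> \<alpha> + \<gamma>" "\<alpha> \<le> 1" "\<alpha> + \<gamma> \<le> 1"
  shows "0 \<le> weighted_integral (indicator B) \<alpha> \<gamma> - weighted_integral (indicator A) \<alpha> \<gamma>"
    and "weighted_integral (indicator B) \<alpha> \<gamma> - weighted_integral (indicator A) \<alpha> \<gamma> \<le>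
      weighted_integral (indicator B) 1 0 - weighted_integral (indicator A) 1 0"
proof -
  have int: "integrable lborel (\<lambda>v. indicator C v * ((\<alpha> + \<gamma> * F\<^sub>0 v) * g v))" if [measurable]: "C \<in> sets borel" for \<alpha> \<gamma> C
    by (rule expectation_weighted[of _ 1]) (auto simp: indicator_def)
  have diff: "weighted_integral (indicator B) \<alpha> \<gamma> - weighted_integral (indicator A) \<alpha> \<gamma> =
     (LINT v|lborel. indicator (B - A) v * ((\<alpha> + \<gamma> * F\<^sub>0 v) * g v))" for \<alpha> \<gamma>
  proof -
    have "indicator (B - A) v = indicator B v - (indicator A v :: real)" for v
      using \<open>A \<subseteq> B\<close> by (auto simp: indicator_def)
    then show ?thesis unfolding weighted_integral_def using int[of B \<alpha> \<gamma>] int[of A \<alpha> \<gamma>]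
      by (simp add: left_diff_distrib)
  qed
  have w01: "0 \<le> \<alpha> + \<gamma> * F\<^sub>0 v \<and> \<alpha> + \<gamma> * F\<^sub>0 v \<le> 1" for v
  proof -
    have eq: "\<alpha> + \<gamma> * F\<^sub>0 v = (1 - F\<^sub>0 v) * \<alpha> + F\<^sub>0 v * (\<alpha> + \<gamma>)" by (simp add: algebra_simps)
    have "0 \<le> (1 - F\<^sub>0 v) * \<alpha>" "0 \<le> F\<^sub>0 v * (\<alpha> + \<gamma>)"
      using w F0_nonneg[of v] F0_le_1[of v] by (simp_all only: mult_nonneg_nonneg diff_ge_0_iff_ge)
    moreover have "(1 - F\<^sub>0 v) * \<alpha> \<le> (1 - F\<^sub>0 v) * 1" "F\<^sub>0 v * (\<alpha> + \<gamma>) \<le> F\<^sub>0 v * 1"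
      using w F0_nonneg[of v] F0_le_1[of v] by (simp_all only: mult_left_mono diff_ge_0_iff_ge)
    ultimately have "0 \<le> (1 - F\<^sub>0 v) * \<alpha> + F\<^sub>0 v * (\<alpha> + \<gamma>)"
        "(1 - F\<^sub>0 v) * \<alpha> + F\<^sub>0 v * (\<alpha> + \<gamma>) \<le> (1 - F\<^sub>0 v) * 1 + F\<^sub>0 v * 1"
      by (simp_all only: add_nonneg_nonneg add_mono)
    then show ?thesis unfolding eq by simp
  qed
  show "0 \<le> weighted_integral (indicator B) \<alpha> \<gamma> - weighted_integral (indicator A) \<alpha> \<gamma>"
    unfolding diff using w01 g_nonneg by (intro integral_nonneg_AE AE_I2) auto
  show "weighted_integral (indicator B) \<alpha> \<gamma> - weighted_integral (indicator A) \<alpha> \<gamma> \<le>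
      weighted_integral (indicator B) 1 0 - weighted_integral (indicator A) 1 0"
    unfolding diff using w01 g_nonneg int[of "B - A"]
    by (intro integral_mono mult_left_mono mult_right_mono) (auto simp: int[of "B - A" 1 0, simplified])
qed

lemma weighted_mean_indicator_mono:
  assumes "A \<subseteq> B" "0 \<le> \<alpha>" "0 \<le> \<alpha> + \<gamma>"
  shows "weighted_mean (indicator A) \<alpha> \<gamma> n \<omega> \<le> weighted_mean (indicator B) \<alpha> \<gamma> n \<omega>"
  unfolding weighted_mean_def using assms
  by (intro divide_right_mono sum_mono mult_right_mono) (auto simp: indicator_def status_def)

lemma weighted_integral_interval:
  assumes "0 \<le> a" "a \<le> b"
  shows "weighted_integral (indicator {0..b}) \<alpha> \<gamma> - weighted_integral (indicator {0..a}) \<alpha> \<gamma> =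
    (LINT v|lborel. indicator {a<..b} v * ((\<alpha> + \<gamma> * F\<^sub>0 v) * g v))"
proof -
  have int: "integrable lborel (\<lambda>v. indicator C v * ((\<alpha> + \<gamma> * F\<^sub>0 v) * g v))" if [measurable]: "C \<in> sets borel" for C
    by (rule expectation_weighted[of _ 1]) (auto simp: indicator_def)
  have "indicator {a<..b} v = indicator {0..b} v - (indicator {0..a} v :: real)" for v
    using assms by (auto simp: indicator_def)
  then show ?thesis unfolding weighted_integral_def using int[of "{0..b}"] int[of "{0..a}"]
    by (simp add: left_diff_distrib)
qed

abbreviation T_mass :: "real \<Rightarrow> real" where
  "T_mass s \<equiv> weighted_integral (indicator {0..s}) 1 0"

text \<open>Inspection times are nonnegative almost surely, so restricting to \<open>[0, s]\<close> loses no
mass.\<close>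

lemma T_mass_eq: "T_mass s = cdf (distr M borel (T 0)) s" "weighted_integral (indicator UNIV) 1 0 = 1"
proof -
  have eq: "weighted_integral (indicator A) 1 0 = prob {\<omega>\<in>space M. T 0 \<omega> \<in> A}" if [measurable]: "A \<in> sets borel" for A
  proof -
    have "weighted_integral (indicator A) 1 0 = expectation (\<lambda>\<omega>. indicator A (T 0 \<omega>) * (1 + 0 * status 0 \<omega>))"
      by (rule expectation_weighted(1)[of _ 1, symmetric]) (auto simp: indicator_def)
    also have "\<dots> = expectation (indicator {\<omega>\<in>space M. T 0 \<omega> \<in> A})"
      by (intro Bochner_Integration.integral_cong) (auto simp: indicator_def)
    finally show ?thesis by simp
  qed
  show "weighted_integral (indicator UNIV) 1 0 = 1" using eq[of UNIV] by (simp add: prob_space)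
  have "prob {\<omega>\<in>space M. T 0 \<omega> \<in> {0..s}} = prob {\<omega>\<in>space M. T 0 \<omega> \<in> {..s}}"
    using T_nonneg[of 0] by (intro measure_eq_AE) auto
  then show "T_mass s = cdf (distr M borel (T 0)) s"
    by (simp add: eq cdf_def measure_distr vimage_def Int_def conj_commute)
qed

lemma isCont_T_mass: "isCont T_mass s"
proof -
  have "isCont (cdf (distr M borel (T 0))) s"
    unfolding distr_T by (rule isCont_cdf_density)
      (use real_distribution.finite_borel_measure_M[OF real_distribution_distr[OF measurable_T[of 0]]] in \<open>simp_all add: distr_T\<close>)
  then show ?thesis by (simp add: T_mass_eq(1)[abs_def])
qed

lemma T_mass_uniformly_continuous:
  assumes "0 < \<eta>"
  obtains \<delta> where "0 < \<delta>" "\<And>a b. a \<le> b \<Longrightarrow> b - a \<le> \<delta> \<Longrightarrow> T_mass b - T_mass a \<le> \<eta>"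
proof -
  interpret D: real_distribution "distr M borel (T 0)" by simp
  have "(T_mass \<longlongrightarrow> 1) at_top" unfolding T_mass_eq(1) by (rule D.cdf_lim_at_top_prob)
  then have "\<forall>\<^sub>F x in at_top. 1 - \<eta> < T_mass x" using assms by (intro order_tendstoD) auto
  then obtain b where b: "\<And>x. x \<ge> b \<Longrightarrow> 1 - \<eta> < T_mass x" unfolding eventually_at_top_linorder by blast
  have neg: "T_mass x = 0" if "x < 0" for x using that by (simp add: weighted_integral_def)
  define c where "c = max b 0 + 1"
  have "uniformly_continuous_on {-1..c} T_mass"
    by (intro compact_uniformly_continuous continuous_at_imp_continuous_on ballI isCont_T_mass) auto
  then obtain d where d: "d > 0" "\<And>x y. x \<in> {-1..c} \<Longrightarrow> y \<in> {-1..c} \<Longrightarrow> dist y x < d \<Longrightarrow> dist (T_mass y) (T_mass x) < \<eta>"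
    unfolding uniformly_continuous_on_def using assms by metis
  define \<delta> where "\<delta> = min (d / 2) (1 / 2)"
  have \<delta>: "\<delta> > 0" "\<delta> < d" "\<delta> < 1" using d by (auto simp: \<delta>_def)
  have "T_mass y - T_mass x \<le> \<eta>" if "x \<le> y" "y - x \<le> \<delta>" for x y
  proof -
    consider "y < 0" | "x \<ge> b" | "y \<ge> 0" "x < b" by linarith
    then show ?thesis
    proof cases
      case 1 then show ?thesis using neg[of x] neg[of y] that assms by simp
    next
      case 2
      then show ?thesis using b[of x] D.cdf_bounded_prob[of y] by (simp add: T_mass_eq(1))
    next
      case 3
      then have "dist (T_mass y) (T_mass x) < \<eta>"
        using that \<delta> by (intro d(2)) (auto simp: c_def dist_real_def)
      then show ?thesis by (simp add: dist_real_def)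
    qed
  qed
  with \<delta> show thesis by (intro that[of \<delta>]) auto
qed

text \<open>Bracketing: each interval \<open>[0, s]\<close> lies between two sets of a fixed finite family whose
masses are close, and on this family the law of large numbers applies. The family contains the empty
set for \<open>s < 0\<close> and the whole line for large \<open>s\<close>.\<close>

lemma glivenko_cantelli:
  assumes w: "0 \<le> \<alpha>" "0 \<le> \<alpha> + \<gamma>" "\<alpha> \<le> 1" "\<alpha> + \<gamma> \<le> 1" and \<eta>: "0 < \<eta>"
  shows "whp (\<lambda>n \<omega>. \<forall>s. \<bar>weighted_mean (indicator {0..s}) \<alpha> \<gamma> n \<omega> - weighted_integral (indicator {0..s}) \<alpha> \<gamma>\<bar> \<le> \<eta>)"
proof -
  have \<eta>2: "\<eta> / 2 > 0" using \<eta> by simp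
  obtain \<delta> where \<delta>: "0 < \<delta>" "\<And>a b. a \<le> b \<Longrightarrow> b - a \<le> \<delta> \<Longrightarrow> T_mass b - T_mass a \<le> \<eta> / 2"
    using T_mass_uniformly_continuous[OF \<eta>2] by blast
  interpret D: real_distribution "distr M borel (T 0)" by simp
  have "(T_mass \<longlongrightarrow> 1) at_top" unfolding T_mass_eq(1) by (rule D.cdf_lim_at_top_prob)
  then have "\<forall>\<^sub>F x in at_top. 1 - \<eta> / 2 < T_mass x" using \<eta>2 by (intro order_tendstoD) auto
  then obtain b where b: "\<And>x. x \<ge> b \<Longrightarrow> 1 - \<eta> / 2 < T_mass x" unfolding eventually_at_top_linorder by blast
  \<comment> \<open>The grid of mesh \<open>\<delta>\<close> reaches \<open>b\<close>, beyond which
      little mass remains.\<close>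
  define N where "N = nat \<lceil>b / \<delta>\<rceil>"
  have N: "b \<le> real N * \<delta>" using \<delta>(1) by (simp add: N_def pos_divide_le_eq[symmetric] of_nat_ceiling)
  define S where "S = insert UNIV (insert {} ((\<lambda>l. {0..real l * \<delta>}) ` {..N}))"
  have S: "finite S" "\<And>A. A \<in> S \<Longrightarrow> A \<in> sets borel" by (auto simp: S_def)
  have bracket: "\<exists>A\<in>S. \<exists>B\<in>S. A \<subseteq> {0..s} \<and> {0..s} \<subseteq> B \<and>
      weighted_integral (indicator B) 1 0 - weighted_integral (indicator A) 1 0 \<le> \<eta> / 2" for s
  proof -
    consider "s < 0" | "0 \<le> s" "s < real N * \<delta>" | "real N * \<delta> \<le> s" by linarith
    then show ?thesis
    proof cases
      case 1 then show ?thesis using \<eta> by (intro bexI[of _ "{}"]) (auto simp: S_def)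
    next
      case 2
      define l where "l = nat \<lfloor>s / \<delta>\<rfloor>"
      have fl: "real l \<le> s / \<delta>" "s / \<delta> < real l + 1" using 2 \<delta>(1) by (auto simp: l_def)
      then have l: "real l * \<delta> \<le> s" "s < real (Suc l) * \<delta>" using \<delta>(1) by (auto simp: field_simps)
      have "real l * \<delta> < real N * \<delta>" using l 2 by linarith
      then have lN: "Suc l \<le> N" using \<delta>(1) by simp
      have "T_mass (real (Suc l) * \<delta>) - T_mass (real l * \<delta>) \<le> \<eta> / 2"
        using \<delta>(1) by (intro \<delta>(2)) (auto simp: algebra_simps)
      then show ?thesis using l lN
        by (intro bexI[where x = "{0..real l * \<delta>}", OF bexI[where x = "{0..real (Suc l) * \<delta>}"]])
          (auto simp: S_def simp del: of_nat_Suc)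
    next
      case 3
      have "1 - \<eta> / 2 < T_mass (real N * \<delta>)" using b N by simp
      then show ?thesis using 3
        using T_mass_eq(2) \<eta>
        by (intro bexI[where x = "{0..real N * \<delta>}", OF bexI[where x = UNIV]]) (auto simp: S_def)
    qed
  qed
  have "whp (\<lambda>n \<omega>. \<forall>A\<in>S. \<bar>weighted_mean (indicator A) \<alpha> \<gamma> n \<omega> - weighted_integral (indicator A) \<alpha> \<gamma>\<bar> < \<eta> / 2)"
  proof (rule whp_ball_finite[OF S(1)])
    fix A assume "A \<in> S"
    then have [measurable]: "A \<in> sets borel" by (rule S)
    show "whp (\<lambda>n \<omega>. \<bar>weighted_mean (indicator A) \<alpha> \<gamma> n \<omega> - weighted_integral (indicator A) \<alpha> \<gamma>\<bar> < \<eta> / 2)"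
      by (rule weighted_mean_converges[where B = "\<lambda>_. 1"])
        (auto simp: indicator_def filterlim_real_sequentially \<eta>)
  qed
  then show ?thesis
  proof (rule whp_mono, intro always_eventually allI ballI impI)
    fix n \<omega> s
    assume good: "\<forall>A\<in>S. \<bar>weighted_mean (indicator A) \<alpha> \<gamma> n \<omega> - weighted_integral (indicator A) \<alpha> \<gamma>\<bar> < \<eta> / 2"
    obtain A B where AB: "A \<in> S" "B \<in> S" "A \<subseteq> {0..s}" "{0..s} \<subseteq> B"
      "weighted_integral (indicator B) 1 0 - weighted_integral (indicator A) 1 0 \<le> \<eta> / 2" using bracket by blast
    let ?W = "\<lambda>A. weighted_mean (indicator A) \<alpha> \<gamma> n \<omega>" and ?I = "\<lambda>A. weighted_integral (indicator A) \<alpha> \<gamma>"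
    have "?W A \<le> ?W {0..s}" "?W {0..s} \<le> ?W B" using AB w by (auto intro!: weighted_mean_indicator_mono)
    moreover have "?I A \<le> ?I {0..s}" "?I {0..s} \<le> ?I B" "?I B - ?I A \<le> \<eta> / 2"
      using weighted_integral_indicator_diff[of A "{0..s}" \<alpha> \<gamma>] weighted_integral_indicator_diff[of "{0..s}" B \<alpha> \<gamma>]
        weighted_integral_indicator_diff[of A B \<alpha> \<gamma>] AB w S by auto
    moreover have "\<bar>?W A - ?I A\<bar> < \<eta> / 2" "\<bar>?W B - ?I B\<bar> < \<eta> / 2" using good AB by auto
    ultimately show "\<bar>?W {0..s} - ?I {0..s}\<bar> \<le> \<eta>" by linarith
  qed
qed

end

section \<open>Uniform consistency of the smoothed estimators\<close>

text \<open>The hypotheses in local form: \<open>t\<close> is an interior point of the support \<open>[0,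
M\<^sub>0]\<close> of the event times, and the smoothness conditions are conditions at
\<open>t\<close> or near it.\<close>

locale smoothed_current_status = current_status M X T F\<^sub>0 g + kernel k
  for M :: "'a measure" and X T :: "nat \<Rightarrow> 'a \<Rightarrow> real" and F\<^sub>0 g k :: "real \<Rightarrow> real" +
  fixes f\<^sub>0 :: "real \<Rightarrow> real" and M\<^sub>0 t c :: real
  assumes c: "0 < c" and t_pos: "0 < t" and t_less: "t < M\<^sub>0"
    and F0_deriv: "\<forall>\<^sub>F u in nhds t. (F\<^sub>0 has_real_derivative f\<^sub>0 u) (at u)"
    and f0_deriv: "(f\<^sub>0 has_real_derivative deriv f\<^sub>0 t) (at t)"
    and g_deriv: "\<forall>\<^sub>F u in nhds t. (g has_real_derivative deriv g u) (at u)"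
    and g'_cont: "isCont (deriv g) t"
    and f0_pos: "0 < f\<^sub>0 t"
    and F0_strict: "strict_mono_on {0..M\<^sub>0} F\<^sub>0"
    and g_away: "\<exists>\<delta>>0. \<forall>x\<in>{0..M\<^sub>0}. \<delta> \<le> g x"
begin

abbreviation h :: "nat \<Rightarrow> real" where "h \<equiv> bandwidth c"

abbreviation T_at :: "'a \<Rightarrow> nat \<Rightarrow> real" where "T_at \<omega> \<equiv> (\<lambda>j. T j \<omega>)"

abbreviation D_at :: "'a \<Rightarrow> nat \<Rightarrow> nat" where "D_at \<omega> \<equiv> (\<lambda>j. if X j \<omega> \<le> T j \<omega> then 1 else 0)"

abbreviation g_est :: "nat \<Rightarrow> 'a \<Rightarrow> nat \<Rightarrow> real \<Rightarrow> real" where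
  "g_est n \<omega> \<equiv> dens_est k (h n) n (T_at \<omega>) (D_at \<omega>)"

abbreviation g_est_total :: "nat \<Rightarrow> 'a \<Rightarrow> real \<Rightarrow> real" where
  "g_est_total n \<omega> \<equiv> dens_est_total k (h n) n (T_at \<omega>) (D_at \<omega>)"

abbreviation G_est :: "nat \<Rightarrow> 'a \<Rightarrow> nat \<Rightarrow> real \<Rightarrow> real" where
  "G_est n \<omega> \<equiv> cum_est k (h n) n (T_at \<omega>) (D_at \<omega>)"

abbreviation G_est_total :: "nat \<Rightarrow> 'a \<Rightarrow> real \<Rightarrow> real" where
  "G_est_total n \<omega> \<equiv> cum_est_total k (h n) n (T_at \<omega>) (D_at \<omega>)"

abbreviation F_naive_at :: "nat \<Rightarrow> 'a \<Rightarrow> real" where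
  "F_naive_at n \<omega> \<equiv> F_naive k (h n) n (T_at \<omega>) (D_at \<omega>) t"

abbreviation F_MS_at :: "nat \<Rightarrow> 'a \<Rightarrow> real" where
  "F_MS_at n \<omega> \<equiv> F_MS k (h n) n (T_at \<omega>) (D_at \<omega>) t"

abbreviation kernel_mean :: "real \<Rightarrow> real \<Rightarrow> nat \<Rightarrow> 'a \<Rightarrow> real \<Rightarrow> real" where
  "kernel_mean \<alpha> \<gamma> n \<omega> u \<equiv> weighted_mean (\<lambda>v. scaled_kernel k (h n) (u - v)) \<alpha> \<gamma> n \<omega>"

lemma h_pos: "0 < n \<Longrightarrow> 0 < h n" using c by (simp add: bandwidth_def)

lemma h_tendsto: "h \<longlonglongrightarrow> 0"
proof -
  have "(\<lambda>n. real n powr (- 1 / 5)) \<longlonglongrightarrow> 0"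
    by (rule tendsto_neg_powr) (auto simp: filterlim_real_sequentially)
  from tendsto_mult[OF tendsto_const[of c] this] show ?thesis by (simp add: bandwidth_def[abs_def])
qed

lemma eventually_h: assumes "0 < d" shows "\<forall>\<^sub>F n in sequentially. 0 < h n \<and> h n < d"
  using eventually_gt_at_top[of 0] order_tendstoD(2)[OF h_tendsto assms]
  by eventually_elim (auto intro: h_pos)

lemma power_h: assumes "0 < n" shows "h n ^ i = c ^ i * real n powr (- real i / 5)"
proof -
  have "(real n powr (- 1 / 5)) ^ i = (real n powr (- 1 / 5)) powr real i"
    using assms by (simp add: powr_realpow)
  then show ?thesis by (simp add: bandwidth_def power_mult_distrib powr_powr)
qed

text \<open>\<open>i = 2\<close> is what consistency of a density estimator needs, \<open>i = 4\<close> belongs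
to its derivative.\<close>

lemma n_times_h_power_at_top:
  assumes "i < 5" and a: "0 < a"
  shows "filterlim (\<lambda>n. real n * (a * h n ^ i)) at_top sequentially"
proof -
  have "filterlim (\<lambda>n. exp ((1 - real i / 5) * ln (real n))) at_top sequentially"
    using assms by (intro filterlim_compose[OF exp_at_top] filterlim_tendsto_pos_mult_at_top[OF tendsto_const]
        filterlim_compose[OF ln_at_top filterlim_real_sequentially]) auto
  moreover have "\<forall>\<^sub>F n in sequentially. exp ((1 - real i / 5) * ln (real n)) = real n powr (1 - real i / 5)"
    using eventually_gt_at_top[of 0] by eventually_elim (simp add: powr_def)
  ultimately have "filterlim (\<lambda>n. real n powr (1 - real i / 5)) at_top sequentially"
    by (rule filterlim_mono_eventually[OF _ order_refl order_refl])
  then have "filterlim (\<lambda>n. (a * c ^ i) * real n powr (1 - real i / 5)) at_top sequentially"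
    using a c by (intro filterlim_tendsto_pos_mult_at_top[OF tendsto_const]) auto
  moreover have "\<forall>\<^sub>F n in sequentially. (a * c ^ i) * real n powr (1 - real i / 5) = real n * (a * h n ^ i)"
    using eventually_gt_at_top[of 0]
  proof eventually_elim
    case (elim n)
    have "real n powr (1 - real i / 5) = real n powr 1 * real n powr (- real i / 5)"
      by (subst powr_add[symmetric]) simp
    then show ?case using elim by (simp add: power_h)
  qed
  ultimately show ?thesis by (rule filterlim_mono_eventually[OF _ order_refl order_refl])
qed

text \<open>The pair \<open>(\<alpha>, \<gamma>)\<close> for which \<open>\<alpha> + \<gamma> * status j
\<omega>\<close> indicates the event that the status is \<open>i\<close>.\<close>

definition weight_of :: "nat \<Rightarrow> real \<times> real" where
  "weight_of i = (if i = 0 then (1, -1) else (0, 1))"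

text \<open>Beyond the bandwidth a negative observation has no influence, so the restriction to \<open>0 \<le> T
j\<close> in the empirical subdistribution function disappears.\<close>

lemma dens_est_eq_weighted_mean:
  assumes h: "0 < h'" "h' < u" and i: "i \<in> {0, 1}"
  shows "dens_est k h' n (T_at \<omega>) (D_at \<omega>) i u =
    weighted_mean (\<lambda>v. scaled_kernel k h' (u - v)) (fst (weight_of i)) (snd (weight_of i)) n \<omega>"
proof -
  have eq: "(if 0 \<le> T j \<omega> \<and> D_at \<omega> j = i then local_weight k h' u (T j \<omega>) else 0) =
     scaled_kernel k h' (u - T j \<omega>) * (fst (weight_of i) + snd (weight_of i) * status j \<omega>)" for j
    using local_weight_nonpos_obs[OF h(1), of u "T j \<omega>"] h i
    by (cases "0 \<le> T j \<omega>") (auto simp: weight_of_def status_def local_weight_def)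
  show ?thesis unfolding dens_est_eq weighted_mean_def by (simp only: eq)
qed

lemma weighted_mean_add:
  "weighted_mean \<kappa> \<alpha> \<gamma> n \<omega> + weighted_mean \<kappa> \<alpha>' \<gamma>' n \<omega> = weighted_mean \<kappa> (\<alpha> + \<alpha>') (\<gamma> + \<gamma>') n \<omega>"
  by (simp add: weighted_mean_def add_divide_distrib[symmetric] sum.distrib[symmetric] algebra_simps)

lemma dens_est_total_eq_weighted_mean:
  assumes h: "0 < h'" "h' < u"
  shows "dens_est_total k h' n (T_at \<omega>) (D_at \<omega>) u = weighted_mean (\<lambda>v. scaled_kernel k h' (u - v)) 1 0 n \<omega>"
  unfolding dens_est_total_def using assms
  by (simp add: dens_est_eq_weighted_mean weighted_mean_add weight_of_def del: One_nat_def)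

text \<open>Summation of \<open>cum_weight_approx\<close>; the right-hand side is the empirical mass of the
inspection times near \<open>s\<close> and near \<open>0\<close>.\<close>

lemma cum_est_approx:
  obtains C where "0 < C" "\<And>h' s n \<omega> i. 0 < h' \<Longrightarrow> 0 \<le> s \<Longrightarrow> i \<in> {0, 1} \<Longrightarrow>
    \<bar>cum_est k h' n (T_at \<omega>) (D_at \<omega>) i s - weighted_mean (indicator {0..s}) (fst (weight_of i)) (snd (weight_of i)) n \<omega>\<bar>
    \<le> weighted_mean (indicator {0..s + h'}) 1 0 n \<omega> - weighted_mean (indicator {0..s - 2 * h'}) 1 0 n \<omega>
      + C * weighted_mean (indicator {0..2 * h'}) 1 0 n \<omega>"
proof -
  obtain C where C: "0 < C" "\<And>h s v. 0 < h \<Longrightarrow> 0 \<le> s \<Longrightarrow> 0 \<le> v \<Longrightarrow>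
     \<bar>cum_weight k h s v - (if v \<le> s then 1 else 0)\<bar> \<le>
       (if \<bar>s - v\<bar> \<le> h then 1 else 0) + C * (if v \<le> 2 * h then 1 else 0)"
    using cum_weight_approx by blast
  have "\<bar>cum_est k h' n (T_at \<omega>) (D_at \<omega>) i s - weighted_mean (indicator {0..s}) (fst (weight_of i)) (snd (weight_of i)) n \<omega>\<bar>
    \<le> weighted_mean (indicator {0..s + h'}) 1 0 n \<omega> - weighted_mean (indicator {0..s - 2 * h'}) 1 0 n \<omega>
      + C * weighted_mean (indicator {0..2 * h'}) 1 0 n \<omega>"
    if h: "0 < h'" and s: "0 \<le> s" and i: "i \<in> {0, 1}" for h' s n \<omega> i
  proof -
    let ?L = "\<lambda>j. (if 0 \<le> T j \<omega> \<and> D_at \<omega> j = i then cum_weight k h' s (T j \<omega>) else 0)"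
    let ?I = "\<lambda>j. indicator {0..s} (T j \<omega>) * (fst (weight_of i) + snd (weight_of i) * status j \<omega>)"
    let ?R = "\<lambda>j. indicator {0..s + h'} (T j \<omega>) - indicator {0..s - 2 * h'} (T j \<omega>) + C * indicator {0..2 * h'} (T j \<omega>) :: real"
    have term_le: "\<bar>?L j - ?I j\<bar> \<le> ?R j" for j
    proof (cases "0 \<le> T j \<omega>")
      case False then show ?thesis by simp
    next
      case True
      have "\<bar>?L j - ?I j\<bar> \<le> \<bar>cum_weight k h' s (T j \<omega>) - (if T j \<omega> \<le> s then 1 else 0)\<bar>"
        using True i by (auto simp: weight_of_def status_def)
      also have "\<dots> \<le> (if \<bar>s - T j \<omega>\<bar> \<le> h' then 1 else 0) + C * (if T j \<omega> \<le> 2 * h' then 1 else 0)"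
        by (rule C(2)[OF h s True])
      also have "\<dots> \<le> ?R j"
      proof -
        have "(if \<bar>s - T j \<omega>\<bar> \<le> h' then 1 else 0 :: real) \<le> indicator {0..s + h'} (T j \<omega>) - indicator {0..s - 2 * h'} (T j \<omega>)"
          using True h by (auto simp: indicator_def)
        moreover have "C * (if T j \<omega> \<le> 2 * h' then 1 else 0) = C * indicator {0..2 * h'} (T j \<omega>)"
          using True by (simp add: indicator_def)
        ultimately show ?thesis by linarith
      qed
      finally show ?thesis .
    qed
    have eq: "cum_est k h' n (T_at \<omega>) (D_at \<omega>) i s - weighted_mean (indicator {0..s}) (fst (weight_of i)) (snd (weight_of i)) n \<omega>
      = (\<Sum>j<n. ?L j - ?I j) / real n"
      unfolding cum_est_eq[OF h] weighted_mean_def by (simp add: sum_subtractf diff_divide_distrib)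
    have "\<bar>cum_est k h' n (T_at \<omega>) (D_at \<omega>) i s - weighted_mean (indicator {0..s}) (fst (weight_of i)) (snd (weight_of i)) n \<omega>\<bar> \<le> (\<Sum>j<n. ?R j) / real n"
    proof -
      have "\<bar>\<Sum>j<n. ?L j - ?I j\<bar> \<le> (\<Sum>j<n. ?R j)"
        by (rule order_trans[OF sum_abs sum_mono]) (rule term_le)
      then show ?thesis unfolding eq abs_divide abs_of_nat by (rule divide_right_mono) simp
    qed
    also have "\<dots> = weighted_mean (indicator {0..s + h'}) 1 0 n \<omega> - weighted_mean (indicator {0..s - 2 * h'}) 1 0 n \<omega>
      + C * weighted_mean (indicator {0..2 * h'}) 1 0 n \<omega>"
    proof -
      have wm: "weighted_mean (indicator S) 1 0 n \<omega> = (\<Sum>j<n. indicator S (T j \<omega>)) / real n" for S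
        by (simp add: weighted_mean_def)
      have "(\<Sum>j<n. ?R j) = (\<Sum>j<n. indicator {0..s + h'} (T j \<omega>)) - (\<Sum>j<n. indicator {0..s - 2 * h'} (T j \<omega>))
          + C * (\<Sum>j<n. indicator {0..2 * h'} (T j \<omega>))"
        by (simp only: sum.distrib sum_subtractf sum_distrib_left)
      then show ?thesis unfolding wm by (simp only: add_divide_distrib diff_divide_distrib times_divide_eq_right)
    qed
    finally show ?thesis .
  qed
  with C(1) show thesis by (rule that)
qed

text \<open>The integrated estimators differ from the empirical subdistribution functions by the empirical mass
of short intervals, which is uniformly small by \<open>glivenko_cantelli\<close> and the uniform
continuity of the distribution function of the inspection times.\<close>

lemma cum_est_uniform:
  assumes i: "i \<in> {0, 1}" and \<epsilon>: "0 < \<epsilon>"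
  shows "whp (\<lambda>n \<omega>. \<forall>s\<ge>0. \<bar>G_est n \<omega> i s -
    weighted_integral (indicator {0..s}) (fst (weight_of i)) (snd (weight_of i))\<bar> \<le> \<epsilon>)"
proof -
  obtain C where C: "0 < C" "\<And>h' s n \<omega> i. 0 < h' \<Longrightarrow> 0 \<le> s \<Longrightarrow> i \<in> {0, 1} \<Longrightarrow>
    \<bar>cum_est k h' n (T_at \<omega>) (D_at \<omega>) i s - weighted_mean (indicator {0..s}) (fst (weight_of i)) (snd (weight_of i)) n \<omega>\<bar>
    \<le> weighted_mean (indicator {0..s + h'}) 1 0 n \<omega> - weighted_mean (indicator {0..s - 2 * h'}) 1 0 n \<omega>
      + C * weighted_mean (indicator {0..2 * h'}) 1 0 n \<omega>"
    using cum_est_approx by blast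
  \<comment> \<open>Four errors of size \<open>\<eta>\<close>, and \<open>C\<close> times the mass of
      \<open>[0, 2 * h n]\<close>, which is at most \<open>2 * \<eta>\<close>.\<close>
  define \<eta> where "\<eta> = \<epsilon> / (4 + 2 * C)"
  have \<eta>: "0 < \<eta>" and \<eta>C: "\<eta> * (4 + 2 * C) = \<epsilon>" using \<epsilon> C by (auto simp: \<eta>_def)
  obtain \<delta> where \<delta>: "0 < \<delta>" "\<And>a b. a \<le> b \<Longrightarrow> b - a \<le> \<delta> \<Longrightarrow> T_mass b - T_mass a \<le> \<eta>"
    using T_mass_uniformly_continuous[OF \<eta>] by blast
  let ?a = "fst (weight_of i)" and ?g = "snd (weight_of i)"
  let ?W = "\<lambda>n \<omega> s. weighted_mean (indicator {0..s}) 1 0 n \<omega>"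
  have "whp (\<lambda>n \<omega>. (\<forall>s. \<bar>weighted_mean (indicator {0..s}) ?a ?g n \<omega> - weighted_integral (indicator {0..s}) ?a ?g\<bar> \<le> \<eta>)
      \<and> (\<forall>s. \<bar>?W n \<omega> s - T_mass s\<bar> \<le> \<eta>))"
    using \<eta> i by (intro whp_conj glivenko_cantelli) (auto simp: weight_of_def)
  then show ?thesis
  proof (rule whp_mono)
    show "\<forall>\<^sub>F n in sequentially. \<forall>\<omega>\<in>space M.
       (\<forall>s. \<bar>weighted_mean (indicator {0..s}) ?a ?g n \<omega> - weighted_integral (indicator {0..s}) ?a ?g\<bar> \<le> \<eta>)
      \<and> (\<forall>s. \<bar>?W n \<omega> s - T_mass s\<bar> \<le> \<eta>) \<longrightarrow>
      (\<forall>s\<ge>0. \<bar>G_est n \<omega> i s - weighted_integral (indicator {0..s}) ?a ?g\<bar> \<le> \<epsilon>)"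
    proof (rule eventually_mono[OF eventually_h[of "\<delta> / 3"]], goal_cases)
      case 1 then show ?case using \<delta>(1) by simp
    next
      case (2 n)
      show ?case
      proof (intro ballI impI allI)
      fix \<omega> s
      assume s: "(0::real) \<le> s"
        and good: "(\<forall>s. \<bar>weighted_mean (indicator {0..s}) ?a ?g n \<omega> - weighted_integral (indicator {0..s}) ?a ?g\<bar> \<le> \<eta>)
      \<and> (\<forall>s. \<bar>?W n \<omega> s - T_mass s\<bar> \<le> \<eta>)"
      have hn: "0 < h n" "h n * 3 < \<delta>" using 2 by auto
      have 1: "\<bar>G_est n \<omega> i s - weighted_mean (indicator {0..s}) ?a ?g n \<omega>\<bar>
        \<le> ?W n \<omega> (s + h n) - ?W n \<omega> (s - 2 * h n) + C * ?W n \<omega> (2 * h n)"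
        using hn s i by (intro C(2)) auto
      have 2: "\<bar>weighted_mean (indicator {0..s}) ?a ?g n \<omega> - weighted_integral (indicator {0..s}) ?a ?g\<bar> \<le> \<eta>" using good by blast
      have W: "\<bar>?W n \<omega> r - T_mass r\<bar> \<le> \<eta>" for r using good by blast
      have 3: "T_mass (s + h n) - T_mass (s - 2 * h n) \<le> \<eta>" using hn by (intro \<delta>(2)) auto
      have "T_mass (2 * h n) - T_mass (- h n) \<le> \<eta>" using hn by (intro \<delta>(2)) auto
      moreover have "T_mass (- h n) = 0" using hn by (simp add: weighted_integral_def)
      ultimately have "?W n \<omega> (2 * h n) \<le> 2 * \<eta>" using W[of "2 * h n"] by linarith
      then have 4: "C * ?W n \<omega> (2 * h n) \<le> C * (2 * \<eta>)" using C(1) by (intro mult_left_mono) auto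
      have "\<bar>G_est n \<omega> i s - weighted_integral (indicator {0..s}) ?a ?g\<bar> \<le> 4 * \<eta> + C * (2 * \<eta>)"
        using 1 2 3 4 W[of "s + h n"] W[of "s - 2 * h n"] by linarith
      also have "\<dots> = \<epsilon>" using \<eta>C by (simp add: algebra_simps)
      finally show "\<bar>G_est n \<omega> i s - weighted_integral (indicator {0..s}) ?a ?g\<bar> \<le> \<epsilon>" .
      qed
    qed
  qed
qed

text \<open>The density that \<open>\<alpha> + \<gamma> * status\<close> induces: \<open>g\<close> for
\<open>(1, 0)\<close> and \<open>F\<^sub>0 * g\<close> for \<open>(0, 1)\<close>.\<close>

definition subdensity :: "real \<Rightarrow> real \<Rightarrow> real \<Rightarrow> real" where
  "subdensity \<alpha> \<gamma> v = (\<alpha> + \<gamma> * F\<^sub>0 v) * g v"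

lemma measurable_subdensity [measurable]: "subdensity \<alpha> \<gamma> \<in> borel_measurable borel"
  unfolding subdensity_def[abs_def] by measurable

definition subdensity' :: "real \<Rightarrow> real \<Rightarrow> real \<Rightarrow> real" where
  "subdensity' \<alpha> \<gamma> v = \<gamma> * f\<^sub>0 v * g v + (\<alpha> + \<gamma> * F\<^sub>0 v) * deriv g v"

lemma subdensity_deriv: "\<forall>\<^sub>F u in nhds t. (subdensity \<alpha> \<gamma> has_real_derivative subdensity' \<alpha> \<gamma> u) (at u)"
  using F0_deriv g_deriv
proof eventually_elim
  case (elim u)
  then show ?case unfolding subdensity_def[abs_def] subdensity'_def
    by (auto intro!: derivative_eq_intros simp: algebra_simps)
qed

lemma isCont_at_t: "isCont F\<^sub>0 t" "isCont g t" "isCont f\<^sub>0 t"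
  using eventually_nhds_x_imp_x[OF F0_deriv] eventually_nhds_x_imp_x[OF g_deriv] f0_deriv
  by (auto intro: DERIV_isCont)

lemma isCont_subdensity: "isCont (subdensity \<alpha> \<gamma>) t" "isCont (subdensity' \<alpha> \<gamma>) t"
  unfolding subdensity_def[abs_def] subdensity'_def[abs_def]
  by (intro continuous_intros isCont_at_t g'_cont)+

text \<open>Strict differentiability at \<open>t\<close>, from continuity of the derivative; it makes the
expansion uniform in both points.\<close>

lemma subdensity_strict_derivative:
  assumes "0 < \<eta>"
  obtains \<epsilon> where "0 < \<epsilon>" "\<And>u v. \<bar>u - t\<bar> \<le> \<epsilon> \<Longrightarrow> \<bar>v - t\<bar> \<le> \<epsilon> \<Longrightarrow>
    \<bar>subdensity \<alpha> \<gamma> v - (subdensity \<alpha> \<gamma> u + subdensity' \<alpha> \<gamma> t * (v - u))\<bar> \<le> \<eta> * \<bar>v - u\<bar>"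
proof -
  let ?p = "subdensity \<alpha> \<gamma>" and ?p' = "subdensity' \<alpha> \<gamma>"
  have "\<forall>\<^sub>F u in nhds t. dist (?p' u) (?p' t) < \<eta>"
    using isCont_subdensity(2)[of \<alpha> \<gamma>] assms tendstoD
    by (auto simp: continuous_at_imp_continuous_at_within isCont_def tendsto_at_iff_tendsto_nhds)
  then have "\<forall>\<^sub>F u in nhds t. dist (?p' u) (?p' t) < \<eta> \<and> (?p has_real_derivative ?p' u) (at u)"
    using subdensity_deriv by (rule eventually_conj)
  then obtain d where d: "0 < d" "\<And>u. dist u t < d \<Longrightarrow> dist (?p' u) (?p' t) < \<eta> \<and> (?p has_real_derivative ?p' u) (at u)"
    unfolding eventually_nhds_metric by blast
  have "\<bar>?p v - (?p u + ?p' t * (v - u))\<bar> \<le> \<eta> * \<bar>v - u\<bar>" if "\<bar>u - t\<bar> \<le> d / 2" "\<bar>v - t\<bar> \<le> d / 2" for u v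
  proof -
    let ?f = "\<lambda>x. ?p x - ?p' t * x"
    have "norm (?f v - ?f u) \<le> \<eta> * norm (v - u)"
    proof (rule field_differentiable_bound[of "cball t (d / 2)" ?f "\<lambda>x. ?p' x - ?p' t"])
      fix x assume "x \<in> cball t (d / 2)"
      then have x: "dist x t < d" using d(1) by (auto simp: dist_commute)
      show "(?f has_real_derivative ?p' x - ?p' t) (at x within cball t (d / 2))"
        by (rule has_field_derivative_at_within[OF DERIV_diff[OF _ DERIV_cmult_Id]]) (use d(2)[OF x] in blast)
      show "norm (?p' x - ?p' t) \<le> \<eta>" using d(2)[OF x] by (simp add: dist_real_def)
    qed (use that in \<open>auto simp: dist_real_def abs_minus_commute\<close>)
    then show ?thesis by (simp add: algebra_simps)
  qed
  with d(1) show thesis by (intro that[of "d / 2"]) auto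
qed

lemma weighted_integral_tendsto:
  fixes \<kappa> :: "real \<Rightarrow> real"
  assumes [measurable]: "\<kappa> \<in> borel_measurable borel" and \<kappa>: "\<And>w. \<bar>\<kappa> w\<bar> \<le> B" "\<And>w. 1 < \<bar>w\<bar> \<Longrightarrow> \<kappa> w = 0"
  shows "(\<lambda>n. weighted_integral (\<lambda>v. \<kappa> ((t - v) / h n) / h n) \<alpha> \<gamma>) \<longlonglongrightarrow> subdensity \<alpha> \<gamma> t * (LINT w|lborel. \<kappa> w)"
proof (rule LIMSEQ_I)
  fix e :: real assume e: "0 < e"
  let ?I = "LINT w|lborel. \<bar>\<kappa> w\<bar>"
  define J where "J = ?I + 1"
  have "0 \<le> ?I" by (intro integral_nonneg_AE) auto
  then have J: "0 < J" unfolding J_def by linarith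
  define \<eta> where "\<eta> = e / (2 * J)"
  have \<eta>: "0 < \<eta>" using e J by (simp add: \<eta>_def)
  have "\<eta> * ?I \<le> \<eta> * J" using \<eta> by (simp add: J_def)
  also have "\<dots> = e / 2" using J by (simp add: \<eta>_def)
  finally have \<eta>I: "\<eta> * ?I < e" using e by simp
  have "\<forall>\<^sub>F v in at t. dist (subdensity \<alpha> \<gamma> v) (subdensity \<alpha> \<gamma> t) < \<eta>"
    using isCont_subdensity(1)[of \<alpha> \<gamma>] \<eta> by (intro tendstoD) (auto simp: isCont_def)
  then obtain d where d: "0 < d" "\<And>v. v \<noteq> t \<Longrightarrow> dist v t < d \<Longrightarrow> dist (subdensity \<alpha> \<gamma> v) (subdensity \<alpha> \<gamma> t) < \<eta>"
    unfolding eventually_at by auto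
  have cont: "\<bar>subdensity \<alpha> \<gamma> v - subdensity \<alpha> \<gamma> t\<bar> \<le> \<eta>" if "\<bar>v - t\<bar> < d" for v
    using d(2)[of v] that \<eta> by (cases "v = t") (auto simp: dist_real_def)
  have "\<forall>\<^sub>F n in sequentially. norm (weighted_integral (\<lambda>v. \<kappa> ((t - v) / h n) / h n) \<alpha> \<gamma> - subdensity \<alpha> \<gamma> t * (LINT w|lborel. \<kappa> w)) < e"
    using eventually_h[OF d(1)]
  proof eventually_elim
    case (elim n)
    have "\<bar>(LINT v|lborel. \<kappa> ((t - v) / h n) * subdensity \<alpha> \<gamma> v) / h n
     - (subdensity \<alpha> \<gamma> t * (LINT w|lborel. \<kappa> w) - 0 * h n * (LINT w|lborel. w * \<kappa> w) + 0 * (h n)\<^sup>2 * (LINT w|lborel. w\<^sup>2 * \<kappa> w))\<bar>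
     \<le> \<eta> * h n ^ 0 * ?I"
      using \<kappa> elim by (intro kernel_average_expansion) (auto intro!: cont)
    moreover have "weighted_integral (\<lambda>v. \<kappa> ((t - v) / h n) / h n) \<alpha> \<gamma> = (LINT v|lborel. \<kappa> ((t - v) / h n) * subdensity \<alpha> \<gamma> v) / h n"
      by (simp add: weighted_integral_def subdensity_def)
    ultimately show ?case using \<eta>I by simp
  qed
  then show "\<exists>N. \<forall>n\<ge>N. norm (weighted_integral (\<lambda>v. \<kappa> ((t - v) / h n) / h n) \<alpha> \<gamma> - subdensity \<alpha> \<gamma> t * (LINT w|lborel. \<kappa> w)) < e"
    by (simp add: eventually_sequentially)
qed

lemma density_converges:
  assumes \<epsilon>: "0 < \<epsilon>"
  shows "whp (\<lambda>n \<omega>. \<bar>kernel_mean \<alpha> \<gamma> n \<omega> t - subdensity \<alpha> \<gamma> t\<bar> < \<epsilon>)"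
proof -
  obtain B where B: "B > 0" "\<And>u. \<bar>k u\<bar> \<le> B" using bounded by blast
  let ?K = "\<lambda>n v. scaled_kernel k (h n) (t - v)"
  have lim: "(\<lambda>n. weighted_integral (?K n) \<alpha> \<gamma>) \<longlonglongrightarrow> subdensity \<alpha> \<gamma> t"
    using weighted_integral_tendsto[OF measurable_k(1) B(2), of \<alpha> \<gamma>] zero_outside integral_1
    by (simp add: scaled_kernel_def)
  have "whp (\<lambda>n \<omega>. \<bar>weighted_mean (?K n) \<alpha> \<gamma> n \<omega> - weighted_integral (?K n) \<alpha> \<gamma>\<bar> < \<epsilon> / 2)"
  proof (rule weighted_mean_converges[where B = "\<lambda>n. B / h n"])
    show "?K n \<in> borel_measurable borel" for n unfolding scaled_kernel_def by measurable
    show "\<bar>?K n v\<bar> \<le> B / h n" for n v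
    proof (cases "n = 0")
      case True then show ?thesis by (simp add: scaled_kernel_def bandwidth_def)
    next
      case False
      then show ?thesis using B(2) h_pos[of n] by (simp add: scaled_kernel_def abs_divide divide_right_mono)
    qed
    show "\<forall>\<^sub>F n in sequentially. 0 < B / h n" using eventually_h[OF zero_less_one] by eventually_elim (use B in auto)
    show "filterlim (\<lambda>n. real n / (B / h n)\<^sup>2) at_top sequentially"
    proof -
      have "real n / (B / h n)\<^sup>2 = real n * (1 / B\<^sup>2 * (h n)\<^sup>2)" for n by (simp add: power_divide)
      then show ?thesis using n_times_h_power_at_top[of 2 "1 / B\<^sup>2"] B(1) by simp
    qed
  qed (use \<epsilon> in simp)
  then show ?thesis
  proof (rule whp_mono)
    show "\<forall>\<^sub>F n in sequentially. \<forall>\<omega>\<in>space M. \<bar>weighted_mean (?K n) \<alpha> \<gamma> n \<omega> - weighted_integral (?K n) \<alpha> \<gamma>\<bar> < \<epsilon> / 2 \<longrightarrow>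
       \<bar>weighted_mean (?K n) \<alpha> \<gamma> n \<omega> - subdensity \<alpha> \<gamma> t\<bar> < \<epsilon>"
    proof (rule eventually_mono[OF tendstoD[OF lim half_gt_zero[OF \<epsilon>]]], intro ballI impI)
      fix n \<omega> assume "dist (weighted_integral (?K n) \<alpha> \<gamma>) (subdensity \<alpha> \<gamma> t) < \<epsilon> / 2"
        "\<bar>weighted_mean (?K n) \<alpha> \<gamma> n \<omega> - weighted_integral (?K n) \<alpha> \<gamma>\<bar> < \<epsilon> / 2"
      then show "\<bar>weighted_mean (?K n) \<alpha> \<gamma> n \<omega> - subdensity \<alpha> \<gamma> t\<bar> < \<epsilon>" unfolding dist_real_def by linarith
    qed
  qed
qed

lemma exp_poly_bound:
  fixes y :: real
  assumes "0 < y"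
  shows "exp (- y) \<le> fact m / y ^ m"
proof -
  have "y ^ m / fact m \<le> exp y"
  proof -
    have "(\<Sum>i\<in>{m}. y ^ i / fact i) \<le> (\<Sum>i. y ^ i / fact i)"
      using assms summable_exp[of y] by (intro sum_le_suminf) (auto simp: divide_inverse mult.commute)
    then show ?thesis by (simp add: exp_def divide_inverse mult.commute)
  qed
  then have "1 / exp y \<le> 1 / (y ^ m / fact m)" using assms by (intro divide_left_mono) auto
  then show ?thesis by (simp add: exp_minus divide_inverse mult.commute)
qed

text \<open>A union bound over \<open>n + 1\<close> points loses against the exponential rate, as \<open>n * h n
^ 4\<close> is of order \<open>n powr (1/5)\<close>.\<close>

lemma exp_growth_null:
  assumes a: "0 < a"
  shows "(\<lambda>n. real (Suc n) * (2 * exp (- real n * (a * h n ^ 4)))) \<longlonglongrightarrow> 0"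
proof -
  define b where "b = a * c ^ 4"
  have b: "b > 0" using a c by (simp add: b_def)
  \<comment> \<open>The tenth power turns \<open>n powr (1/5)\<close> into \<open>n\<^sup>2\<close>,
      one factor \<open>n\<close> more than the union bound consumes.\<close>
  define C where "C = 4 * (fact 10 / b ^ 10)"
  have upper: "\<forall>\<^sub>F n in sequentially. real (Suc n) * (2 * exp (- real n * (a * h n ^ 4))) \<le> C / real n"
    using eventually_gt_at_top[of 0]
  proof eventually_elim
    case (elim n)
    have "real n powr (1 / 5) = real n powr 1 * real n powr (- 4 / 5)" by (subst powr_add[symmetric]) simp
    then have eq: "real n * (a * h n ^ 4) = b * real n powr (1 / 5)"
      using elim by (simp add: power_h b_def mult_ac)
    have pos: "0 < b * real n powr (1 / 5)" using b elim by simp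
    have "(real n powr (1 / 5)) ^ 10 = (real n)\<^sup>2"
      using elim by (subst powr_realpow[symmetric]) (simp_all add: powr_powr)
    then have "exp (- (real n * (a * h n ^ 4))) \<le> fact 10 / (b ^ 10 * (real n)\<^sup>2)"
      using exp_poly_bound[OF pos, of 10] unfolding eq by (simp add: power_mult_distrib)
    then have "real (Suc n) * (2 * exp (- real n * (a * h n ^ 4))) \<le> (2 * real n) * (2 * (fact 10 / (b ^ 10 * (real n)\<^sup>2)))"
      using elim b by (intro mult_mono) auto
    also have "\<dots> = C / real n" using elim by (simp add: C_def power2_eq_square)
    finally show ?case .
  qed
  have C0: "(\<lambda>n. C / real n) \<longlonglongrightarrow> 0"
    by (intro tendsto_divide_0[OF tendsto_const] filterlim_at_top_imp_at_infinity filterlim_real_sequentially)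
  show ?thesis
    by (rule tendsto_sandwich[OF always_eventually upper tendsto_const C0]) simp
qed

text \<open>The derivative of \<open>kernel_mean \<alpha> \<gamma> n \<omega>\<close>.\<close>

definition density_slope :: "real \<Rightarrow> real \<Rightarrow> nat \<Rightarrow> 'a \<Rightarrow> real \<Rightarrow> real" where
  "density_slope \<alpha> \<gamma> n \<omega> u = weighted_mean (\<lambda>v. deriv k ((u - v) / h n) / (h n)\<^sup>2) \<alpha> \<gamma> n \<omega>"

lemma density_has_slope:
  assumes "0 < h n"
  shows "((\<lambda>u. kernel_mean \<alpha> \<gamma> n \<omega> u) has_real_derivative density_slope \<alpha> \<gamma> n \<omega> u) (at u)"
proof -
  have "((\<lambda>u. scaled_kernel k (h n) (u - v) * a) has_real_derivative deriv k ((u - v) / h n) / (h n)\<^sup>2 * a) (at u)" for v a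
  proof -
    have "((\<lambda>u. k ((u - v) / h n)) has_real_derivative deriv k ((u - v) / h n) * (1 / h n)) (at u)"
      using assms by (intro DERIV_chain2[OF smooth(1)]) (auto intro!: derivative_eq_intros)
    then have "((\<lambda>u. k ((u - v) / h n) / h n * a) has_real_derivative deriv k ((u - v) / h n) * (1 / h n) / h n * a) (at u)"
      by (intro DERIV_cmult_right DERIV_cdivide)
    then show ?thesis by (simp add: scaled_kernel_def power2_eq_square)
  qed
  then show ?thesis unfolding weighted_mean_def density_slope_def by (intro DERIV_cdivide DERIV_sum)
qed

text \<open>The bias is uniformly small by strict differentiability, and because the kernel \<open>k'\<close>
has integral \<open>0\<close> and first moment \<open>-1\<close>. The random part is controlled on a
grid of \<open>n + 1\<close> points by Hoeffding's inequality and between grid points by the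
Lipschitz constant of \<open>k'\<close>, which after rescaling is of order \<open>1 / h n ^
3\<close>, that is \<open>n powr (3/5)\<close>, against a mesh of order \<open>1 / n\<close>.\<close>

lemma density_slope_uniform:
  assumes \<eta>: "0 < \<eta>"
  obtains \<epsilon> where "0 < \<epsilon>" "whp (\<lambda>n \<omega>. \<forall>u. \<bar>u - t\<bar> \<le> \<epsilon> \<longrightarrow> \<bar>density_slope \<alpha> \<gamma> n \<omega> u - subdensity' \<alpha> \<gamma> t\<bar> \<le> \<eta>)"
proof -
  obtain B where B: "B > 0" "\<And>u. \<bar>deriv k u\<bar> \<le> B" using deriv_bounded by blast
  obtain L where L: "L > 0" "\<And>x y. \<bar>deriv k x - deriv k y\<bar> \<le> L * \<bar>x - y\<bar>" using deriv_lipschitz by blast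
  define A where "A = \<bar>\<alpha>\<bar> + \<bar>\<gamma>\<bar> + 1"
  have A: "0 < A" by (simp add: A_def add_nonneg_pos)
  let ?I = "LINT w|lborel. \<bar>deriv k w\<bar>"
  define J where "J = ?I + 1"
  have "0 \<le> ?I" by (intro integral_nonneg_AE) auto
  then have J: "0 < J" unfolding J_def by linarith
  define \<eta>1 where "\<eta>1 = \<eta> / (3 * J)"
  have \<eta>1: "0 < \<eta>1" using \<eta> J by (simp add: \<eta>1_def)
  have "\<eta>1 * ?I \<le> \<eta>1 * J" using \<eta>1 by (simp add: J_def)
  also have "\<dots> = \<eta> / 3" using J by (simp add: \<eta>1_def)
  finally have \<eta>I: "\<eta>1 * ?I \<le> \<eta> / 3" .
  obtain \<epsilon>0 where \<epsilon>0: "0 < \<epsilon>0" "\<And>u v. \<bar>u - t\<bar> \<le> \<epsilon>0 \<Longrightarrow> \<bar>v - t\<bar> \<le> \<epsilon>0 \<Longrightarrow>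
    \<bar>subdensity \<alpha> \<gamma> v - (subdensity \<alpha> \<gamma> u + subdensity' \<alpha> \<gamma> t * (v - u))\<bar> \<le> \<eta>1 * \<bar>v - u\<bar>"
    using subdensity_strict_derivative[OF \<eta>1] by blast
  define \<epsilon> where "\<epsilon> = \<epsilon>0 / 2"
  have \<epsilon>: "0 < \<epsilon>" using \<epsilon>0 by (simp add: \<epsilon>_def)
  let ?K = "\<lambda>n u v. deriv k ((u - v) / h n) / (h n)\<^sup>2"
  have bias: "\<bar>weighted_integral (?K n u) \<alpha> \<gamma> - subdensity' \<alpha> \<gamma> t\<bar> \<le> \<eta> / 3" if u: "\<bar>u - t\<bar> \<le> \<epsilon>" and hn: "0 < h n" "h n < \<epsilon>" for n u
  proof -
    have "\<bar>(LINT v|lborel. deriv k ((u - v) / h n) * subdensity \<alpha> \<gamma> v) / h n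
     - (subdensity \<alpha> \<gamma> u * (LINT w|lborel. deriv k w) - subdensity' \<alpha> \<gamma> t * h n * (LINT w|lborel. w * deriv k w) + 0 * (h n)\<^sup>2 * (LINT w|lborel. w\<^sup>2 * deriv k w))\<bar>
     \<le> \<eta>1 * h n ^ 1 * ?I"
    proof (rule kernel_average_expansion)
      fix v assume "\<bar>v - u\<bar> \<le> h n"
      then have "\<bar>v - t\<bar> \<le> \<epsilon>0" "\<bar>u - t\<bar> \<le> \<epsilon>0" using u hn \<epsilon>_def \<open>0 < \<epsilon>\<close> by linarith+
      then show "\<bar>subdensity \<alpha> \<gamma> v - (subdensity \<alpha> \<gamma> u + subdensity' \<alpha> \<gamma> t * (v - u) + 0 * (v - u)\<^sup>2)\<bar> \<le> \<eta>1 * \<bar>v - u\<bar> ^ 1"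
        using \<epsilon>0(2)[of u v] by simp
    qed (use B hn deriv_zero_outside in auto)
    then have *: "\<bar>(LINT v|lborel. deriv k ((u - v) / h n) * subdensity \<alpha> \<gamma> v) / h n - subdensity' \<alpha> \<gamma> t * h n\<bar> \<le> (\<eta>1 * ?I) * h n"
      by (simp add: integral_deriv integral_id_deriv mult_ac)
    have "weighted_integral (?K n u) \<alpha> \<gamma> = (LINT v|lborel. deriv k ((u - v) / h n) * subdensity \<alpha> \<gamma> v) / h n / h n"
      by (simp add: weighted_integral_def subdensity_def power2_eq_square)
    then have "weighted_integral (?K n u) \<alpha> \<gamma> - subdensity' \<alpha> \<gamma> t =
      ((LINT v|lborel. deriv k ((u - v) / h n) * subdensity \<alpha> \<gamma> v) / h n - subdensity' \<alpha> \<gamma> t * h n) / h n"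
      using hn by (simp add: diff_divide_distrib)
    then have "\<bar>weighted_integral (?K n u) \<alpha> \<gamma> - subdensity' \<alpha> \<gamma> t\<bar> \<le> \<eta>1 * ?I"
      using * hn by (simp add: abs_divide pos_divide_le_eq)
    then show ?thesis using \<eta>I by linarith
  qed
  \<comment> \<open>The grid points divide \<open>[t - \<epsilon>, t + \<epsilon>]\<close> into
      \<open>n\<close> intervals.\<close>
  define pt where "pt n l = t - \<epsilon> + real l * (2 * \<epsilon> / real n)" for n l
  define E where "E n = (\<Union>l\<le>n. {\<omega>\<in>space M. \<eta> / 3 \<le> \<bar>weighted_mean (?K n (pt n l)) \<alpha> \<gamma> n \<omega> - weighted_integral (?K n (pt n l)) \<alpha> \<gamma>\<bar>})" for n
  have Km: "?K n u \<in> borel_measurable borel" for n u by measurable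
  have Eev: "E n \<in> events" for n unfolding E_def using Km by (intro sets.finite_UN) auto
  define a where "a = (\<eta> / 3)\<^sup>2 / (2 * (B * A)\<^sup>2)"
  have a: "0 < a" using \<eta> B A by (simp add: a_def)
  have probE: "\<forall>\<^sub>F n in sequentially. prob (E n) \<le> real (Suc n) * (2 * exp (- real n * (a * h n ^ 4)))"
    using eventually_gt_at_top[of 0]
  proof eventually_elim
    case (elim n)
    have "prob (E n) \<le> (\<Sum>l\<le>n. prob {\<omega>\<in>space M. \<eta> / 3 \<le> \<bar>weighted_mean (?K n (pt n l)) \<alpha> \<gamma> n \<omega> - weighted_integral (?K n (pt n l)) \<alpha> \<gamma>\<bar>})"
      unfolding E_def using Km by (intro measure_UNION_le) auto
    also have "\<dots> \<le> (\<Sum>l\<le>n. 2 * exp (- real n * (a * h n ^ 4)))"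
    proof (rule sum_mono)
      fix l
      have "prob {\<omega>\<in>space M. \<eta> / 3 \<le> \<bar>weighted_mean (?K n (pt n l)) \<alpha> \<gamma> n \<omega> - weighted_integral (?K n (pt n l)) \<alpha> \<gamma>\<bar>}
        \<le> 2 * exp (- real n * (\<eta> / 3)\<^sup>2 / (2 * (B / (h n)\<^sup>2 * A)\<^sup>2))"
        using Km A B \<eta> elim h_pos[OF elim]
        by (intro weighted_mean_concentration) (auto simp: A_def abs_divide intro!: divide_right_mono)
      also have "- real n * (\<eta> / 3)\<^sup>2 / (2 * (B / (h n)\<^sup>2 * A)\<^sup>2) = - real n * (a * h n ^ 4)"
        using h_pos[OF elim] A B by (simp add: a_def power_mult_distrib power_divide field_simps)
      finally show "prob {\<omega>\<in>space M. \<eta> / 3 \<le> \<bar>weighted_mean (?K n (pt n l)) \<alpha> \<gamma> n \<omega> - weighted_integral (?K n (pt n l)) \<alpha> \<gamma>\<bar>}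
        \<le> 2 * exp (- real n * (a * h n ^ 4))" .
    qed
    finally show ?case by simp
  qed
  have null: "(\<lambda>n. prob (E n)) \<longlonglongrightarrow> 0"
    by (rule tendsto_sandwich[OF always_eventually probE tendsto_const exp_growth_null[OF a]]) simp
  have mesh: "(\<lambda>n. (L * A * 2 * \<epsilon> / c ^ 3) * real n powr (- 2 / 5)) \<longlonglongrightarrow> 0"
    using tendsto_mult[OF tendsto_const tendsto_neg_powr[OF _ filterlim_real_sequentially, of "- 2 / 5"], of "L * A * 2 * \<epsilon> / c ^ 3"] by simp
  have lip: "\<bar>density_slope \<alpha> \<gamma> n \<omega> u - density_slope \<alpha> \<gamma> n \<omega> v\<bar> \<le> L * A / h n ^ 3 * \<bar>u - v\<bar>" if n: "0 < n" for n \<omega> u v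
  proof -
    have hn: "0 < h n" using h_pos[OF n] .
    have le: "\<bar>?K n u x * (\<alpha> + \<gamma> * status j \<omega>) - ?K n v x * (\<alpha> + \<gamma> * status j \<omega>)\<bar> \<le> L * A / h n ^ 3 * \<bar>u - v\<bar>" for j x
    proof -
      have "?K n u x * (\<alpha> + \<gamma> * status j \<omega>) - ?K n v x * (\<alpha> + \<gamma> * status j \<omega>) =
         (deriv k ((u - x) / h n) - deriv k ((v - x) / h n)) / (h n)\<^sup>2 * (\<alpha> + \<gamma> * status j \<omega>)"
        by (simp add: left_diff_distrib diff_divide_distrib)
      also have "\<bar>\<dots>\<bar> \<le> L * (\<bar>u - v\<bar> / h n) / (h n)\<^sup>2 * A"
        unfolding abs_mult abs_divide
      proof (intro mult_mono divide_mono)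
        have "\<bar>deriv k ((u - x) / h n) - deriv k ((v - x) / h n)\<bar> \<le> L * \<bar>(u - x) / h n - (v - x) / h n\<bar>" by (rule L)
        also have "(u - x) / h n - (v - x) / h n = (u - v) / h n" by (simp add: diff_divide_distrib)
        finally show "\<bar>deriv k ((u - x) / h n) - deriv k ((v - x) / h n)\<bar> \<le> L * (\<bar>u - v\<bar> / h n)" using hn by (simp add: abs_divide)
        show "\<bar>\<alpha> + \<gamma> * status j \<omega>\<bar> \<le> A" by (auto simp: status_def A_def)
      qed (use hn L in auto)
      finally show ?thesis using hn by (simp add: power2_eq_square power3_eq_cube mult_ac)
    qed
    have "\<bar>(\<Sum>j<n. ?K n u (T j \<omega>) * (\<alpha> + \<gamma> * status j \<omega>) - ?K n v (T j \<omega>) * (\<alpha> + \<gamma> * status j \<omega>))\<bar>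
       \<le> (\<Sum>j<n. L * A / h n ^ 3 * \<bar>u - v\<bar>)"
      by (rule order_trans[OF sum_abs sum_mono]) (rule le)
    then have "\<bar>(\<Sum>j<n. ?K n u (T j \<omega>) * (\<alpha> + \<gamma> * status j \<omega>) - ?K n v (T j \<omega>) * (\<alpha> + \<gamma> * status j \<omega>))\<bar> / real n
       \<le> L * A / h n ^ 3 * \<bar>u - v\<bar>"
      using n by (simp add: pos_divide_le_eq mult_ac)
    moreover have "density_slope \<alpha> \<gamma> n \<omega> u - density_slope \<alpha> \<gamma> n \<omega> v =
      (\<Sum>j<n. ?K n u (T j \<omega>) * (\<alpha> + \<gamma> * status j \<omega>) - ?K n v (T j \<omega>) * (\<alpha> + \<gamma> * status j \<omega>)) / real n"
      by (simp add: density_slope_def weighted_mean_def sum_subtractf diff_divide_distrib)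
    ultimately show ?thesis by (simp add: abs_divide)
  qed
  have "whp (\<lambda>n \<omega>. \<forall>u. \<bar>u - t\<bar> \<le> \<epsilon> \<longrightarrow> \<bar>density_slope \<alpha> \<gamma> n \<omega> u - subdensity' \<alpha> \<gamma> t\<bar> \<le> \<eta>)"
  proof (rule whp_if_complement_null[OF Eev null])
    have "\<forall>\<^sub>F n in sequentially. (L * A * 2 * \<epsilon> / c ^ 3) * real n powr (- 2 / 5) < \<eta> / 3"
      using order_tendstoD(2)[OF mesh, of "\<eta> / 3"] \<eta> by simp
    then show "\<forall>\<^sub>F n in sequentially. \<forall>\<omega>\<in>space M. \<omega> \<notin> E n \<longrightarrow>
       (\<forall>u. \<bar>u - t\<bar> \<le> \<epsilon> \<longrightarrow> \<bar>density_slope \<alpha> \<gamma> n \<omega> u - subdensity' \<alpha> \<gamma> t\<bar> \<le> \<eta>)"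
      using eventually_h[OF \<epsilon>] eventually_gt_at_top[of 0]
    proof eventually_elim
      case (elim n)
      show ?case
      proof (intro ballI impI allI)
        fix \<omega> u assume \<omega>: "\<omega> \<in> space M" "\<omega> \<notin> E n" and u: "\<bar>u - t\<bar> \<le> \<epsilon>"
        define d where "d = 2 * \<epsilon> / real n"
        have d: "0 < d" "real n * d = 2 * \<epsilon>" using \<epsilon> elim by (auto simp: d_def)
        define l where "l = nat \<lfloor>(u - (t - \<epsilon>)) / d\<rfloor>"
        have q0: "0 \<le> (u - (t - \<epsilon>)) / d" using u d by (auto simp: abs_le_iff)
        then have l: "real l \<le> (u - (t - \<epsilon>)) / d" "(u - (t - \<epsilon>)) / d < real l + 1" by (auto simp: l_def)
        have ld: "real l * d \<le> u - (t - \<epsilon>)" "u - (t - \<epsilon>) < real l * d + d"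
          using l d(1) by (auto simp: pos_le_divide_eq pos_divide_less_eq algebra_simps)
        have "real l * d \<le> real n * d" using ld(1) u d(2) by (auto simp: abs_le_iff)
        then have ln: "l \<le> n" using d(1) by simp
        have pt: "pt n l \<le> u" "u - pt n l < d" using ld by (auto simp: pt_def d_def)
        have "pt n l \<ge> t - \<epsilon>" using \<epsilon> by (simp add: pt_def)
        with pt u have ptt: "\<bar>pt n l - t\<bar> \<le> \<epsilon>" by linarith
        have 1: "\<bar>density_slope \<alpha> \<gamma> n \<omega> (pt n l) - weighted_integral (?K n (pt n l)) \<alpha> \<gamma>\<bar> < \<eta> / 3"
        proof (rule ccontr)
          assume "\<not> ?thesis"
          then have "\<omega> \<in> E n" using \<omega>(1) ln unfolding E_def density_slope_def not_less by blast
          with \<omega>(2) show False by blast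
        qed
        have 2: "\<bar>weighted_integral (?K n (pt n l)) \<alpha> \<gamma> - subdensity' \<alpha> \<gamma> t\<bar> \<le> \<eta> / 3"
          using ptt elim by (intro bias) auto
        have n: "0 < n" by fact
        have "\<bar>density_slope \<alpha> \<gamma> n \<omega> u - density_slope \<alpha> \<gamma> n \<omega> (pt n l)\<bar> \<le> L * A / h n ^ 3 * \<bar>u - pt n l\<bar>" by (rule lip[OF n])
        also have "\<dots> \<le> L * A / h n ^ 3 * d" using pt L A h_pos[OF n] by (intro mult_left_mono) auto
        also have "\<dots> = (L * A * 2 * \<epsilon> / c ^ 3) * real n powr (- 2 / 5)"
        proof -
          define P Q where "P = real n powr (- 3 / 5)" and "Q = real n powr (- 2 / 5)"
          have P0: "P \<noteq> 0" using n by (simp add: P_def)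
          have "P * Q = real n powr (- 1)" unfolding P_def Q_def powr_add[symmetric] by simp
          then have "d = 2 * \<epsilon> * (P * Q)" using n by (simp add: d_def powr_neg_one)
          moreover have "h n ^ 3 = c ^ 3 * P" using power_h[OF n, of 3] by (simp add: P_def)
          ultimately have "L * A / h n ^ 3 * d = L * A * 2 * \<epsilon> / c ^ 3 * Q" using P0 c by simp
          then show ?thesis unfolding Q_def .
        qed
        finally have 3: "\<bar>density_slope \<alpha> \<gamma> n \<omega> u - density_slope \<alpha> \<gamma> n \<omega> (pt n l)\<bar> < \<eta> / 3" using elim by linarith
        show "\<bar>density_slope \<alpha> \<gamma> n \<omega> u - subdensity' \<alpha> \<gamma> t\<bar> \<le> \<eta>" using 1 2 3 by linarith
      qed
    qed
  qed
  with \<epsilon> show thesis by (rule that)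
qed

end

section \<open>Coincidence of the two estimators\<close>

context current_status
begin

lemma weighted_integral_scale: "weighted_integral (\<lambda>v. b * \<kappa> v) \<alpha> \<gamma> = b * weighted_integral \<kappa> \<alpha> \<gamma>"
  unfolding weighted_integral_def by (simp add: mult.assoc)

lemma weighted_integral_linear:
  assumes [measurable]: "\<kappa> \<in> borel_measurable borel" and bound: "\<And>v. \<bar>\<kappa> v\<bar> \<le> B"
  shows "weighted_integral \<kappa> (\<alpha> + r * \<alpha>') (\<gamma> + r * \<gamma>') = weighted_integral \<kappa> \<alpha> \<gamma> + r * weighted_integral \<kappa> \<alpha>' \<gamma>'"
proof -
  have eq: "\<kappa> v * ((\<alpha> + r * \<alpha>' + (\<gamma> + r * \<gamma>') * F\<^sub>0 v) * g v) =
      \<kappa> v * ((\<alpha> + \<gamma> * F\<^sub>0 v) * g v) + r * (\<kappa> v * ((\<alpha>' + \<gamma>' * F\<^sub>0 v) * g v))" for v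
    by (simp add: algebra_simps)
  show ?thesis unfolding weighted_integral_def eq
    using expectation_weighted(2)[OF assms(1) bound, of \<alpha> \<gamma>] expectation_weighted(2)[OF assms(1) bound, of \<alpha>' \<gamma>']
    by simp
qed

end

context smoothed_current_status
begin

lemma F0_t: "0 < F\<^sub>0 t" "F\<^sub>0 t < 1" and g_t: "0 < g t"
proof -
  have "F\<^sub>0 0 < F\<^sub>0 t" "F\<^sub>0 t < F\<^sub>0 M\<^sub>0" using F0_strict t_pos t_less by (auto simp: strict_mono_on_def)
  then show "0 < F\<^sub>0 t" "F\<^sub>0 t < 1" using F0_nonneg[of 0] F0_le_1[of M\<^sub>0] by linarith+
  obtain \<delta> where "\<delta> > 0" "\<And>x. x \<in> {0..M\<^sub>0} \<Longrightarrow> \<delta> \<le> g x" using g_away by blast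
  then show "0 < g t" using t_pos t_less by (meson atLeastAtMost_iff less_imp_le less_le_trans)
qed

text \<open>The expression is \<open>\<integral>\<^sub>t\<^sup>s (F\<^sub>0 v - F\<^sub>0 t) g v dv\<close>,
whose integrand has the sign of \<open>v - t\<close>. It is bounded below by the contribution of the
half of \<open>[t, t + \<epsilon>]\<close>, respectively \<open>[t - \<epsilon>, t]\<close>, that is
farther from \<open>t\<close>.\<close>

lemma drift_away_from_t:
  assumes \<epsilon>: "0 < \<epsilon>" "0 \<le> t - \<epsilon>" "t + \<epsilon> \<le> M\<^sub>0"
  obtains \<eta> where "0 < \<eta>" "\<And>s. 0 \<le> s \<Longrightarrow> \<epsilon> \<le> \<bar>s - t\<bar> \<Longrightarrow>
    \<eta> \<le> (weighted_integral (indicator {0..s}) 0 1 - weighted_integral (indicator {0..t}) 0 1) - F\<^sub>0 t * (T_mass s - T_mass t)"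
proof -
  obtain \<delta> where \<delta>: "\<delta> > 0" "\<And>x. x \<in> {0..M\<^sub>0} \<Longrightarrow> \<delta> \<le> g x" using g_away by blast
  define \<eta>1 where "\<eta>1 = (F\<^sub>0 (t + \<epsilon> / 2) - F\<^sub>0 t) * \<delta> * (\<epsilon> / 2)"
  define \<eta>2 where "\<eta>2 = (F\<^sub>0 t - F\<^sub>0 (t - \<epsilon> / 2)) * \<delta> * (\<epsilon> / 2)"
  have F: "F\<^sub>0 t < F\<^sub>0 (t + \<epsilon> / 2)" "F\<^sub>0 (t - \<epsilon> / 2) < F\<^sub>0 t"
    using F0_strict \<epsilon> t_pos t_less by (auto simp: strict_mono_on_def)
  then have \<eta>: "0 < \<eta>1" "0 < \<eta>2" using \<delta> \<epsilon> by (auto simp: \<eta>1_def \<eta>2_def)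
  have int: "integrable lborel (\<lambda>v. indicator C v * ((\<alpha> + \<gamma> * F\<^sub>0 v) * g v))" if [measurable]: "C \<in> sets borel" for \<alpha> \<gamma> C
    by (rule expectation_weighted[of _ 1]) (auto simp: indicator_def)
  have lin: "weighted_integral (indicator {0..s}) \<alpha> \<gamma> = \<gamma> * weighted_integral (indicator {0..s}) 0 1 + \<alpha> * T_mass s" for s \<alpha> \<gamma>
    using weighted_integral_linear[of "indicator {0..s}" 1 0 \<alpha> 1 \<gamma> 0] weighted_integral_linear[of "indicator {0..s}" 1 0 \<gamma> 0 0 1]
    by (simp add: indicator_def[abs_def] weighted_integral_def[of _ 0 0])
  have const: "integrable lborel (\<lambda>v. indicator {a<..b} v * r)" "(LINT v|lborel. indicator {a<..b} v * r) = (b - a) * r"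
    if "a \<le> b" for a b r :: real
  proof -
    show "integrable lborel (\<lambda>v. indicator {a<..b} v * r)"
      using that by (intro integrable_mult_left integrable_real_indicator) (auto simp: emeasure_lborel_Ioc)
    show "(LINT v|lborel. indicator {a<..b} v * r) = (b - a) * r" using that by simp
  qed
  have "min \<eta>1 \<eta>2 \<le> (weighted_integral (indicator {0..s}) 0 1 - weighted_integral (indicator {0..t}) 0 1) - F\<^sub>0 t * (T_mass s - T_mass t)"
    if s: "0 \<le> s" and far: "\<epsilon> \<le> \<bar>s - t\<bar>" for s
  proof (cases "t \<le> s")
    case True
    then have s': "t + \<epsilon> \<le> s" using far by simp
    have "(LINT v|lborel. indicator {t + \<epsilon> / 2<..t + \<epsilon>} v * ((F\<^sub>0 (t + \<epsilon> / 2) - F\<^sub>0 t) * \<delta>)) \<le>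
      (LINT v|lborel. indicator {t<..s} v * ((- F\<^sub>0 t + 1 * F\<^sub>0 v) * g v))"
    proof (rule integral_mono)
      fix v :: real
      show "indicator {t + \<epsilon> / 2<..t + \<epsilon>} v * ((F\<^sub>0 (t + \<epsilon> / 2) - F\<^sub>0 t) * \<delta>) \<le> indicator {t<..s} v * ((- F\<^sub>0 t + 1 * F\<^sub>0 v) * g v)"
      proof (cases "v \<in> {t + \<epsilon> / 2<..t + \<epsilon>}")
        case True
        then have "(F\<^sub>0 (t + \<epsilon> / 2) - F\<^sub>0 t) * \<delta> \<le> (- F\<^sub>0 t + 1 * F\<^sub>0 v) * g v"
          using F \<delta> \<epsilon> F0_mono[of "t + \<epsilon> / 2" v] t_pos by (intro mult_mono) auto
        then show ?thesis using True s' \<epsilon> by (auto simp: indicator_def)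
      next
        case False
        have "0 \<le> (- F\<^sub>0 t + 1 * F\<^sub>0 v) * g v" if "t < v" using F0_mono[of t v] that g_nonneg by (intro mult_nonneg_nonneg) auto
        then show ?thesis using False by (auto simp: indicator_def)
      qed
    next
      show "integrable lborel (\<lambda>v. indicator {t + \<epsilon> / 2<..t + \<epsilon>} v * ((F\<^sub>0 (t + \<epsilon> / 2) - F\<^sub>0 t) * \<delta>))"
        using \<epsilon> by (intro const) simp
      show "integrable lborel (\<lambda>v. indicator {t<..s} v * ((- F\<^sub>0 t + 1 * F\<^sub>0 v) * g v))" by (rule int) simp
    qed
    also have "\<dots> = weighted_integral (indicator {0..s}) (- F\<^sub>0 t) 1 - weighted_integral (indicator {0..t}) (- F\<^sub>0 t) 1"
      using True t_pos by (intro weighted_integral_interval[symmetric]) auto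
    finally have "\<eta>1 \<le> weighted_integral (indicator {0..s}) (- F\<^sub>0 t) 1 - weighted_integral (indicator {0..t}) (- F\<^sub>0 t) 1"
      using const(2)[of "t + \<epsilon> / 2" "t + \<epsilon>"] \<epsilon> by (simp add: \<eta>1_def mult_ac)
    then show ?thesis unfolding lin[of _ "- F\<^sub>0 t" 1] by (simp add: algebra_simps min_le_iff_disj)
  next
    case False
    then have s': "s \<le> t - \<epsilon>" using far by simp
    have "(LINT v|lborel. indicator {t - \<epsilon><..t - \<epsilon> / 2} v * ((F\<^sub>0 t - F\<^sub>0 (t - \<epsilon> / 2)) * \<delta>)) \<le>
      (LINT v|lborel. indicator {s<..t} v * ((F\<^sub>0 t + -1 * F\<^sub>0 v) * g v))"
    proof (rule integral_mono)
      fix v :: real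
      show "indicator {t - \<epsilon><..t - \<epsilon> / 2} v * ((F\<^sub>0 t - F\<^sub>0 (t - \<epsilon> / 2)) * \<delta>) \<le> indicator {s<..t} v * ((F\<^sub>0 t + -1 * F\<^sub>0 v) * g v)"
      proof (cases "v \<in> {t - \<epsilon><..t - \<epsilon> / 2}")
        case True
        then have "(F\<^sub>0 t - F\<^sub>0 (t - \<epsilon> / 2)) * \<delta> \<le> (F\<^sub>0 t + -1 * F\<^sub>0 v) * g v"
          using F \<delta> \<epsilon> F0_mono[of v "t - \<epsilon> / 2"] t_less by (intro mult_mono) auto
        then show ?thesis using True s' \<epsilon> by (auto simp: indicator_def)
      next
        case False
        have "0 \<le> (F\<^sub>0 t + -1 * F\<^sub>0 v) * g v" if "v \<le> t" using F0_mono[of v t] that g_nonneg by (intro mult_nonneg_nonneg) auto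
        then show ?thesis using False by (auto simp: indicator_def)
      qed
    next
      show "integrable lborel (\<lambda>v. indicator {t - \<epsilon><..t - \<epsilon> / 2} v * ((F\<^sub>0 t - F\<^sub>0 (t - \<epsilon> / 2)) * \<delta>))"
        using \<epsilon> by (intro const) simp
      show "integrable lborel (\<lambda>v. indicator {s<..t} v * ((F\<^sub>0 t + -1 * F\<^sub>0 v) * g v))" by (rule int) simp
    qed
    also have "\<dots> = weighted_integral (indicator {0..t}) (F\<^sub>0 t) (-1) - weighted_integral (indicator {0..s}) (F\<^sub>0 t) (-1)"
      using False s by (intro weighted_integral_interval[symmetric]) auto
    finally have "\<eta>2 \<le> weighted_integral (indicator {0..t}) (F\<^sub>0 t) (-1) - weighted_integral (indicator {0..s}) (F\<^sub>0 t) (-1)"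
      using const(2)[of "t - \<epsilon>" "t - \<epsilon> / 2"] \<epsilon> by (simp add: \<eta>2_def mult_ac)
    then show ?thesis unfolding lin[of _ "F\<^sub>0 t" "-1"] by (simp add: algebra_simps min_le_iff_disj)
  qed
  then show thesis using \<eta> by (intro that[of "min \<eta>1 \<eta>2"]) auto
qed

lemma ratio_close:
  assumes "\<bar>y - F\<^sub>0 t * g t\<bar> < \<eta>" "\<bar>x - g t\<bar> < \<eta>" "\<eta> \<le> g t / 2"
  shows "0 < x" "\<bar>y / x - F\<^sub>0 t\<bar> \<le> 4 * \<eta> / g t"
proof -
  have x: "g t / 2 < x" using assms by linarith
  then show x0: "0 < x" using g_t by linarith
  have "\<bar>y - F\<^sub>0 t * x\<bar> \<le> 2 * \<eta>"
  proof -
    have "\<bar>F\<^sub>0 t * (g t - x)\<bar> \<le> 1 * \<eta>" unfolding abs_mult using assms F0_t by (intro mult_mono) auto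
    moreover have "y - F\<^sub>0 t * x = (y - F\<^sub>0 t * g t) + F\<^sub>0 t * (g t - x)" by (simp add: algebra_simps)
    ultimately show ?thesis using assms(1) by linarith
  qed
  moreover have "y / x - F\<^sub>0 t = (y - F\<^sub>0 t * x) / x" using x0 by (simp add: diff_divide_distrib)
  ultimately have "\<bar>y / x - F\<^sub>0 t\<bar> \<le> 2 * \<eta> / x" using x0 by (simp add: abs_divide divide_right_mono)
  also have "\<dots> \<le> 2 * \<eta> / (g t / 2)" using x g_t x0 assms by (intro divide_left_mono) auto
  finally show "\<bar>y / x - F\<^sub>0 t\<bar> \<le> 4 * \<eta> / g t" by simp
qed

lemma dens_est_1_eq_weighted_mean:
  assumes "0 < h n" "h n < u"
  shows "g_est n \<omega> 1 u = kernel_mean 0 1 n \<omega> u"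
  using dens_est_eq_weighted_mean[OF assms, of 1] by (simp add: weight_of_def del: One_nat_def)

text \<open>The height over the tangent has derivative \<open>\<psi> = g\<^sub>1 - r g\<close>, in terms of the
density estimators. This function vanishes at \<open>t\<close> by the choice of \<open>r\<close> and
is nondecreasing, so the height has its minimum at \<open>t\<close>.\<close>

lemma tangent_near_t:
  assumes h: "0 < h n" "h n < t - \<epsilon>" and \<epsilon>: "0 < \<epsilon>" and s: "\<bar>s - t\<bar> \<le> \<epsilon>"
    and r: "kernel_mean 0 1 n \<omega> t = r * kernel_mean 1 0 n \<omega> t"
    and slope: "\<And>u. \<bar>u - t\<bar> \<le> \<epsilon> \<Longrightarrow> 0 \<le> density_slope 0 1 n \<omega> u - r * density_slope 1 0 n \<omega> u"
  shows "r * (G_est_total n \<omega> s - G_est_total n \<omega> t)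
    \<le> G_est n \<omega> 1 s - G_est n \<omega> 1 t"
proof -
  let ?X = "G_est_total n \<omega>" and ?Y = "G_est n \<omega> 1"
  define \<psi> where "\<psi> u = kernel_mean 0 1 n \<omega> u
     - r * kernel_mean 1 0 n \<omega> u" for u
  define Q where "Q u = ?Y u - r * ?X u" for u
  have \<psi>t: "\<psi> t = 0" using r by (simp add: \<psi>_def)
  have d\<psi>: "(\<psi> has_real_derivative density_slope 0 1 n \<omega> u - r * density_slope 1 0 n \<omega> u) (at u)" for u
    unfolding \<psi>_def[abs_def] by (intro DERIV_diff DERIV_cmult density_has_slope h)
  have mono: "\<psi> a \<le> \<psi> b" if "a \<le> b" "\<bar>a - t\<bar> \<le> \<epsilon>" "\<bar>b - t\<bar> \<le> \<epsilon>" for a b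
  proof (rule DERIV_nonneg_imp_nondecreasing[OF that(1)])
    fix x assume "a \<le> x" "x \<le> b"
    then have "\<bar>x - t\<bar> \<le> \<epsilon>" using that by linarith
    then show "\<exists>y. (\<psi> has_real_derivative y) (at x) \<and> 0 \<le> y" using d\<psi>[of x] slope[of x] by blast
  qed
  have dQ: "(Q has_real_derivative \<psi> u) (at u)" if u: "\<bar>u - t\<bar> \<le> \<epsilon>" for u
  proof -
    have hu: "h n < u" using u h by linarith
    show ?thesis unfolding Q_def[abs_def] \<psi>_def dens_est_1_eq_weighted_mean[OF h(1) hu, symmetric] dens_est_total_eq_weighted_mean[OF h(1) hu, symmetric]
      by (intro DERIV_diff DERIV_cmult cum_est_has_derivative h hu)
  qed
  have "Q t \<le> Q s"
  proof (cases "t \<le> s")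
    case True
    show ?thesis
    proof (rule DERIV_nonneg_imp_nondecreasing[OF True])
      fix x assume x: "t \<le> x" "x \<le> s"
      then have "\<bar>x - t\<bar> \<le> \<epsilon>" using s by linarith
      then show "\<exists>y. (Q has_real_derivative y) (at x) \<and> 0 \<le> y" using dQ[of x] mono[of t x] \<psi>t x \<epsilon> by fastforce
    qed
  next
    case False
    then have st: "s \<le> t" by simp
    show ?thesis
    proof (rule DERIV_nonpos_imp_nonincreasing[OF st])
      fix x assume x: "s \<le> x" "x \<le> t"
      then have "\<bar>x - t\<bar> \<le> \<epsilon>" using s by linarith
      then show "\<exists>y. (Q has_real_derivative y) (at x) \<and> y \<le> 0" using dQ[of x] mono[of x t] \<psi>t x \<epsilon> by fastforce
    qed
  qed
  then show ?thesis by (simp add: Q_def algebra_simps)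
qed

text \<open>The tangent condition is checked near \<open>t\<close> by \<open>tangent_near_t\<close> and
elsewhere by comparison with \<open>drift_away_from_t\<close>. The tolerances are chosen in the
order \<open>\<eta>1\<close> (slopes), \<open>\<epsilon>\<close> (the neighbourhood),
\<open>\<eta>0\<close> (the drift outside of it), \<open>\<eta>2\<close> (integrated estimators and
\<open>r\<close>), \<open>\<eta>3\<close> (densities at \<open>t\<close>).\<close>

lemma F_MS_eq_F_naive_whp:
  "whp (\<lambda>n \<omega>. F_MS_at n \<omega> = F_naive_at n \<omega>)"
proof -
  define \<kappa> where "\<kappa> = f\<^sub>0 t * g t"
  define L where "L = \<bar>deriv g t\<bar>"
  have \<kappa>: "0 < \<kappa>" using f0_pos g_t by (simp add: \<kappa>_def)
  \<comment> \<open>With \<open>\<bar>r\<bar> \<le> 2\<close> the derivative of the height misses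
      \<open>\<kappa>\<close> by at most \<open>\<eta>1 * (1 + 2 + L)\<close>.\<close>
  define \<eta>1 where "\<eta>1 = min 1 (\<kappa> / (3 + L))"
  have L: "0 \<le> L" by (simp add: L_def)
  then have \<eta>1: "0 < \<eta>1" "\<eta>1 \<le> 1" using \<kappa> by (auto simp: \<eta>1_def)
  have \<eta>1': "\<eta>1 * (3 + L) \<le> \<kappa>"
  proof -
    have "\<eta>1 * (3 + L) \<le> \<kappa> / (3 + L) * (3 + L)" using L by (intro mult_right_mono) (auto simp: \<eta>1_def)
    then show ?thesis using L by simp
  qed
  obtain \<epsilon>1 where \<epsilon>1: "0 < \<epsilon>1" "whp (\<lambda>n \<omega>. \<forall>u. \<bar>u - t\<bar> \<le> \<epsilon>1 \<longrightarrow> \<bar>density_slope 0 1 n \<omega> u - subdensity' 0 1 t\<bar> \<le> \<eta>1)"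
    using density_slope_uniform[OF \<eta>1(1)] by blast
  obtain \<epsilon>2 where \<epsilon>2: "0 < \<epsilon>2" "whp (\<lambda>n \<omega>. \<forall>u. \<bar>u - t\<bar> \<le> \<epsilon>2 \<longrightarrow> \<bar>density_slope 1 0 n \<omega> u - subdensity' 1 0 t\<bar> \<le> \<eta>1)"
    using density_slope_uniform[OF \<eta>1(1)] by blast
  define \<epsilon> where "\<epsilon> = min (min \<epsilon>1 \<epsilon>2) (min (t / 2) (M\<^sub>0 - t))"
  have \<epsilon>: "0 < \<epsilon>" "\<epsilon> \<le> \<epsilon>1" "\<epsilon> \<le> \<epsilon>2" "\<epsilon> \<le> t / 2" "t + \<epsilon> \<le> M\<^sub>0"
    using \<epsilon>1(1) \<epsilon>2(1) t_pos t_less unfolding \<epsilon>_def by linarith+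
  have \<epsilon>t: "0 \<le> t - \<epsilon>" using \<epsilon> t_pos by linarith
  let ?H = "\<lambda>s. weighted_integral (indicator {0..s}) 0 1" and ?K = "\<lambda>s. weighted_integral (indicator {0..s}) 1 (-1)"
  obtain \<eta>0 where \<eta>0: "0 < \<eta>0" "\<And>s. 0 \<le> s \<Longrightarrow> \<epsilon> \<le> \<bar>s - t\<bar> \<Longrightarrow> \<eta>0 \<le> (?H s - ?H t) - F\<^sub>0 t * (T_mass s - T_mass t)"
    by (rule drift_away_from_t[OF \<epsilon>(1) \<epsilon>t \<epsilon>(5)]) (rule that)
  \<comment> \<open>The error in the height is at most \<open>2 + 8 + 1\<close> times
      \<open>\<eta>2\<close>: vertical coordinates, \<open>\<bar>r\<bar> \<le> 2\<close> times
      horizontal ones, and \<open>r\<close>.\<close>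
  define \<eta>2 where "\<eta>2 = min \<eta>1 (\<eta>0 / 11)"
  have \<eta>2: "0 < \<eta>2" "\<eta>2 \<le> \<eta>1" "11 * \<eta>2 \<le> \<eta>0" using \<eta>1 \<eta>0(1) by (auto simp: \<eta>2_def)
  \<comment> \<open>Chosen for \<open>ratio_close\<close>, so that \<open>r\<close> is within
      \<open>\<eta>2\<close> of \<open>F\<^sub>0 t\<close>.\<close>
  define \<eta>3 where "\<eta>3 = min (g t / 2) (\<eta>2 * g t / 4)"
  have \<eta>3: "0 < \<eta>3" "\<eta>3 \<le> g t / 2" "4 * \<eta>3 \<le> \<eta>2 * g t" using \<eta>2 g_t by (auto simp: \<eta>3_def)
  have \<eta>3': "4 * \<eta>3 / g t \<le> \<eta>2" using \<eta>3(3) g_t by (simp add: pos_divide_le_eq)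
  have H_sum: "?K s + ?H s = T_mass s" for s
    using weighted_integral_linear[of "indicator {0..s}" 1 1 1 0 "-1" 1] by (simp add: indicator_def[abs_def])
  have T01: "0 \<le> T_mass s" "T_mass s \<le> 1" for s
  proof -
    interpret D: real_distribution "distr M borel (T 0)" by simp
    show "0 \<le> T_mass s" "T_mass s \<le> 1" unfolding T_mass_eq(1) using D.cdf_nonneg D.cdf_bounded_prob by auto
  qed
  let ?d = "\<lambda>n \<omega> \<alpha> \<gamma>. kernel_mean \<alpha> \<gamma> n \<omega> t"
  let ?C = "\<lambda>n \<omega> i s. G_est n \<omega> i s"
  have cum: "whp (\<lambda>n \<omega>. \<forall>s\<ge>0. \<bar>?C n \<omega> 1 s - ?H s\<bar> \<le> \<eta>2)" "whp (\<lambda>n \<omega>. \<forall>s\<ge>0. \<bar>?C n \<omega> 0 s - ?K s\<bar> \<le> \<eta>2)"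
    using cum_est_uniform[of 1, OF _ \<eta>2(1)] cum_est_uniform[of 0, OF _ \<eta>2(1)] by (simp_all add: weight_of_def)
  have "whp (\<lambda>n \<omega>. ((\<forall>u. \<bar>u - t\<bar> \<le> \<epsilon>1 \<longrightarrow> \<bar>density_slope 0 1 n \<omega> u - subdensity' 0 1 t\<bar> \<le> \<eta>1) \<and>
      (\<forall>u. \<bar>u - t\<bar> \<le> \<epsilon>2 \<longrightarrow> \<bar>density_slope 1 0 n \<omega> u - subdensity' 1 0 t\<bar> \<le> \<eta>1)) \<and>
      (\<bar>?d n \<omega> 0 1 - subdensity 0 1 t\<bar> < \<eta>3 \<and> \<bar>?d n \<omega> 1 0 - subdensity 1 0 t\<bar> < \<eta>3) \<and>
      (\<forall>s\<ge>0. \<bar>?C n \<omega> 1 s - ?H s\<bar> \<le> \<eta>2) \<and> (\<forall>s\<ge>0. \<bar>?C n \<omega> 0 s - ?K s\<bar> \<le> \<eta>2))"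
    by (intro whp_conj \<epsilon>1(2) \<epsilon>2(2) density_converges \<eta>3(1) cum)
  then show ?thesis
  proof (rule whp_mono[OF _ eventually_mono[OF eventually_h[of "t / 2"]]], goal_cases)
    case 1 show ?case using t_pos by simp
  next
    case (2 n)
    show ?case
    proof (intro ballI impI, elim conjE)
      fix \<omega>
      assume s1: "\<forall>u. \<bar>u - t\<bar> \<le> \<epsilon>1 \<longrightarrow> \<bar>density_slope 0 1 n \<omega> u - subdensity' 0 1 t\<bar> \<le> \<eta>1"
        and s2: "\<forall>u. \<bar>u - t\<bar> \<le> \<epsilon>2 \<longrightarrow> \<bar>density_slope 1 0 n \<omega> u - subdensity' 1 0 t\<bar> \<le> \<eta>1"
        and d1: "\<bar>?d n \<omega> 0 1 - subdensity 0 1 t\<bar> < \<eta>3" and d2: "\<bar>?d n \<omega> 1 0 - subdensity 1 0 t\<bar> < \<eta>3"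
        and c1: "\<forall>s\<ge>0. \<bar>?C n \<omega> 1 s - ?H s\<bar> \<le> \<eta>2" and c0: "\<forall>s\<ge>0. \<bar>?C n \<omega> 0 s - ?K s\<bar> \<le> \<eta>2"
      have hn: "0 < h n" "h n < t / 2" "h n < t" using 2 t_pos by auto
      define r where "r = ?d n \<omega> 0 1 / ?d n \<omega> 1 0"
      have pos: "0 < ?d n \<omega> 1 0" and r: "\<bar>r - F\<^sub>0 t\<bar> \<le> \<eta>2"
        using ratio_close[of "?d n \<omega> 0 1" \<eta>3 "?d n \<omega> 1 0"] d1 d2 \<eta>3(2) \<eta>3' unfolding r_def by (auto simp: subdensity_def)
      have r2: "\<bar>r\<bar> \<le> 2" using r F0_t \<eta>2 \<eta>1 by linarith
      have naive: "F_naive_at n \<omega> = r"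
        unfolding F_naive_def r_def dens_est_1_eq_weighted_mean[OF hn(1,3)] dens_est_total_eq_weighted_mean[OF hn(1,3)] ..
      let ?X = "G_est_total n \<omega>"
      have slope: "0 \<le> density_slope 0 1 n \<omega> u - r * density_slope 1 0 n \<omega> u" if u: "\<bar>u - t\<bar> \<le> \<epsilon>" for u
      proof -
        let ?D1 = "density_slope 0 1 n \<omega> u" and ?D = "density_slope 1 0 n \<omega> u"
        have 1: "\<bar>?D1 - (\<kappa> + F\<^sub>0 t * deriv g t)\<bar> \<le> \<eta>1" using s1 u \<epsilon> by (auto simp: subdensity'_def \<kappa>_def)
        have 2: "\<bar>?D - deriv g t\<bar> \<le> \<eta>1" using s2 u \<epsilon> by (auto simp: subdensity'_def)
        have "\<bar>r * (?D - deriv g t)\<bar> \<le> 2 * \<eta>1" unfolding abs_mult using r2 2 by (intro mult_mono) auto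
        moreover have "\<bar>(r - F\<^sub>0 t) * deriv g t\<bar> \<le> \<eta>1 * L"
          unfolding abs_mult L_def using r \<eta>2 by (intro mult_right_mono) auto
        moreover have "?D1 - r * ?D = \<kappa> + (?D1 - (\<kappa> + F\<^sub>0 t * deriv g t)) - r * (?D - deriv g t) - (r - F\<^sub>0 t) * deriv g t"
          by (simp add: algebra_simps)
        moreover have "\<eta>1 * 3 + \<eta>1 * L \<le> \<kappa>" using \<eta>1' by (simp add: distrib_left)
        ultimately show ?thesis using 1 by linarith
      qed
      show "F_MS_at n \<omega> = F_naive_at n \<omega>"
      proof (rule F_MS_eq_F_naive[OF hn(1,3)])
        show "(if X j \<omega> \<le> T j \<omega> then 1 else 0) \<in> {0, 1 :: nat}" for j by auto
        show "0 < g_est_total n \<omega> t"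
          using pos by (simp add: dens_est_total_eq_weighted_mean[OF hn(1,3)])
        fix s :: real assume s: "0 \<le> s"
        have "r * (?X s - ?X t) \<le> ?C n \<omega> 1 s - ?C n \<omega> 1 t"
        proof (cases "\<bar>s - t\<bar> \<le> \<epsilon>")
          case True
          have "?d n \<omega> 0 1 = r * ?d n \<omega> 1 0" using pos by (simp add: r_def)
          then show ?thesis using hn \<epsilon> by (intro tangent_near_t[OF _ _ \<epsilon>(1) True _ slope]) auto
        next
          case False
          have X: "?X u = ?C n \<omega> 0 u + ?C n \<omega> 1 u" for u by (rule cum_est_total_eq[OF hn(1)])
          have X_close: "\<bar>?X u - T_mass u\<bar> \<le> 2 * \<eta>2" if "0 \<le> u" for u
            using c1[rule_format, OF that] c0[rule_format, OF that] H_sum[of u] unfolding X by linarith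
          have "\<bar>(?X s - ?X t) - (T_mass s - T_mass t)\<bar> \<le> 4 * \<eta>2"
            using X_close[OF s] X_close[of t] t_pos by linarith
          then have "\<bar>r * ((?X s - ?X t) - (T_mass s - T_mass t))\<bar> \<le> 2 * (4 * \<eta>2)"
            unfolding abs_mult using r2 by (intro mult_mono) auto
          moreover have "\<bar>(r - F\<^sub>0 t) * (T_mass s - T_mass t)\<bar> \<le> \<eta>2 * 1"
            unfolding abs_mult using r T01[of s] T01[of t] by (intro mult_mono) auto
          moreover have "r * (?X s - ?X t) = r * ((?X s - ?X t) - (T_mass s - T_mass t)) + (r - F\<^sub>0 t) * (T_mass s - T_mass t)
              + F\<^sub>0 t * (T_mass s - T_mass t)" by (simp add: algebra_simps)
          moreover have "\<eta>0 \<le> (?H s - ?H t) - F\<^sub>0 t * (T_mass s - T_mass t)" using False by (intro \<eta>0(2) s) auto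
          moreover have "\<bar>?C n \<omega> 1 s - ?H s\<bar> \<le> \<eta>2" "\<bar>?C n \<omega> 1 t - ?H t\<bar> \<le> \<eta>2" using c1 s t_pos by auto
          ultimately show ?thesis using \<eta>2(3) by linarith
        qed
        then show "F_naive_at n \<omega> * (?X s - ?X t) \<le> ?C n \<omega> 1 s - ?C n \<omega> 1 t"
          unfolding naive .
      qed
    qed
  qed
qed

end

section \<open>Asymptotic normality\<close>

context smoothed_current_status
begin

text \<open>Half the second derivative of \<open>(F\<^sub>0 - F\<^sub>0 t) * g\<close> at \<open>t\<close>.\<close>

definition curvature :: real where
  "curvature = deriv f\<^sub>0 t / 2 * g t + f\<^sub>0 t * deriv g t"

lemma F0_second_order: "((\<lambda>v. (F\<^sub>0 v - F\<^sub>0 t - f\<^sub>0 t * (v - t)) / (v - t)\<^sup>2) \<longlongrightarrow> deriv f\<^sub>0 t / 2) (at t)"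
proof (rule lhopital[where f' = "\<lambda>v. f\<^sub>0 v - f\<^sub>0 t" and g' = "\<lambda>v. 2 * (v - t)"])
  have "isCont (\<lambda>v. F\<^sub>0 v - F\<^sub>0 t - f\<^sub>0 t * (v - t)) t" by (intro continuous_intros isCont_at_t)
  then show "((\<lambda>v. F\<^sub>0 v - F\<^sub>0 t - f\<^sub>0 t * (v - t)) \<longlongrightarrow> 0) (at t)" by (simp add: isCont_def)
  have "isCont (\<lambda>v. (v - t)\<^sup>2) t" by (intro continuous_intros)
  then show "((\<lambda>v. (v - t)\<^sup>2) \<longlongrightarrow> 0) (at t)" by (simp add: isCont_def)
  show "\<forall>\<^sub>F v in at t. (v - t)\<^sup>2 \<noteq> 0" "\<forall>\<^sub>F v in at t. 2 * (v - t) \<noteq> 0"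
    by (auto simp: eventually_at_filter)
  show "\<forall>\<^sub>F v in at t. ((\<lambda>v. F\<^sub>0 v - F\<^sub>0 t - f\<^sub>0 t * (v - t)) has_real_derivative f\<^sub>0 v - f\<^sub>0 t) (at v)"
    using F0_deriv unfolding eventually_at_filter
  proof eventually_elim
    case (elim v)
    have "((\<lambda>v. F\<^sub>0 v - F\<^sub>0 t - f\<^sub>0 t * (v - t)) has_real_derivative f\<^sub>0 v - 0 - f\<^sub>0 t * (1 - 0)) (at v)"
      by (intro DERIV_diff DERIV_cmult DERIV_ident DERIV_const elim)
    then show ?case by simp
  qed
  show "\<forall>\<^sub>F v in at t. ((\<lambda>v. (v - t)\<^sup>2) has_real_derivative 2 * (v - t)) (at v)"
    by (auto intro!: always_eventually derivative_eq_intros)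
  have "((\<lambda>v. (f\<^sub>0 v - f\<^sub>0 t) / (v - t) / 2) \<longlongrightarrow> deriv f\<^sub>0 t / 2) (at t)"
    using f0_deriv by (intro tendsto_divide tendsto_const) (auto simp: has_field_derivative_iff)
  then show "((\<lambda>v. (f\<^sub>0 v - f\<^sub>0 t) / (2 * (v - t))) \<longlongrightarrow> deriv f\<^sub>0 t / 2) (at t)"
    by (simp add: mult.commute)
qed

lemma subdensity_second_order:
  "((\<lambda>v. (subdensity (- F\<^sub>0 t) 1 v - f\<^sub>0 t * g t * (v - t)) / (v - t)\<^sup>2) \<longlongrightarrow> curvature) (at t)"
proof -
  have g': "((\<lambda>v. (g v - g t) / (v - t)) \<longlongrightarrow> deriv g t) (at t)"
    using eventually_nhds_x_imp_x[OF g_deriv] by (simp add: has_field_derivative_iff)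
  have g: "(g \<longlongrightarrow> g t) (at t)" using isCont_at_t by (simp add: isCont_def)
  have "((\<lambda>v. (F\<^sub>0 v - F\<^sub>0 t - f\<^sub>0 t * (v - t)) / (v - t)\<^sup>2 * g v + f\<^sub>0 t * ((g v - g t) / (v - t))) \<longlongrightarrow> curvature) (at t)"
    unfolding curvature_def by (intro tendsto_add tendsto_mult tendsto_const F0_second_order g g')
  moreover have "\<forall>\<^sub>F v in at t. (F\<^sub>0 v - F\<^sub>0 t - f\<^sub>0 t * (v - t)) / (v - t)\<^sup>2 * g v + f\<^sub>0 t * ((g v - g t) / (v - t))
     = (subdensity (- F\<^sub>0 t) 1 v - f\<^sub>0 t * g t * (v - t)) / (v - t)\<^sup>2"
    unfolding eventually_at_filter
  proof (intro always_eventually allI impI)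
    fix v :: real assume "v \<noteq> t"
    then have e: "v - t \<noteq> 0" by simp
    define e where "e = v - t"
    have e0: "e \<noteq> 0" using e by (simp add: e_def)
    have "f\<^sub>0 t * ((g v - g t) / e) = f\<^sub>0 t * e * (g v - g t) / e\<^sup>2" using e0 by (simp add: power2_eq_square)
    then have "(F\<^sub>0 v - F\<^sub>0 t - f\<^sub>0 t * e) / e\<^sup>2 * g v + f\<^sub>0 t * ((g v - g t) / e)
      = ((F\<^sub>0 v - F\<^sub>0 t - f\<^sub>0 t * e) * g v + f\<^sub>0 t * e * (g v - g t)) / e\<^sup>2"
      by (simp only: add_divide_distrib times_divide_eq_left)
    also have "(F\<^sub>0 v - F\<^sub>0 t - f\<^sub>0 t * e) * g v + f\<^sub>0 t * e * (g v - g t) = subdensity (- F\<^sub>0 t) 1 v - f\<^sub>0 t * g t * e"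
      by (simp add: subdensity_def algebra_simps)
    finally show "(F\<^sub>0 v - F\<^sub>0 t - f\<^sub>0 t * (v - t)) / (v - t)\<^sup>2 * g v + f\<^sub>0 t * ((g v - g t) / (v - t))
     = (subdensity (- F\<^sub>0 t) 1 v - f\<^sub>0 t * g t * (v - t)) / (v - t)\<^sup>2" by (simp only: e_def)
  qed
  ultimately show ?thesis by (rule Lim_transform_eventually)
qed

text \<open>The value and, by symmetry of the kernel, the first order term do not contribute.\<close>

lemma smoothing_bias:
  "(\<lambda>n. weighted_integral (\<lambda>v. scaled_kernel k (h n) (t - v)) (- F\<^sub>0 t) 1 / (h n)\<^sup>2) \<longlonglongrightarrow> curvature * second_moment k"
proof (rule LIMSEQ_I)
  fix e :: real assume e: "0 < e"
  obtain B where B: "B > 0" "\<And>u. \<bar>k u\<bar> \<le> B" using bounded by blast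
  have "\<forall>\<^sub>F v in at t. dist ((subdensity (- F\<^sub>0 t) 1 v - f\<^sub>0 t * g t * (v - t)) / (v - t)\<^sup>2) curvature < e / 2"
    using e by (intro tendstoD[OF subdensity_second_order]) simp
  then obtain d where d: "0 < d" "\<And>v. v \<noteq> t \<Longrightarrow> dist v t < d \<Longrightarrow>
      dist ((subdensity (- F\<^sub>0 t) 1 v - f\<^sub>0 t * g t * (v - t)) / (v - t)\<^sup>2) curvature < e / 2"
    unfolding eventually_at by blast
  have taylor: "\<bar>subdensity (- F\<^sub>0 t) 1 v - (0 + f\<^sub>0 t * g t * (v - t) + curvature * (v - t)\<^sup>2)\<bar> \<le> e / 2 * \<bar>v - t\<bar> ^ 2"
    if v: "\<bar>v - t\<bar> < d" for v
  proof (cases "v = t")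
    case True then show ?thesis by (simp add: subdensity_def)
  next
    case False
    define q where "q = subdensity (- F\<^sub>0 t) 1 v - f\<^sub>0 t * g t * (v - t)"
    define s where "s = (v - t)\<^sup>2"
    have s: "0 < s" using False by (simp add: s_def)
    have "\<bar>q / s - curvature\<bar> < e / 2" using d(2)[OF False] v by (simp add: dist_real_def q_def s_def)
    then have "\<bar>q / s - curvature\<bar> * s \<le> e / 2 * s" using s by (intro mult_right_mono) auto
    moreover have "\<bar>q / s - curvature\<bar> * s = \<bar>q - curvature * s\<bar>"
    proof -
      have "(q / s - curvature) * s = q - curvature * s" using s by (simp add: left_diff_distrib)
      then show ?thesis using s by (metis abs_mult abs_of_pos)
    qed
    ultimately show ?thesis by (simp add: q_def s_def algebra_simps)
  qed
  have "\<forall>\<^sub>F n in sequentially. norm (weighted_integral (\<lambda>v. scaled_kernel k (h n) (t - v)) (- F\<^sub>0 t) 1 / (h n)\<^sup>2 - curvature * second_moment k) < e"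
    using eventually_h[OF d(1)]
  proof eventually_elim
    case (elim n)
    let ?W = "(LINT v|lborel. k ((t - v) / h n) * subdensity (- F\<^sub>0 t) 1 v) / h n"
    have "\<bar>?W - (0 * (LINT w|lborel. k w) - f\<^sub>0 t * g t * h n * (LINT w|lborel. w * k w) + curvature * (h n)\<^sup>2 * (LINT w|lborel. w\<^sup>2 * k w))\<bar>
      \<le> e / 2 * h n ^ 2 * (LINT w|lborel. \<bar>k w\<bar>)"
    proof (rule kernel_average_expansion)
      show "k w = 0" if "1 < \<bar>w\<bar>" for w using that zero_outside[of w] by simp
      show "\<bar>subdensity (- F\<^sub>0 t) 1 v - (0 + f\<^sub>0 t * g t * (v - t) + curvature * (v - t)\<^sup>2)\<bar> \<le> e / 2 * \<bar>v - t\<bar> ^ 2"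
        if "\<bar>v - t\<bar> \<le> h n" for v using that elim by (intro taylor) auto
    qed (use B elim in auto)
    then have *: "\<bar>?W - curvature * second_moment k * (h n)\<^sup>2\<bar> \<le> e / 2 * (h n)\<^sup>2"
      using integral_1 nonneg by (simp add: first_moment second_moment_def mult_ac)
    have W: "weighted_integral (\<lambda>v. scaled_kernel k (h n) (t - v)) (- F\<^sub>0 t) 1 = ?W"
      by (simp add: weighted_integral_def subdensity_def scaled_kernel_def)
    have h2: "0 < (h n)\<^sup>2" using elim by simp
    have "?W / (h n)\<^sup>2 - curvature * second_moment k = (?W - curvature * second_moment k * (h n)\<^sup>2) / (h n)\<^sup>2"
      using elim by (simp add: diff_divide_distrib)
    then have "\<bar>?W / (h n)\<^sup>2 - curvature * second_moment k\<bar> = \<bar>?W - curvature * second_moment k * (h n)\<^sup>2\<bar> / (h n)\<^sup>2"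
      by (simp add: abs_divide)
    also have "\<dots> \<le> e / 2" using * by (subst pos_divide_le_eq[OF h2])
    also have "\<dots> < e" using e by simp
    finally show ?case unfolding W real_norm_def .
  qed
  then show "\<exists>N. \<forall>n\<ge>N. norm (weighted_integral (\<lambda>v. scaled_kernel k (h n) (t - v)) (- F\<^sub>0 t) 1 / (h n)\<^sup>2 - curvature * second_moment k) < e"
    by (simp add: eventually_sequentially)
qed

text \<open>The constant added to the status in each summand, which carries the threshold \<open>x\<close> of
the distribution function.\<close>

definition shift :: "real \<Rightarrow> nat \<Rightarrow> real" where
  "shift x n = - F\<^sub>0 t - x * real n powr (- 2 / 5)"

lemma shift_tendsto: "shift x \<longlonglongrightarrow> - F\<^sub>0 t"
proof -
  have "(\<lambda>n. - F\<^sub>0 t - x * real n powr (- 2 / 5)) \<longlonglongrightarrow> - F\<^sub>0 t - x * 0"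
    by (intro tendsto_intros tendsto_neg_powr filterlim_real_sequentially) auto
  then show ?thesis by (simp add: shift_def[abs_def])
qed

lemma bandwidth_powers:
  assumes "0 < n"
  shows "real n * real n powr (- 3 / 5) = real n powr (2 / 5)" "real n powr (2 / 5) * real n powr (- 2 / 5) = 1"
    "real n powr (2 / 5) * (h n)\<^sup>2 = c\<^sup>2" "real n * (real n powr (- 3 / 5))\<^sup>2 / h n = 1 / c"
    "real n powr (- 3 / 5) / h n = real n powr (- 2 / 5) / c"
proof -
  have p: "real n powr a * real n powr b = real n powr (a + b)" for a b by (simp add: powr_add)
  have one: "real n = real n powr 1" using assms by simp
  have "real n powr 1 * real n powr (- 3 / 5) = real n powr (2 / 5)" unfolding p by simp
  then show 1: "real n * real n powr (- 3 / 5) = real n powr (2 / 5)" using assms by simp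
  have "real n powr (2 / 5) * real n powr (- 2 / 5) = real n powr 0" unfolding p by simp
  then show 2: "real n powr (2 / 5) * real n powr (- 2 / 5) = 1" using assms by simp
  show "real n powr (2 / 5) * (h n)\<^sup>2 = c\<^sup>2" using power_h[OF assms, of 2] 2 by simp
  have h1: "h n = c * real n powr (- 1 / 5)" by (simp add: bandwidth_def)
  have nz: "real n powr (- 1 / 5) \<noteq> 0" using assms by simp
  have "real n powr (- 3 / 5) = real n powr (- 2 / 5) * real n powr (- 1 / 5)" unfolding p by simp
  then show 3: "real n powr (- 3 / 5) / h n = real n powr (- 2 / 5) / c" using nz c unfolding h1 by simp
  have "real n * (real n powr (- 3 / 5))\<^sup>2 / h n = real n * real n powr (- 3 / 5) * (real n powr (- 3 / 5) / h n)"
    by (simp add: power2_eq_square)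
  also have "\<dots> = 1 / c" unfolding 1 3 using 2 by simp
  finally show "real n * (real n powr (- 3 / 5))\<^sup>2 / h n = 1 / c" .
qed

text \<open>The normalisation \<open>n powr (-3/5)\<close> is \<open>n powr (2/5)\<close> for the rate divided
by \<open>n\<close> for the average.\<close>

definition summand :: "real \<Rightarrow> nat \<Rightarrow> nat \<Rightarrow> 'a \<Rightarrow> real" where
  "summand x n j \<omega> = (real n powr (- 3 / 5) * scaled_kernel k (h n) (t - T j \<omega>)) * (shift x n + 1 * status j \<omega>)"

lemma measurable_scaled [measurable]: "(\<lambda>v. scaled_kernel k h' (u - v)) \<in> borel_measurable borel"
  unfolding scaled_kernel_def by measurable

lemma scaled_kernel_bound:
  assumes B: "\<And>u. \<bar>k u\<bar> \<le> B" "0 < B"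
  shows "\<bar>scaled_kernel k (h n) u\<bar> \<le> B / h n"
proof (cases "n = 0")
  case True then show ?thesis by (simp add: scaled_kernel_def bandwidth_def)
next
  case False
  then show ?thesis using B h_pos[of n] by (simp add: scaled_kernel_def abs_divide divide_right_mono)
qed

text \<open>The first term is the smoothing bias, and the second one comes from the threshold \<open>x\<close>
in \<open>shift\<close>, multiplied by the total weight, which converges to \<open>g t\<close>.\<close>

lemma summand_mean: "(\<lambda>n. real n * expectation (summand x n 0)) \<longlonglongrightarrow> c\<^sup>2 * (curvature * second_moment k) - x * g t"
proof -
  obtain B where B: "B > 0" "\<And>u. \<bar>k u\<bar> \<le> B" using bounded by blast
  let ?s = "\<lambda>n v. scaled_kernel k (h n) (t - v)"
  have sb: "\<bar>?s n v\<bar> \<le> B / h n" for n v by (rule scaled_kernel_bound[OF B(2) B(1)])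
  have lim: "(\<lambda>n. weighted_integral (?s n) 1 0) \<longlonglongrightarrow> g t"
    using weighted_integral_tendsto[OF measurable_k(1) B(2), of 1 0] zero_outside integral_1
    by (simp add: scaled_kernel_def subdensity_def)
  have "(\<lambda>n. c\<^sup>2 * (weighted_integral (?s n) (- F\<^sub>0 t) 1 / (h n)\<^sup>2) - x * weighted_integral (?s n) 1 0)
      \<longlonglongrightarrow> c\<^sup>2 * (curvature * second_moment k) - x * g t"
    by (intro tendsto_diff tendsto_mult tendsto_const smoothing_bias lim)
  moreover have "\<forall>\<^sub>F n in sequentially. c\<^sup>2 * (weighted_integral (?s n) (- F\<^sub>0 t) 1 / (h n)\<^sup>2) - x * weighted_integral (?s n) 1 0
      = real n * expectation (summand x n 0)"
    using eventually_gt_at_top[of 0]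
  proof eventually_elim
    case (elim n)
    have hn: "h n \<noteq> 0" using h_pos[OF elim] by simp
    have "expectation (summand x n 0) = weighted_integral (\<lambda>v. real n powr (- 3 / 5) * ?s n v) (shift x n) 1"
      unfolding summand_def[abs_def]
    proof (rule expectation_weighted(1))
      show "\<bar>real n powr (- 3 / 5) * ?s n v\<bar> \<le> real n powr (- 3 / 5) * (B / h n)" for v
        unfolding abs_mult using sb by (intro mult_mono) auto
    qed measurable
    also have "\<dots> = real n powr (- 3 / 5) * weighted_integral (?s n) (shift x n) 1"
      by (rule weighted_integral_scale)
    also have "weighted_integral (?s n) (shift x n) 1 =
        weighted_integral (?s n) (- F\<^sub>0 t) 1 + (- x * real n powr (- 2 / 5)) * weighted_integral (?s n) 1 0"
    proof -
      have "weighted_integral (?s n) (- F\<^sub>0 t + (- x * real n powr (- 2 / 5)) * 1) (1 + (- x * real n powr (- 2 / 5)) * 0) =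
        weighted_integral (?s n) (- F\<^sub>0 t) 1 + (- x * real n powr (- 2 / 5)) * weighted_integral (?s n) 1 0"
        by (rule weighted_integral_linear[OF _ sb]) measurable
      then show ?thesis by (simp add: shift_def)
    qed
    finally have E: "expectation (summand x n 0) = real n powr (- 3 / 5) * (weighted_integral (?s n) (- F\<^sub>0 t) 1 + (- x * real n powr (- 2 / 5)) * weighted_integral (?s n) 1 0)" .
    have "real n * expectation (summand x n 0) = (real n * real n powr (- 3 / 5)) * weighted_integral (?s n) (- F\<^sub>0 t) 1
       - x * (real n * real n powr (- 3 / 5) * real n powr (- 2 / 5)) * weighted_integral (?s n) 1 0"
      unfolding E by (simp add: algebra_simps)
    also have "\<dots> = real n powr (2 / 5) * weighted_integral (?s n) (- F\<^sub>0 t) 1 - x * weighted_integral (?s n) 1 0"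
      unfolding bandwidth_powers(1)[OF elim] bandwidth_powers(2)[OF elim] by simp
    also have "real n powr (2 / 5) = c\<^sup>2 / (h n)\<^sup>2" using bandwidth_powers(3)[OF elim] hn by (simp add: eq_divide_eq)
    finally show ?case by simp
  qed
  ultimately show ?thesis by (rule Lim_transform_eventually)
qed

text \<open>Since the status is \<open>0\<close> or \<open>1\<close>, the square of \<open>shift x n +
status\<close> is affine in the status; in the limit it contributes \<open>F\<^sub>0 t * (1 -
F\<^sub>0 t)\<close>, the variance of the status at \<open>t\<close>.\<close>

lemma summand_variance:
  "(\<lambda>n. real n * expectation (\<lambda>\<omega>. (summand x n 0 \<omega>)\<^sup>2)) \<longlonglongrightarrow> 1 / c * (F\<^sub>0 t * (1 - F\<^sub>0 t) * g t * (LINT u|lborel. (k u)\<^sup>2))"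
proof -
  obtain B where B: "B > 0" "\<And>u. \<bar>k u\<bar> \<le> B" using bounded by blast
  let ?q = "\<lambda>n v. (k ((t - v) / h n))\<^sup>2 / h n"
  let ?I = "LINT u|lborel. (k u)\<^sup>2"
  have sq: "\<bar>(k u)\<^sup>2\<bar> \<le> B\<^sup>2" for u using B(2)[of u] B(1) by (simp add: abs_le_square_iff[symmetric])
  have [measurable]: "(\<lambda>w. (k w)\<^sup>2) \<in> borel_measurable borel" by measurable
  have lim: "(\<lambda>n. weighted_integral (?q n) \<alpha> \<gamma>) \<longlonglongrightarrow> subdensity \<alpha> \<gamma> t * ?I" for \<alpha> \<gamma>
    using weighted_integral_tendsto[of "\<lambda>w. (k w)\<^sup>2" "B\<^sup>2" \<alpha> \<gamma>] sq zero_outside by simp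
  have qb: "\<bar>?q n v\<bar> \<le> B\<^sup>2 / \<bar>h n\<bar>" for n v
    unfolding abs_divide using sq by (intro divide_right_mono) auto
  have "(\<lambda>n. 1 / c * ((shift x n)\<^sup>2 * weighted_integral (?q n) 1 0 + (2 * shift x n + 1) * weighted_integral (?q n) 0 1))
     \<longlonglongrightarrow> 1 / c * ((- F\<^sub>0 t)\<^sup>2 * (subdensity 1 0 t * ?I) + (2 * - F\<^sub>0 t + 1) * (subdensity 0 1 t * ?I))"
    by (intro tendsto_intros lim shift_tendsto)
  also have "(- F\<^sub>0 t)\<^sup>2 * (subdensity 1 0 t * ?I) + (2 * - F\<^sub>0 t + 1) * (subdensity 0 1 t * ?I) = F\<^sub>0 t * (1 - F\<^sub>0 t) * g t * ?I"
    by (simp add: subdensity_def power2_eq_square algebra_simps)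
  finally have "(\<lambda>n. 1 / c * ((shift x n)\<^sup>2 * weighted_integral (?q n) 1 0 + (2 * shift x n + 1) * weighted_integral (?q n) 0 1))
     \<longlonglongrightarrow> 1 / c * (F\<^sub>0 t * (1 - F\<^sub>0 t) * g t * ?I)" .
  moreover have "\<forall>\<^sub>F n in sequentially. 1 / c * ((shift x n)\<^sup>2 * weighted_integral (?q n) 1 0 + (2 * shift x n + 1) * weighted_integral (?q n) 0 1)
      = real n * expectation (\<lambda>\<omega>. (summand x n 0 \<omega>)\<^sup>2)"
    using eventually_gt_at_top[of 0]
  proof eventually_elim
    case (elim n)
    define b where "b = (real n powr (- 3 / 5))\<^sup>2 / h n"
    have b0: "0 \<le> b" using h_pos[OF elim] by (simp add: b_def)
    have eq: "(summand x n 0 \<omega>)\<^sup>2 = (b * ?q n (T 0 \<omega>)) * ((shift x n)\<^sup>2 + (2 * shift x n + 1) * status 0 \<omega>)" for \<omega>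
      by (simp add: summand_def b_def scaled_kernel_def power_mult_distrib power_divide status_def power2_eq_square algebra_simps)
    have "expectation (\<lambda>\<omega>. (summand x n 0 \<omega>)\<^sup>2) = weighted_integral (\<lambda>v. b * ?q n v) ((shift x n)\<^sup>2) (2 * shift x n + 1)"
      unfolding eq
    proof (rule expectation_weighted(1))
      show "\<bar>b * ?q n v\<bar> \<le> b * (B\<^sup>2 / \<bar>h n\<bar>)" for v
        unfolding abs_mult[of b] using qb b0 by (intro mult_mono) auto
    qed measurable
    also have "\<dots> = b * weighted_integral (?q n) ((shift x n)\<^sup>2) (2 * shift x n + 1)" by (rule weighted_integral_scale)
    also have "weighted_integral (?q n) ((shift x n)\<^sup>2) (2 * shift x n + 1) =
       (shift x n)\<^sup>2 * weighted_integral (?q n) 1 0 + (2 * shift x n + 1) * weighted_integral (?q n) 0 1"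
    proof -
      have z: "weighted_integral (?q n) 0 0 = 0" by (simp add: weighted_integral_def)
      have "weighted_integral (?q n) ((shift x n)\<^sup>2 + (2 * shift x n + 1) * 0) (0 + (2 * shift x n + 1) * 1)
        = weighted_integral (?q n) ((shift x n)\<^sup>2) 0 + (2 * shift x n + 1) * weighted_integral (?q n) 0 1"
        by (rule weighted_integral_linear[OF _ qb]) measurable
      moreover have "weighted_integral (?q n) (0 + (shift x n)\<^sup>2 * 1) (0 + (shift x n)\<^sup>2 * 0)
        = weighted_integral (?q n) 0 0 + (shift x n)\<^sup>2 * weighted_integral (?q n) 1 0"
        by (rule weighted_integral_linear[OF _ qb]) measurable
      ultimately show ?thesis using z by simp
    qed
    finally have "real n * expectation (\<lambda>\<omega>. (summand x n 0 \<omega>)\<^sup>2) =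
       (real n * (real n powr (- 3 / 5))\<^sup>2 / h n) * ((shift x n)\<^sup>2 * weighted_integral (?q n) 1 0 + (2 * shift x n + 1) * weighted_integral (?q n) 0 1)"
      by (simp add: b_def)
    then show ?case unfolding bandwidth_powers(4)[OF elim] by simp
  qed
  ultimately show ?thesis by (rule Lim_transform_eventually)
qed

lemma summand_clt:
  "(\<lambda>n. prob {\<omega>\<in>space M. (\<Sum>j<n. summand x n j \<omega>) \<le> 0}) \<longlonglongrightarrow>
    cdf std_normal_distribution (- (c\<^sup>2 * (curvature * second_moment k) - x * g t) /
      sqrt (1 / c * (F\<^sub>0 t * (1 - F\<^sub>0 t) * g t * (LINT u|lborel. (k u)\<^sup>2))))"
proof -
  obtain B where B: "B > 0" "\<And>u. \<bar>k u\<bar> \<le> B" using bounded by blast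
  let ?b = "\<lambda>n. real n powr (- 3 / 5) * (B / h n) * (F\<^sub>0 t + \<bar>x\<bar> * real n powr (- 2 / 5) + 1)"
  have m: "(\<lambda>v. real n powr (- 3 / 5) * scaled_kernel k (h n) (t - v)) \<in> borel_measurable borel" for n by measurable
  show ?thesis
  proof (rule triangular_clt_prob[where Y = "summand x" and b = ?b, OF _ _ _ _ summand_mean summand_variance])
    show "indep_vars (\<lambda>_. borel) (summand x n) UNIV" for n
      unfolding summand_def[abs_def] by (rule weighted_indep(1)[OF m])
    show "distr M borel (summand x n j) = distr M borel (summand x n 0)" for n j
      unfolding summand_def[abs_def] by (rule weighted_indep(2)[OF m])
    show "\<bar>summand x n 0 \<omega>\<bar> \<le> ?b n" for n \<omega>
      unfolding summand_def abs_mult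
    proof (intro mult_mono)
      show "\<bar>scaled_kernel k (h n) (t - T 0 \<omega>)\<bar> \<le> B / h n" by (rule scaled_kernel_bound[OF B(2) B(1)])
      have "\<bar>x * real n powr (- 2 / 5)\<bar> = \<bar>x\<bar> * real n powr (- 2 / 5)" by (simp add: abs_mult)
      moreover have "0 \<le> status 0 \<omega>" "status 0 \<omega> \<le> 1" by (auto simp: status_def)
      ultimately show "\<bar>shift x n + 1 * status 0 \<omega>\<bar> \<le> F\<^sub>0 t + \<bar>x\<bar> * real n powr (- 2 / 5) + 1"
        unfolding shift_def using F0_t by linarith
      show "0 \<le> real n powr (- 3 / 5) * (B / h n)" using B c by (simp add: bandwidth_def)
    qed (use B c in \<open>auto simp: bandwidth_def\<close>)
    have "(\<lambda>n. real n powr (- 2 / 5)) \<longlonglongrightarrow> 0" by (intro tendsto_neg_powr filterlim_real_sequentially) simp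
    then have "(\<lambda>n. B / c * real n powr (- 2 / 5) * (F\<^sub>0 t + \<bar>x\<bar> * real n powr (- 2 / 5) + 1)) \<longlonglongrightarrow> B / c * 0 * (F\<^sub>0 t + \<bar>x\<bar> * 0 + 1)"
      by (intro tendsto_intros)
    then have "(\<lambda>n. B / c * real n powr (- 2 / 5) * (F\<^sub>0 t + \<bar>x\<bar> * real n powr (- 2 / 5) + 1)) \<longlonglongrightarrow> 0" by simp
    moreover have "\<forall>\<^sub>F n in sequentially. B / c * real n powr (- 2 / 5) * (F\<^sub>0 t + \<bar>x\<bar> * real n powr (- 2 / 5) + 1) = ?b n"
      using eventually_gt_at_top[of 0]
    proof eventually_elim
      case (elim n)
      have "real n powr (- 3 / 5) * (B / h n) = B * (real n powr (- 3 / 5) / h n)" by simp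
      then show ?case unfolding bandwidth_powers(5)[OF elim] by simp
    qed
    ultimately show "?b \<longlonglongrightarrow> 0" by (rule Lim_transform_eventually)
    show "0 < 1 / c * (F\<^sub>0 t * (1 - F\<^sub>0 t) * g t * (LINT u|lborel. (k u)\<^sup>2))"
      using c F0_t g_t square_integral_pos by simp
  qed
qed

text \<open>Clearing the positive denominator makes the event linear in the observations.\<close>

lemma naive_iff_sum:
  assumes n: "0 < n" and hn: "h n < t" and pos: "0 < g_est_total n \<omega> t"
  shows "(\<Sum>j<n. summand x n j \<omega>) \<le> 0 \<longleftrightarrow>
    real n powr (2 / 5) * (F_naive_at n \<omega> - F\<^sub>0 t) \<le> x"
proof -
  define N where "N = real n powr (2 / 5)"
  define y where "y = g_est n \<omega> 1 t"
  define d where "d = g_est_total n \<omega> t"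
  have N: "0 < N" using n by (simp add: N_def)
  have Ninv: "real n powr (- 2 / 5) = 1 / N" using bandwidth_powers(2)[OF n] N by (simp add: N_def eq_divide_eq mult.commute)
  have d: "0 < d" using pos by (simp add: d_def)
  let ?s = "\<lambda>v. scaled_kernel k (h n) (t - v)"
  have y: "y = weighted_mean ?s 0 1 n \<omega>" unfolding y_def by (rule dens_est_1_eq_weighted_mean[OF h_pos[OF n] hn])
  have dd: "d = weighted_mean ?s 1 0 n \<omega>" unfolding d_def by (rule dens_est_total_eq_weighted_mean[OF h_pos[OF n] hn])
  have "(\<Sum>j<n. summand x n j \<omega>) = real n powr (- 3 / 5) * (\<Sum>j<n. ?s (T j \<omega>) * (shift x n + 1 * status j \<omega>))"
    by (simp add: summand_def sum_distrib_left mult.assoc)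
  also have "(\<Sum>j<n. ?s (T j \<omega>) * (shift x n + 1 * status j \<omega>)) = real n * weighted_mean ?s (shift x n) 1 n \<omega>"
    using n by (simp add: weighted_mean_def)
  also have "weighted_mean ?s (shift x n) 1 n \<omega> = y + shift x n * d"
  proof -
    have "shift x n * d = weighted_mean ?s (shift x n) 0 n \<omega>"
      unfolding dd by (simp add: weighted_mean_def sum_distrib_left mult_ac)
    then show ?thesis unfolding y using weighted_mean_add[of ?s 0 1 n \<omega> "shift x n" 0] by simp
  qed
  also have "real n powr (- 3 / 5) * (real n * (y + shift x n * d)) = N * (y + shift x n * d)"
    using bandwidth_powers(1)[OF n] by (simp add: N_def mult_ac)
  finally have S: "(\<Sum>j<n. summand x n j \<omega>) = N * (y + shift x n * d)" .
  have "(\<Sum>j<n. summand x n j \<omega>) \<le> 0 \<longleftrightarrow> y + shift x n * d \<le> 0"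
    unfolding S using N by (simp add: mult_le_0_iff)
  also have "\<dots> \<longleftrightarrow> y \<le> (F\<^sub>0 t + x / N) * d" unfolding shift_def Ninv by (simp add: algebra_simps)
  also have "\<dots> \<longleftrightarrow> y / d \<le> F\<^sub>0 t + x / N" using d by (simp add: pos_divide_le_eq)
  also have "\<dots> \<longleftrightarrow> y / d - F\<^sub>0 t \<le> x / N" by linarith
  also have "\<dots> \<longleftrightarrow> N * (y / d - F\<^sub>0 t) \<le> x" using N by (simp add: pos_le_divide_eq mult.commute)
  finally show ?thesis unfolding N_def y_def d_def F_naive_def .
qed

lemma measurable_D_at [measurable]: "(\<lambda>\<omega>. D_at \<omega> j) \<in> measurable M (count_space UNIV)"
  by measurable

lemma measurable_F_naive [measurable]:
  "random_variable borel (\<lambda>\<omega>. F_naive_at n \<omega>)"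
proof -
  have "random_variable borel (\<lambda>\<omega>. g_est n \<omega> i t)" for i
    unfolding dens_est_eq by measurable
  then show ?thesis unfolding F_naive_def dens_est_total_def by measurable
qed

text \<open>Numerator and standard deviation carry the same factor \<open>g t\<close>, which cancels and leaves
the asymptotic mean and variance of the ratio.\<close>

lemma standardised_argument:
  "- (c\<^sup>2 * (curvature * second_moment k) - x * g t) / sqrt (1 / c * (F\<^sub>0 t * (1 - F\<^sub>0 t) * g t * (LINT u|lborel. (k u)\<^sup>2)))
    = (x - asymp_mean k f\<^sub>0 g t c) / sqrt (asymp_var k F\<^sub>0 g t c)"
proof -
  let ?I = "LINT u|lborel. (k u)\<^sup>2"
  have mean: "c\<^sup>2 * (curvature * second_moment k) = g t * asymp_mean k f\<^sub>0 g t c"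
    using g_t by (simp add: curvature_def asymp_mean_def field_simps)
  have "1 / c * (F\<^sub>0 t * (1 - F\<^sub>0 t) * g t * ?I) = (g t)\<^sup>2 * asymp_var k F\<^sub>0 g t c"
    using g_t by (simp add: asymp_var_def power2_eq_square divide_inverse)
  then have sd: "sqrt (1 / c * (F\<^sub>0 t * (1 - F\<^sub>0 t) * g t * ?I)) = g t * sqrt (asymp_var k F\<^sub>0 g t c)"
    using g_t by (simp add: real_sqrt_mult)
  have "- (g t * asymp_mean k f\<^sub>0 g t c - x * g t) = g t * (x - asymp_mean k f\<^sub>0 g t c)" by (simp add: algebra_simps)
  then show ?thesis unfolding mean sd using g_t by simp
qed

lemma asymp_var_pos: "0 < asymp_var k F\<^sub>0 g t c"
  using F0_t g_t c square_integral_pos by (simp add: asymp_var_def)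

text \<open>The denominator is positive with probability tending to one since it converges to \<open>g
t\<close>.\<close>

theorem F_naive_limit:
  "(\<lambda>n. prob {\<omega>\<in>space M. real n powr (2 / 5) * (F_naive_at n \<omega> - F\<^sub>0 t) \<le> x})
     \<longlonglongrightarrow> cdf (normal_law (asymp_mean k f\<^sub>0 g t c) (asymp_var k F\<^sub>0 g t c)) x"
  unfolding cdf_normal_law[OF asymp_var_pos] standardised_argument[symmetric]
proof (rule prob_tendsto_transfer[OF summand_clt])
  have [measurable]: "random_variable borel (summand x n j)" for n j
    unfolding summand_def[abs_def] by measurable
  show "\<forall>\<^sub>F n in sequentially. {\<omega>\<in>space M. (\<Sum>j<n. summand x n j \<omega>) \<le> 0} \<in> events \<and>
     {\<omega>\<in>space M. real n powr (2 / 5) * (F_naive_at n \<omega> - F\<^sub>0 t) \<le> x} \<in> events"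
    by (intro always_eventually allI conjI) measurable
  have "whp (\<lambda>n \<omega>. \<bar>kernel_mean 1 0 n \<omega> t - subdensity 1 0 t\<bar> < g t)"
    by (rule density_converges[OF g_t])
  then show "whp (\<lambda>n \<omega>. (\<Sum>j<n. summand x n j \<omega>) \<le> 0 \<longleftrightarrow>
     real n powr (2 / 5) * (F_naive_at n \<omega> - F\<^sub>0 t) \<le> x)"
  proof (rule whp_mono[OF _ eventually_mono[OF eventually_conj[OF eventually_h[OF t_pos] eventually_gt_at_top[of 0]]]])
    fix n assume n: "(0 < h n \<and> h n < t) \<and> 0 < n"
    show "\<forall>\<omega>\<in>space M. \<bar>kernel_mean 1 0 n \<omega> t - subdensity 1 0 t\<bar> < g t \<longrightarrow>
      ((\<Sum>j<n. summand x n j \<omega>) \<le> 0 \<longleftrightarrow> real n powr (2 / 5) * (F_naive_at n \<omega> - F\<^sub>0 t) \<le> x)"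
    proof (intro ballI impI)
      fix \<omega> assume "\<bar>kernel_mean 1 0 n \<omega> t - subdensity 1 0 t\<bar> < g t"
      moreover have "subdensity 1 0 t = g t" by (simp add: subdensity_def)
      ultimately have "0 < g_est_total n \<omega> t"
        using n dens_est_total_eq_weighted_mean[of "h n" t n \<omega>] by linarith
      then show "(\<Sum>j<n. summand x n j \<omega>) \<le> 0 \<longleftrightarrow> real n powr (2 / 5) * (F_naive_at n \<omega> - F\<^sub>0 t) \<le> x"
        using n by (intro naive_iff_sum) auto
    qed
  qed
qed

lemma F_MS_measurable: "0 < n \<Longrightarrow> random_variable borel (\<lambda>\<omega>. F_MS_at n \<omega>)"
  using h_pos[of n] t_pos by (intro measurable_F_MS) auto

theorem F_MS_limit:
  "(\<lambda>n. prob {\<omega>\<in>space M. real n powr (2 / 5) * (F_MS_at n \<omega> - F\<^sub>0 t) \<le> x})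
     \<longlonglongrightarrow> cdf (normal_law (asymp_mean k f\<^sub>0 g t c) (asymp_var k F\<^sub>0 g t c)) x"
proof (rule prob_tendsto_transfer[OF F_naive_limit])
  show "\<forall>\<^sub>F n in sequentially. {\<omega>\<in>space M. real n powr (2 / 5) * (F_naive_at n \<omega> - F\<^sub>0 t) \<le> x} \<in> events \<and>
     {\<omega>\<in>space M. real n powr (2 / 5) * (F_MS_at n \<omega> - F\<^sub>0 t) \<le> x} \<in> events"
    using eventually_gt_at_top[of 0]
  proof eventually_elim
    case (elim n)
    note [measurable] = F_MS_measurable[OF elim]
    show ?case by (intro conjI) measurable
  qed
  show "whp (\<lambda>n \<omega>. (real n powr (2 / 5) * (F_naive_at n \<omega> - F\<^sub>0 t) \<le> x) \<longleftrightarrow>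
     (real n powr (2 / 5) * (F_MS_at n \<omega> - F\<^sub>0 t) \<le> x))"
    by (rule whp_mono[OF F_MS_eq_F_naive_whp]) auto
qed

lemma weak_conv_mI_cdf:
  fixes U :: "nat \<Rightarrow> 'a \<Rightarrow> real"
  assumes lim: "\<And>x. (\<lambda>n. prob {\<omega>\<in>space M. U n \<omega> \<le> x}) \<longlonglongrightarrow> cdf N x"
    and meas: "\<And>n. 0 < n \<Longrightarrow> random_variable borel (U n)"
  shows "weak_conv_m (\<lambda>n. distr M borel (U n)) N"
  unfolding weak_conv_m_def weak_conv_def
proof (intro allI impI)
  fix x
  have "\<forall>\<^sub>F n in sequentially. prob {\<omega>\<in>space M. U n \<omega> \<le> x} = cdf (distr M borel (U n)) x"
    using eventually_gt_at_top[of 0]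
  proof eventually_elim
    case (elim n)
    show ?case using meas[OF elim] by (simp add: cdf_def measure_distr vimage_def Int_def conj_commute)
  qed
  with lim show "(\<lambda>n. cdf (distr M borel (U n)) x) \<longlonglongrightarrow> cdf N x" by (rule Lim_transform_eventually)
qed

theorem weak_convergence:
  "weak_conv_m (\<lambda>n. distr M borel (\<lambda>\<omega>. real n powr (2 / 5) * (F_MS_at n \<omega> - F\<^sub>0 t)))
     (normal_law (asymp_mean k f\<^sub>0 g t c) (asymp_var k F\<^sub>0 g t c))"
  "weak_conv_m (\<lambda>n. distr M borel (\<lambda>\<omega>. real n powr (2 / 5) * (F_naive_at n \<omega> - F\<^sub>0 t)))
     (normal_law (asymp_mean k f\<^sub>0 g t c) (asymp_var k F\<^sub>0 g t c))"
proof -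
  show "weak_conv_m (\<lambda>n. distr M borel (\<lambda>\<omega>. real n powr (2 / 5) * (F_MS_at n \<omega> - F\<^sub>0 t)))
     (normal_law (asymp_mean k f\<^sub>0 g t c) (asymp_var k F\<^sub>0 g t c))"
  proof (rule weak_conv_mI_cdf[OF F_MS_limit])
    fix n :: nat assume "0 < n"
    note [measurable] = F_MS_measurable[OF this]
    show "random_variable borel (\<lambda>\<omega>. real n powr (2 / 5) * (F_MS_at n \<omega> - F\<^sub>0 t))" by measurable
  qed
  show "weak_conv_m (\<lambda>n. distr M borel (\<lambda>\<omega>. real n powr (2 / 5) * (F_naive_at n \<omega> - F\<^sub>0 t)))
     (normal_law (asymp_mean k f\<^sub>0 g t c) (asymp_var k F\<^sub>0 g t c))"
    by (rule weak_conv_mI_cdf[OF F_naive_limit]) measurable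
qed

lemma optimal_constant:
  assumes nondeg: "g t * deriv f\<^sub>0 t + 2 * f\<^sub>0 t * deriv g t \<noteq> 0"
  shows "is_arg_min (\<lambda>c. (asymp_mean k f\<^sub>0 g t c)\<^sup>2 + asymp_var k F\<^sub>0 g t c) (\<lambda>c. 0 < c) c'
     \<longleftrightarrow> c' = optimal_const k F\<^sub>0 f\<^sub>0 g t"
proof -
  define b where "b = deriv f\<^sub>0 t + 2 * (f\<^sub>0 t * deriv g t / g t)"
  define a where "a = (second_moment k)\<^sup>2 * b\<^sup>2"
  define V where "V = F\<^sub>0 t * (1 - F\<^sub>0 t) / g t * (LINT u|lborel. (k u)\<^sup>2)"
  have "b * g t = g t * deriv f\<^sub>0 t + 2 * f\<^sub>0 t * deriv g t" using g_t by (simp add: b_def field_simps)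
  with nondeg have "b \<noteq> 0" by auto
  then have a: "0 < a" using second_moment_pos by (simp add: a_def)
  have V: "0 < V" using F0_t g_t square_integral_pos by (simp add: V_def)
  have "(asymp_mean k f\<^sub>0 g t c)\<^sup>2 + asymp_var k F\<^sub>0 g t c = c ^ 4 * a / 4 + V / c" for c
  proof -
    have "(asymp_mean k f\<^sub>0 g t c)\<^sup>2 = c ^ 4 * a / 4"
      unfolding asymp_mean_def b_def[symmetric] a_def by (simp add: power_mult_distrib power_divide)
    moreover have "asymp_var k F\<^sub>0 g t c = V / c" by (simp add: asymp_var_def V_def divide_inverse mult_ac)
    ultimately show ?thesis by simp
  qed
  then have "is_arg_min (\<lambda>c. (asymp_mean k f\<^sub>0 g t c)\<^sup>2 + asymp_var k F\<^sub>0 g t c) (\<lambda>c. 0 < c) c'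
      \<longleftrightarrow> c' = V powr (1 / 5) * a powr (- 1 / 5)"
    using optimal_bandwidth[OF a V, of c'] by simp
  then show ?thesis by (simp add: optimal_const_def V_def a_def b_def)
qed

end

section \<open>From the hypotheses to the model\<close>

text \<open>Where the density is continuous it is the derivative of the distribution function, by the
fundamental theorem of calculus.\<close>

lemma (in prob_space) cdf_has_density_derivative:
  fixes f :: "real \<Rightarrow> real"
  assumes dens: "distributed M lborel Y (\<lambda>x. ennreal (f x))" and nn: "\<And>x. 0 \<le> f x"
    and cont: "\<And>u. \<bar>u - t\<bar> \<le> d \<Longrightarrow> isCont f u" and u: "\<bar>u - t\<bar> < d"
  shows "(cdf (distr M borel Y) has_real_derivative f u) (at u)"
proof -
  let ?D = "distr M borel Y" and ?a = "t - d" and ?b = "t + d"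
  have [measurable]: "random_variable borel Y" using dens by (auto simp: distributed_def)
  have [measurable]: "f \<in> borel_measurable borel" by (rule distributed_density_measurable[OF dens nn])
  interpret D: real_distribution ?D by simp
  have cdf: "cdf ?D v = cdf ?D ?a + integral {?a..v} f" if v: "?a \<le> v" "v \<le> ?b" for v
  proof -
    have "continuous_on {?a..v} f" using v by (intro continuous_at_imp_continuous_on ballI cont) (auto simp: abs_le_iff)
    then have int: "set_integrable lborel {?a..v} f" by (rule borel_integrable_atLeastAtMost')
    have "ennreal (cdf ?D v - cdf ?D ?a) = emeasure ?D {?a<..v}" using v by (simp add: D.emeasure_Ioc)
    also have "\<dots> = (\<integral>\<^sup>+x. ennreal (f x) * indicator {?a<..v} x \<partial>lborel)"
      unfolding distributed_distr_borel[OF dens] by (rule emeasure_density) auto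
    also have "\<dots> = (\<integral>\<^sup>+x. ennreal (indicator {?a..v} x *\<^sub>R f x) \<partial>lborel)"
    proof (rule nn_integral_cong_AE)
      show "AE x in lborel. ennreal (f x) * indicator {?a<..v} x = ennreal (indicator {?a..v} x *\<^sub>R f x)"
        using AE_lborel_singleton[of ?a] by eventually_elim (auto simp: indicator_def)
    qed
    also have "\<dots> = ennreal (LINT x:{?a..v}|lborel. f x)"
      unfolding set_lebesgue_integral_def using int nn
      by (intro nn_integral_eq_integral) (auto simp: set_integrable_def)
    also have "(LINT x:{?a..v}|lborel. f x) = integral {?a..v} f" by (rule set_borel_integral_eq_integral(2)[OF int])
    finally have "ennreal (cdf ?D v - cdf ?D ?a) = ennreal (integral {?a..v} f)" .
    moreover have "0 \<le> cdf ?D v - cdf ?D ?a" using D.cdf_nondecreasing[OF v(1)] by simp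
    moreover have "0 \<le> integral {?a..v} f" using nn by (intro integral_nonneg set_borel_integral_eq_integral(1)[OF int]) auto
    ultimately show ?thesis by (simp add: ennreal_inj)
  qed
  have "((\<lambda>v. integral {?a..v} f) has_real_derivative f u) (at u within {?a..?b})"
    using u by (intro integral_has_real_derivative continuous_at_imp_continuous_on ballI cont) (auto simp: abs_le_iff abs_less_iff)
  then have "((\<lambda>v. cdf ?D ?a + integral {?a..v} f) has_real_derivative 0 + f u) (at u within {?a..?b})"
    by (intro DERIV_add DERIV_const)
  then have der: "((\<lambda>v. cdf ?D ?a + integral {?a..v} f) has_real_derivative f u) (at u within {?a..?b})" by simp
  have "(cdf ?D has_real_derivative f u) (at u within {?a..?b})"
    using u by (intro has_field_derivative_transform_within[OF der zero_less_one] cdf[symmetric]) (auto simp: abs_less_iff)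
  then show ?thesis using u by (subst (asm) at_within_interior) (auto simp: abs_less_iff)
qed

text \<open>If the density were positive at a point of continuity, every neighbourhood would have positive mass.\<close>

lemma density_zero_off_support:
  fixes f :: "real \<Rightarrow> real"
  assumes dens: "distributed M lborel Y (\<lambda>x. ennreal (f x))" and nn: "\<And>x. 0 \<le> f x"
    and cont: "isCont f x" and x: "x \<notin> measure_support (distr M borel Y)"
  shows "f x = 0"
proof (rule ccontr)
  assume "f x \<noteq> 0"
  with nn[of x] have pos: "0 < f x" by simp
  obtain U where U: "open U" "x \<in> U" "emeasure (distr M borel Y) U = 0"
    using x by (auto simp: measure_support_def)
  have [measurable]: "f \<in> borel_measurable borel" by (rule distributed_density_measurable[OF dens nn])
  have [measurable]: "U \<in> sets borel" using U(1) by simp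
  have "(\<integral>\<^sup>+y. ennreal (f y) * indicator U y \<partial>lborel) = 0"
    using U(3) unfolding distributed_distr_borel[OF dens] by (subst (asm) emeasure_density) auto
  then have ae: "AE y in lborel. ennreal (f y) * indicator U y = 0"
    by (subst (asm) nn_integral_0_iff_AE) auto
  have "\<forall>\<^sub>F y in nhds x. 0 < f y" using cont pos
    by (intro order_tendstoD(1)[of f "f x"]) (auto simp: isCont_def tendsto_at_iff_tendsto_nhds)
  moreover have "\<forall>\<^sub>F y in nhds x. y \<in> U" using U by (intro eventually_nhds_in_open)
  ultimately have "\<forall>\<^sub>F y in nhds x. 0 < f y \<and> y \<in> U" by (rule eventually_conj)
  then obtain d where d: "0 < d" "\<And>y. dist y x < d \<Longrightarrow> 0 < f y \<and> y \<in> U"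
    unfolding eventually_nhds_metric by blast
  have "AE y in lborel. y \<notin> {x<..<x + d}"
    using ae
  proof eventually_elim
    case (elim y)
    show ?case using elim d(2)[of y] by (auto simp: dist_real_def)
  qed
  then have "{x<..<x + d} \<in> null_sets lborel" by (subst AE_iff_null_sets) auto
  then show False using d(1) by (simp add: null_sets_def)
qed

theorem theorem3p5:
  fixes M :: "'a measure"
    and X T :: "nat \<Rightarrow> 'a \<Rightarrow> real"
    and \<Delta> :: "nat \<Rightarrow> 'a \<Rightarrow> nat"
    and F\<^sub>0 G f\<^sub>0 g k :: "real \<Rightarrow> real"
    and M\<^sub>0 t :: real
  defines "\<Delta> \<equiv> \<lambda>j \<omega>. if X j \<omega> \<le> T j \<omega> then 1 else 0"
  assumes M: "prob_space M"
    \<comment> \<open>mutual independence of all the \<open>X i\<close> and all the \<open>T i\<close>\<close>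
    and indep: "prob_space.indep_vars M (\<lambda>_. borel) (case_sum X T) UNIV"
    and X_cdf: "\<And>i. cdf (distr M borel (X i)) = F\<^sub>0"
    and X_pos: "\<And>x. x < 0 \<Longrightarrow> F\<^sub>0 x = 0"
    and X_dens: "\<And>i. distributed M lborel (X i) (\<lambda>x. ennreal (f\<^sub>0 x))"
    and f0_nonneg: "\<And>x. 0 \<le> f\<^sub>0 x"
    and T_cdf: "\<And>i. cdf (distr M borel (T i)) = G"
    and T_pos: "\<And>x. x < 0 \<Longrightarrow> G x = 0"
    and T_dens: "\<And>i. distributed M lborel (T i) (\<lambda>x. ennreal (g x))"
    and g_nonneg: "\<And>x. 0 \<le> g x"
    and kernel: "smoothing_kernel k"
    \<comment> \<open>condition (F)\<close>
    and F_supp: "\<And>i. measure_support (distr M borel (X i)) = {0..M\<^sub>0}"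
    and F_mono: "strict_mono_on {0..M\<^sub>0} F\<^sub>0"
    and f0_away: "\<exists>\<delta>>0. \<forall>x\<in>{0..M\<^sub>0}. \<delta> \<le> f\<^sub>0 x"
    \<comment> \<open>condition (G)\<close>
    and G_supp: "\<And>i. measure_support (distr M borel (T i)) = {0..}"
    and G_mono: "strict_mono_on {0..M\<^sub>0} G"
    and g_away: "\<exists>\<delta>>0. \<forall>x\<in>{0..M\<^sub>0}. \<delta> \<le> g x"
    and g'_bdd: "\<exists>B. \<forall>x\<in>{0..M\<^sub>0}. \<exists>d. (g has_real_derivative d) (at x within {0..M\<^sub>0}) \<and> \<bar>d\<bar> \<le> B"
    \<comment> \<open>the point \<open>t\<close>\<close>
    and t_pos: "0 < t"
    and f0_smooth: "cont_second_deriv_at f\<^sub>0 t"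
    and g_smooth: "cont_second_deriv_at g t"
    and nondeg: "g t * deriv f\<^sub>0 t + 2 * f\<^sub>0 t * deriv g t \<noteq> 0"
  shows "(\<forall>c>0. weak_conv_m
            (\<lambda>n. distr M borel (\<lambda>\<omega>. real n powr (2 / 5) *
               (F_MS k (bandwidth c n) n (\<lambda>j. T j \<omega>) (\<lambda>j. \<Delta> j \<omega>) t - F\<^sub>0 t)))
            (normal_law (asymp_mean k f\<^sub>0 g t c) (asymp_var k F\<^sub>0 g t c))) \<and>
         (\<forall>c>0. weak_conv_m
            (\<lambda>n. distr M borel (\<lambda>\<omega>. real n powr (2 / 5) *
               (F_naive k (bandwidth c n) n (\<lambda>j. T j \<omega>) (\<lambda>j. \<Delta> j \<omega>) t - F\<^sub>0 t)))
            (normal_law (asymp_mean k f\<^sub>0 g t c) (asymp_var k F\<^sub>0 g t c))) \<and>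
         (\<forall>c. is_arg_min (\<lambda>c. (asymp_mean k f\<^sub>0 g t c)\<^sup>2 + asymp_var k F\<^sub>0 g t c) (\<lambda>c. 0 < c) c
              \<longleftrightarrow> c = optimal_const k F\<^sub>0 f\<^sub>0 g t)"
proof -
  interpret prob_space M by (rule M)
  have X_rv [measurable]: "random_variable borel (X i)" and T_rv [measurable]: "random_variable borel (T i)" for i
    using X_dens[of i] T_dens[of i] by (auto simp: distributed_def)
  have T_nonneg: "AE \<omega> in M. 0 \<le> T i \<omega>" for i
  proof -
    \<comment> \<open>\<open>{T i < 0}\<close> is exhausted by countably many events of probability
        \<open>G x\<close> with \<open>x < 0\<close>.\<close>
    have "AE \<omega> in M. - (1 / real (Suc m)) < T i \<omega>" for m
    proof -
      have "prob {\<omega>\<in>space M. T i \<omega> \<le> - (1 / real (Suc m))} = G (- (1 / real (Suc m)))"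
        unfolding T_cdf[of i, symmetric] by (simp add: cdf_def measure_distr vimage_def Int_def conj_commute)
      also have "\<dots> = 0" by (rule T_pos) simp
      finally have "AE \<omega> in M. \<omega> \<notin> {\<omega>\<in>space M. T i \<omega> \<le> - (1 / real (Suc m))}"
        by (subst (asm) prob_eq_0) auto
      then show ?thesis using AE_space by eventually_elim auto
    qed
    then have "AE \<omega> in M. \<forall>m. - (1 / real (Suc m)) < T i \<omega>" by (simp add: AE_all_countable)
    then show ?thesis
    proof eventually_elim
      case (elim \<omega>)
      show ?case
      proof (rule ccontr)
        assume "\<not> 0 \<le> T i \<omega>"
        then obtain m where "1 / real (Suc m) < - T i \<omega>" using nat_approx_posE[of "- T i \<omega>"] by auto
        then show False using elim[rule_format, of m] by linarith
      qed
    qed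
  qed
  have f0_ev: "\<forall>\<^sub>F u in nhds t. f\<^sub>0 differentiable (at u)" "f\<^sub>0 differentiable (at t)"
    using f0_smooth unfolding cont_second_deriv_at_def by (auto elim: eventually_mono dest: eventually_nhds_x_imp_x)
  have g_ev: "\<forall>\<^sub>F u in nhds t. g differentiable (at u)" "deriv g differentiable (at t)"
    using g_smooth unfolding cont_second_deriv_at_def by (auto elim: eventually_mono dest: eventually_nhds_x_imp_x)
  obtain d where d: "0 < d" "\<And>u. dist u t < d \<Longrightarrow> f\<^sub>0 differentiable (at u)"
    using f0_ev(1) unfolding eventually_nhds_metric by blast
  have f0_cont: "isCont f\<^sub>0 u" if "\<bar>u - t\<bar> < d" for u
    using d(2)[of u] that by (auto simp: dist_real_def dest: differentiable_imp_continuous_within)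
  have f0_beyond: "f\<^sub>0 u = 0" if "\<bar>u - t\<bar> < d" "M\<^sub>0 < u" for u
    by (rule density_zero_off_support[OF X_dens[of 0] f0_nonneg f0_cont]) (use that F_supp[of 0] in auto)
  have t_less: "t < M\<^sub>0"
  proof (rule ccontr)
    assume not: "\<not> t < M\<^sub>0"
    \<comment> \<open>Right of \<open>t \<ge> M\<^sub>0\<close> the density vanishes, hence also at
        \<open>t\<close>. For \<open>t = M\<^sub>0\<close> this contradicts the lower bound on the
        support, and for \<open>t > M\<^sub>0\<close> the derivative vanishes as well.\<close>
    have "(f\<^sub>0 \<longlongrightarrow> f\<^sub>0 t) (at_right t)" using f0_cont[of t] d(1) by (auto simp: isCont_def filterlim_at_split)
    moreover have "\<forall>\<^sub>F u in at_right t. f\<^sub>0 u = 0"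
      unfolding eventually_at_right_field using f0_beyond not d(1) by (intro exI[of _ "t + d"]) auto
    then have "(f\<^sub>0 \<longlongrightarrow> 0) (at_right t)" by (rule tendsto_eventually)
    ultimately have f0t: "f\<^sub>0 t = 0" using tendsto_unique[of "at_right t" f\<^sub>0] by auto
    show False
    proof (cases "t = M\<^sub>0")
      case True
      obtain \<delta> where "0 < \<delta>" "\<And>x. x \<in> {0..M\<^sub>0} \<Longrightarrow> \<delta> \<le> f\<^sub>0 x" using f0_away by blast
      then show False using True f0t t_pos by (metis atLeastAtMost_iff less_imp_le not_less order_refl)
    next
      case False
      then have "M\<^sub>0 < t" using not by simp
      then have "\<forall>\<^sub>F u in nhds t. \<bar>u - t\<bar> < d \<and> M\<^sub>0 < u"
        using d(1) unfolding eventually_nhds_metric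
        by (intro exI[of _ "min d (t - M\<^sub>0)"]) (auto simp: dist_real_def abs_less_iff)
      then have "\<forall>\<^sub>F u in nhds t. f\<^sub>0 u = (\<lambda>_. 0) u" by eventually_elim (use f0_beyond in auto)
      then have "deriv f\<^sub>0 t = 0" using deriv_cong_ev[of f\<^sub>0 "\<lambda>_. 0" t t] by simp
      then show False using nondeg f0t by simp
    qed
  qed
  have F0_deriv: "\<forall>\<^sub>F u in nhds t. (F\<^sub>0 has_real_derivative f\<^sub>0 u) (at u)"
    unfolding eventually_nhds_metric
  proof (intro exI[of _ "d / 2"] conjI allI impI)
    show "0 < d / 2" using d(1) by simp
    fix u assume u: "dist u t < d / 2"
    have "isCont f\<^sub>0 v" if "\<bar>v - t\<bar> \<le> d / 2" for v using that d(1) by (intro f0_cont) linarith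
    from cdf_has_density_derivative[where t = t and d = "d / 2", OF X_dens[of 0] f0_nonneg this, of u] u
    show "(F\<^sub>0 has_real_derivative f\<^sub>0 u) (at u)" by (simp add: X_cdf dist_real_def)
  qed
  have setting: "smoothed_current_status M X T F\<^sub>0 g k f\<^sub>0 M\<^sub>0 t c" if c: "0 < c" for c
  proof
    show "indep_vars (\<lambda>_. borel) (case_sum X T) UNIV" by (rule indep)
    show "cdf (distr M borel (X i)) = F\<^sub>0" for i by (rule X_cdf)
    show "distributed M lborel (T i) (\<lambda>x. ennreal (g x))" for i by (rule T_dens)
    show "0 \<le> g x" for x by (rule g_nonneg)
    show "AE \<omega> in M. 0 \<le> T i \<omega>" for i by (rule T_nonneg)
    show "smoothing_kernel k" by (rule kernel)
    show "0 < c" "0 < t" "t < M\<^sub>0" by fact+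
    show "\<forall>\<^sub>F u in nhds t. (F\<^sub>0 has_real_derivative f\<^sub>0 u) (at u)" by (rule F0_deriv)
    show "(f\<^sub>0 has_real_derivative deriv f\<^sub>0 t) (at t)" using f0_ev(2) by (simp add: DERIV_deriv_iff_real_differentiable)
    show "\<forall>\<^sub>F u in nhds t. (g has_real_derivative deriv g u) (at u)"
      using g_ev(1) by eventually_elim (simp add: DERIV_deriv_iff_real_differentiable)
    show "isCont (deriv g) t" using g_ev(2) by (rule differentiable_imp_continuous_within)
    obtain \<delta> where "0 < \<delta>" "\<And>x. x \<in> {0..M\<^sub>0} \<Longrightarrow> \<delta> \<le> f\<^sub>0 x" using f0_away by blast
    then show "0 < f\<^sub>0 t" using t_pos t_less by (meson atLeastAtMost_iff less_imp_le less_le_trans)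
    show "strict_mono_on {0..M\<^sub>0} F\<^sub>0" by (rule F_mono)
    show "\<exists>\<delta>>0. \<forall>x\<in>{0..M\<^sub>0}. \<delta> \<le> g x" by (rule g_away)
  qed
  show ?thesis
  proof (intro conjI allI impI)
    fix c :: real assume "0 < c"
    then interpret smoothed_current_status M X T F\<^sub>0 g k f\<^sub>0 M\<^sub>0 t c by (rule setting)
    show "weak_conv_m (\<lambda>n. distr M borel (\<lambda>\<omega>. real n powr (2 / 5) *
               (F_MS k (bandwidth c n) n (\<lambda>j. T j \<omega>) (\<lambda>j. \<Delta> j \<omega>) t - F\<^sub>0 t)))
            (normal_law (asymp_mean k f\<^sub>0 g t c) (asymp_var k F\<^sub>0 g t c))"
      unfolding \<Delta>_def by (rule weak_convergence(1))
    show "weak_conv_m (\<lambda>n. distr M borel (\<lambda>\<omega>. real n powr (2 / 5) *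
               (F_naive k (bandwidth c n) n (\<lambda>j. T j \<omega>) (\<lambda>j. \<Delta> j \<omega>) t - F\<^sub>0 t)))
            (normal_law (asymp_mean k f\<^sub>0 g t c) (asymp_var k F\<^sub>0 g t c))"
      unfolding \<Delta>_def by (rule weak_convergence(2))
  next
    fix c :: real
    \<comment> \<open>The minimisation ranges over the bandwidth constant, so the setting may be taken
        with any positive value of it.\<close>
    interpret smoothed_current_status M X T F\<^sub>0 g k f\<^sub>0 M\<^sub>0 t 1 by (rule setting) simp
    show "is_arg_min (\<lambda>c. (asymp_mean k f\<^sub>0 g t c)\<^sup>2 + asymp_var k F\<^sub>0 g t c) (\<lambda>c. 0 < c) c
              \<longleftrightarrow> c = optimal_const k F\<^sub>0 f\<^sub>0 g t"
      by (rule optimal_constant[OF nondeg])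
  qed
qed

end
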